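(* Let $3\le n<m$, and let $\beta:L_P^2\times_R(\overline{R\cdot\mathsf p})\to\overline{L_P^2\cdot\mathsf p}$ be the morphism $[g,f]\mapsto g\cdot f$. Then the inverse image $\beta^{-1}(L_P^2\cdot\mathsf p)$ equals $L_P^2\times_R(R\cdot\mathsf p)$. Moreover, the restriction $\beta_o$ of $\beta$ to $L_P^2\times_R(R\cdot\mathsf p)$ is a biregular isomorphism onto $L_P^2\cdot\mathsf p$.
   Context: All varieties are over $\mathbb C$. Let $\mathfrak v$ be a complex vector space of dimension $m$ with basis $e_1,\dots,e_m$, $E=\operatorname{End}\mathfrak v$ (identified with $m\times m$ matrices $X=(x_{i,j})$), with basis of matrix units $e_{i,j}=e_i\otimes e_j^*$; $G=\operatorname{GL}(E)$, and $Q=S^m(E^* )$, the homogeneous polynomial functions of degree $m$ on $E$, with $G$ acting by $(g\cdot q)(X)=q(g^{-1}X)$. Define $\mathsf p\in Q$ by $\mathsf p(X)=x_{1,1}^{m-n}\operatorname{perm}(X^o)$, where $X^o=(x_{i,j})_{m-n+1\le i,j\le m}$ and $\operatorname{perm}$ is the permanent. Let $S\subset E$ be the span of $e_{1,1}$ and all $e_{i,j}$ with $m-n+1\le i,j\le m$, and $S^\perp$ the span of the remaining $e_{i,j}$, so $E=S^\perp\oplus S$. $L_P^2=\operatorname{GL}(S)$, viewed as a subgroup of $G$ acting as the identity on $S^\perp$; $R\subset L_P^2$ is the parabolic subgroup of elements stabilizing the line $\mathbb Ce_{1,1}$. Closures are Zariski closures in $Q$ (reduced). $L_P^2\times_R W$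 denotes the fiber bundle $(L_P^2\times W)/R$ over $L_P^2/R$ associated to the $R$-variety $W$. *)

theory Defs
  imports "HOL-Analysis.Analysis"
begin

section \<open>Varieties as spaces with functions\<close>

text \<open>An affine space is presented by a set \<open>C\<close> of complex-valued functions on a type that
  generates its coordinate ring.  A quasi-affine variety is a locally closed subset \<open>V\<close> of it.\<close>

inductive_set poly_funs :: "('a \<Rightarrow> complex) set \<Rightarrow> ('a \<Rightarrow> complex) set"
  for C :: "('a \<Rightarrow> complex) set" where
  const: "(\<lambda>_. c) \<in> poly_funs C"
| gen: "f \<in> C \<Longrightarrow> f \<in> poly_funs C"
| add: "f \<in> poly_funs C \<Longrightarrow> h \<in> poly_funs C \<Longrightarrow> (\<lambda>x. f x + h x) \<in> poly_funs C"
| mult: "f \<in> poly_funs C \<Longrightarrow> h \<in> poly_funs C \<Longrightarrow> (\<lambda>x. f x * h x) \<in> poly_funs C"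

definition zariski :: "('a \<Rightarrow> complex) set \<Rightarrow> 'a set \<Rightarrow> 'a topology" where
  "zariski C V = topology_generated_by {{x \<in> V. f x \<noteq> 0} | f. f \<in> poly_funs C}"

text \<open>\<open>regular\<close> gives the sections of the structure sheaf.  Sections over \<open>U\<close> are represented by
  total functions, of which only the values on \<open>U\<close> matter.\<close>

record 'a variety =
  topol :: "'a topology"
  regular :: "'a set \<Rightarrow> ('a \<Rightarrow> complex) set"

definition quasi_affine :: "('a \<Rightarrow> complex) set \<Rightarrow> 'a set \<Rightarrow> 'a variety" where
  "quasi_affine C V = \<lparr>topol = zariski C V,
     regular = (\<lambda>U. {\<phi>. \<forall>x\<in>U. \<exists>U' a b. openin (zariski C V) U' \<and> x \<in> U' \<and> U' \<subseteq> U \<and>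
        a \<in> poly_funs C \<and> b \<in> poly_funs C \<and> (\<forall>y\<in>U'. b y \<noteq> 0 \<and> \<phi> y = a y / b y)})\<rparr>"

definition morphism :: "'a variety \<Rightarrow> 'b variety \<Rightarrow> ('a \<Rightarrow> 'b) \<Rightarrow> bool" where
  "morphism X Y \<phi> \<longleftrightarrow> continuous_map (topol X) (topol Y) \<phi> \<and>
     (\<forall>U f. openin (topol Y) U \<longrightarrow> f \<in> regular Y U \<longrightarrow>
        f \<circ> \<phi> \<in> regular X {x \<in> topspace (topol X). \<phi> x \<in> U})"

definition biregular_iso :: "'a variety \<Rightarrow> 'b variety \<Rightarrow> ('a \<Rightarrow> 'b) \<Rightarrow> bool" where
  "biregular_iso X Y \<phi> \<longleftrightarrow> morphism X Y \<phi> \<and>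
     (\<exists>\<psi>. morphism Y X \<psi> \<and> (\<forall>x\<in>topspace (topol X). \<psi> (\<phi> x) = x) \<and>
          (\<forall>y\<in>topspace (topol Y). \<phi> (\<psi> y) = y))"

definition quotient_topology :: "'a topology \<Rightarrow> ('a \<Rightarrow> 'b) \<Rightarrow> 'b topology" where
  "quotient_topology T \<pi> =
     topology (\<lambda>U. U \<subseteq> \<pi> ` topspace T \<and> openin T {x \<in> topspace T. \<pi> x \<in> U})"

lemma openin_quotient_topology:
  "openin (quotient_topology T \<pi>) U \<longleftrightarrow>
     U \<subseteq> \<pi> ` topspace T \<and> openin T {x \<in> topspace T. \<pi> x \<in> U}"
proof -
  let ?P = "\<lambda>U. U \<subseteq> \<pi> ` topspace T \<and> openin T {x \<in> topspace T. \<pi> x \<in> U}"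
  have "istopology ?P"
    unfolding istopology_def
  proof (intro conjI allI impI; (elim conjE)?)
    fix A B assume "openin T {x \<in> topspace T. \<pi> x \<in> A}" "openin T {x \<in> topspace T. \<pi> x \<in> B}"
    moreover have "{x \<in> topspace T. \<pi> x \<in> A \<inter> B} =
        {x \<in> topspace T. \<pi> x \<in> A} \<inter> {x \<in> topspace T. \<pi> x \<in> B}" by auto
    ultimately show "openin T {x \<in> topspace T. \<pi> x \<in> A \<inter> B}" by auto
  next
    fix K assume "\<forall>A\<in>K. ?P A"
    moreover have "{x \<in> topspace T. \<pi> x \<in> \<Union>K} = (\<Union>A\<in>K. {x \<in> topspace T. \<pi> x \<in> A})" by auto
    ultimately show "openin T {x \<in> topspace T. \<pi> x \<in> \<Union>K}" by auto
  qed blast+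
  then show ?thesis
    unfolding quotient_topology_def by (simp add: topology_inverse')
qed

definition quotient_variety :: "'a variety \<Rightarrow> ('a \<Rightarrow> 'b) \<Rightarrow> 'b variety" where
  "quotient_variety X \<pi> = \<lparr>topol = quotient_topology (topol X) \<pi>,
     regular = (\<lambda>U. {f. f \<circ> \<pi> \<in> regular X {x \<in> topspace (topol X). \<pi> x \<in> U}})\<rparr>"

section \<open>The representation of GL(E) on forms of degree m\<close>

text \<open>\<open>E\<close> is the space of matrices over the index type \<open>'m\<close>, flattened to vectors over
  \<open>'m \<times> 'm\<close>, so that \<open>End E\<close> is the space of square matrices over \<open>'m \<times> 'm\<close> and \<open>GL(E)\<close> its subset
  of invertible matrices.  An enumeration \<open>e\<close> of \<open>'m\<close> by \<open>{1..m}\<close> numbers the basis of the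
  underlying \<open>m\<close>-dimensional space.\<close>

type_synonym 'm E = "complex ^ ('m \<times> 'm)"
type_synonym 'm End_E = "complex ^ ('m \<times> 'm) ^ ('m \<times> 'm)"

definition coords_E :: "('m::finite E \<Rightarrow> complex) set" where
  "coords_E = range (\<lambda>a X. X $ a)"

definition coords_End :: "('m::finite End_E \<Rightarrow> complex) set" where
  "coords_End = range (\<lambda>(a, b) g. g $ a $ b)"

definition forms :: "nat \<Rightarrow> ('m::finite E \<Rightarrow> complex) set" where
  "forms d = {q \<in> poly_funs coords_E. \<forall>c X. q (c *s X) = c ^ d * q X}"

text \<open>The linear functionals on \<open>forms d\<close>; their values elsewhere are irrelevant.\<close>

definition coords_forms :: "nat \<Rightarrow> (('m::finite E \<Rightarrow> complex) \<Rightarrow> complex) set" where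
  "coords_forms d = {l. \<forall>q\<in>forms d. \<forall>r\<in>forms d. \<forall>a b.
      l (\<lambda>X. a * q X + b * r X) = a * l q + b * l r}"

definition act :: "'m::finite End_E \<Rightarrow> ('m E \<Rightarrow> complex) \<Rightarrow> ('m E \<Rightarrow> complex)" where
  "act g q = (\<lambda>X. q (matrix_inv g *v X))"

definition orbit :: "'m::finite End_E set \<Rightarrow> ('m E \<Rightarrow> complex) \<Rightarrow> ('m E \<Rightarrow> complex) set" where
  "orbit H q = (\<lambda>g. act g q) ` H"

definition orbit_closure ::
  "nat \<Rightarrow> 'm::finite End_E set \<Rightarrow> ('m E \<Rightarrow> complex) \<Rightarrow> ('m E \<Rightarrow> complex) set" where
  "orbit_closure d H q = zariski (coords_forms d) (forms d) closure_of (orbit H q)"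

abbreviation forms_variety :: "nat \<Rightarrow> ('m::finite E \<Rightarrow> complex) set \<Rightarrow> ('m E \<Rightarrow> complex) variety" where
  "forms_variety d W \<equiv> quasi_affine (coords_forms d) W"

section \<open>The padded permanent\<close>

definition permanent :: "'i set \<Rightarrow> ('i \<Rightarrow> 'i \<Rightarrow> complex) \<Rightarrow> complex" where
  "permanent I M = (\<Sum>\<sigma> | \<sigma> permutes I. \<Prod>i\<in>I. M i (\<sigma> i))"

definition padded_perm :: "(nat \<Rightarrow> 'm::finite) \<Rightarrow> nat \<Rightarrow> nat \<Rightarrow> 'm E \<Rightarrow> complex" where
  "padded_perm e m n X =
     (X $ (e 1, e 1)) ^ (m - n) * permanent {m - n + 1..m} (\<lambda>i j. X $ (e i, e j))"

definition unit_E :: "(nat \<Rightarrow> 'm::finite) \<Rightarrow> nat \<times> nat \<Rightarrow> 'm E" where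
  "unit_E e = (\<lambda>(i, j). axis (e i, e j) 1)"

definition S_index :: "nat \<Rightarrow> nat \<Rightarrow> (nat \<times> nat) set" where
  "S_index m n = insert (1, 1) ({m - n + 1..m} \<times> {m - n + 1..m})"

definition S_space :: "(nat \<Rightarrow> 'm::finite) \<Rightarrow> nat \<Rightarrow> nat \<Rightarrow> 'm E set" where
  "S_space e m n = vec.span (unit_E e ` S_index m n)"

definition S_perp :: "(nat \<Rightarrow> 'm::finite) \<Rightarrow> nat \<Rightarrow> nat \<Rightarrow> 'm E set" where
  "S_perp e m n = vec.span (unit_E e ` (({1..m} \<times> {1..m}) - S_index m n))"

definition LP2 :: "(nat \<Rightarrow> 'm::finite) \<Rightarrow> nat \<Rightarrow> nat \<Rightarrow> 'm End_E set" where
  "LP2 e m n = {g. invertible g \<and> (\<lambda>X. g *v X) ` S_space e m n = S_space e m n \<and> (\<forall>X\<in>S_perp e m n. g *v X = X)}"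

definition R_LP2 :: "(nat \<Rightarrow> 'm::finite) \<Rightarrow> nat \<Rightarrow> nat \<Rightarrow> 'm End_E set" where
  "R_LP2 e m n = {g \<in> LP2 e m n. (\<lambda>X. g *v X) ` vec.span {unit_E e (1, 1)} = vec.span {unit_E e (1, 1)}}"

section \<open>Associated fiber bundles\<close>

text \<open>The class \<open>[g, f]\<close> is the orbit of \<open>(g, f)\<close> under \<open>r \<cdot> (g, f) = (g r\<^sup>-\<^sup>1, r \<cdot> f)\<close>.\<close>

definition bundle_class :: "'m::finite End_E set \<Rightarrow> 'm End_E \<times> ('m E \<Rightarrow> complex) \<Rightarrow>
    ('m End_E \<times> ('m E \<Rightarrow> complex)) set" where
  "bundle_class H = (\<lambda>(g, f). (\<lambda>r. (g ** matrix_inv r, act r f)) ` H)"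

definition bundle_points :: "'m::finite End_E set \<Rightarrow> 'm End_E set \<Rightarrow> ('m E \<Rightarrow> complex) set \<Rightarrow>
    ('m End_E \<times> ('m E \<Rightarrow> complex)) set set" where
  "bundle_points L H W = bundle_class H ` (L \<times> W)"

text \<open>The variety structure on \<open>(L \<times> W)/H\<close> is that of the geometric quotient: quotient topology,
  and functions on the quotient are regular iff their pullbacks to \<open>L \<times> W\<close> are.\<close>

definition assoc_bundle :: "nat \<Rightarrow> 'm::finite End_E set \<Rightarrow> 'm End_E set \<Rightarrow> ('m E \<Rightarrow> complex) set \<Rightarrow>
    ('m End_E \<times> ('m E \<Rightarrow> complex)) set variety" where
  "assoc_bundle d L H W = quotient_variety
     (quasi_affine ((\<lambda>c. c \<circ> fst) ` coords_End \<union> (\<lambda>c. c \<circ> snd) ` coords_forms d) (L \<times> W))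
     (bundle_class H)"

definition beta :: "('m::finite End_E \<times> ('m E \<Rightarrow> complex)) set \<Rightarrow> 'm E \<Rightarrow> complex" where
  "beta c = the_elem ((\<lambda>(g, f). act g f) ` c)"

end

theory Submission
  imports Defs
begin

text \<open>\<^emph>\<open>Preimage of the orbit.\<close>  Write \<open>k = m - n\<close>.  Every form in \<open>R \<cdot> p\<close> is \<open>l\<^sup>k h\<close> with \<open>l\<close> linear and
  \<open>h\<close> constant in the direction \<open>e\<^sub>1\<^sub>1\<close>, so \<open>F\<close> divided by its derivative in this direction is additive.
  With denominators cleared this is a polynomial condition on \<open>F\<close>, hence it holds on the closure of
  \<open>R \<cdot> p\<close>.  Evaluating it on sparse matrices shows that it holds for \<open>p\<close> in a direction \<open>v \<in> S\<close> only
  if \<open>v\<close> is a multiple of \<open>e\<^sub>1\<^sub>1\<close>.  So if \<open>g \<cdot> p\<close> lies in the closure of \<open>R \<cdot> p\<close>, then \<open>g \<in> R\<close>.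
  In particular the stabiliser of \<open>p\<close> is contained in \<open>R\<close>, and \<open>\<beta>\<^sub>o\<close> is bijective.

  \<^emph>\<open>Regularity of the inverse.\<close>  The line \<open>g e\<^sub>1\<^sub>1\<close> has to be recovered from \<open>F = g \<cdot> p\<close> by local
  regular functions.  The traceless \<open>B \<in> End S\<close> which annihilate \<open>F\<close> as derivations are the solutions of a
  linear system depending polynomially on \<open>F\<close>, of constant rank on the orbit, and they all kill
  \<open>g e\<^sub>1\<^sub>1\<close>.  Cramer's rule extends a solution of corank one at a given point of the orbit to a
  neighbourhood; its kernel is the line, and Cramer's rule also yields a regular generator of it.\<close>

section \<open>Regular functions on quasi-affine varieties\<close>

text \<open>A bijective morphism need not have a regular inverse, so the inverse is built explicitly
  from local lifts to the product. A coset \<open>g R\<close> in \<open>L\<close> is determined by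
  the line through \<open>g e11\<close>; a lift therefore only has to find a vector on this line,
  and its other columns can be frozen at a nearby group element. The trace condition excludes an
  obvious obstruction: scaling \<open>e11\<close> by \<alpha> and the block X^o by - k \<alpha> / n
  annihilates \<open>p\<close> without killing \<open>e11\<close>. Its trace is \<alpha> (1 - n k),
  which is nonzero for \<alpha> nonzero because n k is not 1. In the other direction there must be a
  traceless annihilator that kills nothing else in S; scaling the rows of the block with nonzero
  weights of sum 0 provides one. For the preimage, the factorisation l^k h is replaced by the
  additivity condition since the latter is, for each pair of points, one cubic equation in values
  and derivatives of the form. Proportional points satisfy it by homogeneity alone, so the test
  points have to be chosen off a common line.\<close>

lemma poly_funs_sum:
  "finite I \<Longrightarrow> (\<And>i. i \<in> I \<Longrightarrow> f i \<in> poly_funs C) \<Longrightarrow> (\<lambda>x. \<Sum>i\<in>I. f i x) \<in> poly_funs C"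
  by (induction I rule: finite_induct) (auto intro: poly_funs.intros)

lemma poly_funs_prod:
  "finite I \<Longrightarrow> (\<And>i. i \<in> I \<Longrightarrow> f i \<in> poly_funs C) \<Longrightarrow> (\<lambda>x. \<Prod>i\<in>I. f i x) \<in> poly_funs C"
  by (induction I rule: finite_induct) (auto intro: poly_funs.intros)

lemma poly_funs_power: "f \<in> poly_funs C \<Longrightarrow> (\<lambda>x. f x ^ k) \<in> poly_funs C"
  by (induction k) (auto intro: poly_funs.intros)

lemma topspace_zariski [simp]: "topspace (zariski C V) = V"
proof -
  have "V \<in> {{x \<in> V. f x \<noteq> 0} | f. f \<in> poly_funs C}"
    by (rule CollectI, rule exI[of _ "\<lambda>_. 1"]) (auto intro: poly_funs.const)
  then show ?thesis unfolding zariski_def topology_generated_by_topspace by auto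
qed

lemma openin_zariski_basic: "f \<in> poly_funs C \<Longrightarrow> openin (zariski C V) {x \<in> V. f x \<noteq> 0}"
  unfolding zariski_def openin_topology_generated_by_iff
  by (rule generate_topology_on.Basis) auto

text \<open>Basic open sets are closed under intersection, because the product of two functions is
  nonzero exactly where both are. Hence the generating sets form a base and not merely a
  subbase.\<close>

lemma openin_zariski_iff:
  "openin (zariski C V) U \<longleftrightarrow>
    U \<subseteq> V \<and> (\<forall>x\<in>U. \<exists>f\<in>poly_funs C. f x \<noteq> 0 \<and> {y \<in> V. f y \<noteq> 0} \<subseteq> U)" (is "_ \<longleftrightarrow> ?R U")
proof
  assume "openin (zariski C V) U"
  then have "generate_topology_on {{x \<in> V. f x \<noteq> 0} | f. f \<in> poly_funs C} U"
    unfolding zariski_def openin_topology_generated_by_iff .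
  then show "?R U"
  proof (induction rule: generate_topology_on.induct)
    case (Int a b)
    have "\<exists>f\<in>poly_funs C. f x \<noteq> 0 \<and> {y \<in> V. f y \<noteq> 0} \<subseteq> a \<inter> b" if x: "x \<in> a \<inter> b" for x
    proof -
      obtain f h where "f \<in> poly_funs C" "h \<in> poly_funs C" "f x \<noteq> 0" "h x \<noteq> 0"
        "{y \<in> V. f y \<noteq> 0} \<subseteq> a" "{y \<in> V. h y \<noteq> 0} \<subseteq> b" using Int x by blast
      then show ?thesis by (intro bexI[of _ "\<lambda>x. f x * h x"] poly_funs.mult) auto
    qed
    then show ?case using Int by blast
  next
    case (UN K)
    have "\<exists>f\<in>poly_funs C. f x \<noteq> 0 \<and> {y \<in> V. f y \<noteq> 0} \<subseteq> \<Union>K" if "x \<in> \<Union>K" for x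
      using UN that by (meson UnionE Sup_upper order_trans)
    then show ?case using UN by blast
  qed auto
next
  assume R: "?R U"
  then obtain F where F: "\<And>x. x \<in> U \<Longrightarrow> F x \<in> poly_funs C \<and> F x x \<noteq> 0 \<and> {y \<in> V. F x y \<noteq> 0} \<subseteq> U"
    by metis
  then have "U = (\<Union>x\<in>U. {y \<in> V. F x y \<noteq> 0})" using R by fast
  moreover have "openin (zariski C V) (\<Union>x\<in>U. {y \<in> V. F x y \<noteq> 0})"
    using F openin_zariski_basic by (intro openin_Union) blast
  ultimately show "openin (zariski C V) U" by simp
qed

text \<open>Zero sets of polynomial functions are closed; this carries identities from an orbit to
  its closure.\<close>

lemma closure_of_zariski_vanishing:
  assumes "f \<in> poly_funs C" and "\<And>x. x \<in> A \<Longrightarrow> f x = 0" and "x \<in> zariski C V closure_of A"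
  shows "f x = 0"
proof (rule ccontr)
  assume "f x \<noteq> 0"
  moreover have "x \<in> V" using assms(3) by (simp add: in_closure_of)
  ultimately have "x \<in> {x \<in> V. f x \<noteq> 0}" by simp
  then obtain y where "y \<in> A" "y \<in> {x \<in> V. f x \<noteq> 0}"
    using assms(3) openin_zariski_basic[OF assms(1), of V] unfolding in_closure_of by metis
  then show False using assms(2) by simp
qed

text \<open>Names the sections with coordinates, carrier and open set as separate arguments, so that
  closure rules can be stated and applied without the record.\<close>

definition reg :: "('a \<Rightarrow> complex) set \<Rightarrow> 'a set \<Rightarrow> 'a set \<Rightarrow> ('a \<Rightarrow> complex) set" where
  "reg C V U = regular (quasi_affine C V) U"

lemma topol_quasi_affine [simp]: "topol (quasi_affine C V) = zariski C V"
  by (simp add: quasi_affine_def)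

lemma reg_iff:
  "f \<in> reg C V U \<longleftrightarrow> (\<forall>x\<in>U. \<exists>U' a b. openin (zariski C V) U' \<and> x \<in> U' \<and> U' \<subseteq> U \<and>
        a \<in> poly_funs C \<and> b \<in> poly_funs C \<and> (\<forall>y\<in>U'. b y \<noteq> 0 \<and> f y = a y / b y))"
  by (simp add: reg_def quasi_affine_def)

lemma regE:
  assumes "f \<in> reg C V U" "x \<in> U"
  obtains W a b where "openin (zariski C V) W" "x \<in> W" "W \<subseteq> U"
    "a \<in> poly_funs C" "b \<in> poly_funs C" "\<forall>y\<in>W. b y \<noteq> 0 \<and> f y = a y / b y"
  using bspec[OF assms(1)[unfolded reg_iff] assms(2)] by (elim exE conjE) 

lemma reg_cong: "(\<And>x. x \<in> U \<Longrightarrow> f x = g x) \<Longrightarrow> f \<in> reg C V U \<longleftrightarrow> g \<in> reg C V U"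
  unfolding reg_iff by (intro ball_cong ex_cong1) (auto simp: subset_iff)

lemma reg_poly_funs: "openin (zariski C V) U \<Longrightarrow> f \<in> poly_funs C \<Longrightarrow> f \<in> reg C V U"
  unfolding reg_iff
  by (intro ballI exI[of _ U] exI[of _ f] exI[of _ "\<lambda>_. 1"]) (auto intro: poly_funs.const)

lemma reg_restrict:
  assumes "f \<in> reg C V U" "openin (zariski C V) U'" "U' \<subseteq> U"
  shows "f \<in> reg C V U'"
  unfolding reg_iff
proof
  fix x assume "x \<in> U'"
  then obtain W a b where "openin (zariski C V) W" "x \<in> W" "W \<subseteq> U"
      "a \<in> poly_funs C" "b \<in> poly_funs C" "\<forall>y\<in>W. b y \<noteq> 0 \<and> f y = a y / b y"
    using regE[OF assms(1)] assms(3) by blast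
  with \<open>x \<in> U'\<close> assms(2)
  show "\<exists>W a b. openin (zariski C V) W \<and> x \<in> W \<and> W \<subseteq> U' \<and>
        a \<in> poly_funs C \<and> b \<in> poly_funs C \<and> (\<forall>y\<in>W. b y \<noteq> 0 \<and> f y = a y / b y)"
    by (intro exI[of _ "W \<inter> U'"] exI[of _ a] exI[of _ b]) auto
qed

text \<open>The gluing property of the structure sheaf: being a fraction is required only
  locally.\<close>

lemma reg_local:
  assumes "\<And>x. x \<in> U \<Longrightarrow> \<exists>U'. openin (zariski C V) U' \<and> x \<in> U' \<and> U' \<subseteq> U \<and> f \<in> reg C V U'"
  shows "f \<in> reg C V U"
  unfolding reg_iff
proof
  fix x assume "x \<in> U"
  then obtain U' where U': "openin (zariski C V) U'" "x \<in> U'" "U' \<subseteq> U" "f \<in> reg C V U'"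
    using assms by blast
  obtain W a b where "openin (zariski C V) W" "x \<in> W" "W \<subseteq> U'"
      "a \<in> poly_funs C" "b \<in> poly_funs C" "\<forall>y\<in>W. b y \<noteq> 0 \<and> f y = a y / b y"
    using regE[OF U'(4,2)] by metis
  then show "\<exists>W a b. openin (zariski C V) W \<and> x \<in> W \<and> W \<subseteq> U \<and>
        a \<in> poly_funs C \<and> b \<in> poly_funs C \<and> (\<forall>y\<in>W. b y \<noteq> 0 \<and> f y = a y / b y)"
    using U'(3) by (intro exI[of _ W] exI[of _ a] exI[of _ b]) auto
qed

text \<open>The two fractions live on different neighbourhoods, so they are compared on the
  intersection. The last assumption says that \<open>h\<close> of two fractions is again a fraction
  with nonvanishing denominator; sums and products are instances.\<close>

lemma reg_combine:
  assumes "f \<in> reg C V U" "g \<in> reg C V U"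
    and "\<And>a b c d. a \<in> poly_funs C \<Longrightarrow> b \<in> poly_funs C \<Longrightarrow> c \<in> poly_funs C \<Longrightarrow> d \<in> poly_funs C \<Longrightarrow>
      \<exists>p q. p \<in> poly_funs C \<and> q \<in> poly_funs C \<and> (\<forall>y. b y \<noteq> 0 \<longrightarrow> d y \<noteq> 0 \<longrightarrow> q y \<noteq> 0 \<and> 
         h (a y / b y) (c y / d y) = p y / q y)"
  shows "(\<lambda>x. h (f x) (g x)) \<in> reg C V U"
  unfolding reg_iff
proof
  fix x assume x: "x \<in> U"
  obtain W a b where 1: "openin (zariski C V) W" "x \<in> W" "W \<subseteq> U"
      "a \<in> poly_funs C" "b \<in> poly_funs C" "\<forall>y\<in>W. b y \<noteq> 0 \<and> f y = a y / b y"
    using regE[OF assms(1) x] by metis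
  obtain W' c d where 2: "openin (zariski C V) W'" "x \<in> W'" "W' \<subseteq> U"
      "c \<in> poly_funs C" "d \<in> poly_funs C" "\<forall>y\<in>W'. d y \<noteq> 0 \<and> g y = c y / d y"
    using regE[OF assms(2) x] by metis
  obtain p q where "p \<in> poly_funs C" "q \<in> poly_funs C" "\<forall>y. b y \<noteq> 0 \<longrightarrow> d y \<noteq> 0 \<longrightarrow> q y \<noteq> 0 \<and> 
         h (a y / b y) (c y / d y) = p y / q y" using assms(3)[OF 1(4,5) 2(4,5)] by blast
  then show "\<exists>W a b. openin (zariski C V) W \<and> x \<in> W \<and> W \<subseteq> U \<and>
        a \<in> poly_funs C \<and> b \<in> poly_funs C \<and> (\<forall>y\<in>W. b y \<noteq> 0 \<and> h (f y) (g y) = a y / b y)"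
    using 1 2 by (intro exI[of _ "W \<inter> W'"] exI[of _ p] exI[of _ q]) auto
qed

lemma reg_add: "f \<in> reg C V U \<Longrightarrow> g \<in> reg C V U \<Longrightarrow> (\<lambda>x. f x + g x) \<in> reg C V U"
proof (rule reg_combine[of _ _ _ _ _ "(+)"], assumption, assumption)
  fix a b c d assume "a \<in> poly_funs C" "b \<in> poly_funs C" "c \<in> poly_funs C" "d \<in> poly_funs C"
  then show "\<exists>p q. p \<in> poly_funs C \<and> q \<in> poly_funs C \<and> (\<forall>y. b y \<noteq> 0 \<longrightarrow> d y \<noteq> 0 \<longrightarrow> q y \<noteq> 0 \<and> 
         a y / b y + c y / d y = p y / q y)"
    by (intro exI[of _ "\<lambda>y. a y * d y + c y * b y"] exI[of _ "\<lambda>y. b y * d y"])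
      (auto intro: poly_funs.intros simp: add_frac_eq)
qed

lemma reg_mult: "f \<in> reg C V U \<Longrightarrow> g \<in> reg C V U \<Longrightarrow> (\<lambda>x. f x * g x) \<in> reg C V U"
proof (rule reg_combine[of _ _ _ _ _ "(*)"], assumption, assumption)
  fix a b c d assume "a \<in> poly_funs C" "b \<in> poly_funs C" "c \<in> poly_funs C" "d \<in> poly_funs C"
  then show "\<exists>p q. p \<in> poly_funs C \<and> q \<in> poly_funs C \<and> (\<forall>y. b y \<noteq> 0 \<longrightarrow> d y \<noteq> 0 \<longrightarrow> q y \<noteq> 0 \<and> 
         a y / b y * (c y / d y) = p y / q y)"
    by (intro exI[of _ "\<lambda>y. a y * c y"] exI[of _ "\<lambda>y. b y * d y"])
      (auto intro: poly_funs.intros)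
qed

text \<open>Locally f = a / b with b nowhere zero, so f vanishes exactly where the polynomial
  function a does.\<close>

lemma openin_reg_nonzero:
  assumes U: "openin (zariski C V) U" and f: "f \<in> reg C V U"
  shows "openin (zariski C V) {x \<in> U. f x \<noteq> 0}"
proof (subst openin_subopen, intro ballI)
  fix x assume x: "x \<in> {x \<in> U. f x \<noteq> 0}"
  then obtain W a b where W: "openin (zariski C V) W" "x \<in> W" "W \<subseteq> U"
      "a \<in> poly_funs C" "b \<in> poly_funs C" "\<forall>y\<in>W. b y \<noteq> 0 \<and> f y = a y / b y"
    using regE[OF f] by blast
  have "openin (zariski C V) (W \<inter> {x \<in> V. a x \<noteq> 0})"
    using W openin_zariski_basic by (intro openin_Int) auto
  moreover have "W \<subseteq> V" using openin_subset[OF W(1)] by simp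
  ultimately show "\<exists>T. openin (zariski C V) T \<and> x \<in> T \<and> T \<subseteq> {x \<in> U. f x \<noteq> 0}"
    using x W by (intro exI[of _ "W \<inter> {x \<in> V. a x \<noteq> 0}"]) auto
qed

lemma reg_divide:
  assumes f: "f \<in> reg C V U" and g: "g \<in> reg C V U" and ne: "\<And>x. x \<in> U \<Longrightarrow> g x \<noteq> 0"
  shows "(\<lambda>x. f x / g x) \<in> reg C V U"
proof -
  have "(\<lambda>x. 1 / g x) \<in> reg C V U"
    unfolding reg_iff
  proof
    fix x assume x: "x \<in> U"
    obtain W a b where W: "openin (zariski C V) W" "x \<in> W" "W \<subseteq> U"
        "a \<in> poly_funs C" "b \<in> poly_funs C" "\<forall>y\<in>W. b y \<noteq> 0 \<and> g y = a y / b y"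
      using regE[OF g x] by metis
    then show "\<exists>W a b. openin (zariski C V) W \<and> x \<in> W \<and> W \<subseteq> U \<and>
          a \<in> poly_funs C \<and> b \<in> poly_funs C \<and> (\<forall>y\<in>W. b y \<noteq> 0 \<and> 1 / g y = a y / b y)"
      using ne by (intro exI[of _ W] exI[of _ b] exI[of _ a]) (auto simp: subset_iff)
  qed
  from reg_mult[OF f this] show ?thesis by simp
qed

lemma reg_sum:
  assumes U: "openin (zariski C V) U"
  shows "finite I \<Longrightarrow> (\<And>i. i \<in> I \<Longrightarrow> f i \<in> reg C V U) \<Longrightarrow> (\<lambda>x. \<Sum>i\<in>I. f i x) \<in> reg C V U"
  by (induction I rule: finite_induct) (auto intro: reg_add reg_poly_funs[OF U] poly_funs.const)

lemma reg_prod: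
  assumes U: "openin (zariski C V) U"
  shows "finite I \<Longrightarrow> (\<And>i. i \<in> I \<Longrightarrow> f i \<in> reg C V U) \<Longrightarrow> (\<lambda>x. \<Prod>i\<in>I. f i x) \<in> reg C V U"
  by (induction I rule: finite_induct) (auto intro: reg_mult reg_poly_funs[OF U] poly_funs.const)

lemma reg_const: "openin (zariski C V) U \<Longrightarrow> (\<lambda>_. c) \<in> reg C V U"
  by (intro reg_poly_funs poly_funs.const)

lemma reg_poly_funs_comp:
  assumes U: "openin (zariski C V) U" and c: "\<And>c. c \<in> C' \<Longrightarrow> (\<lambda>x. c (\<sigma> x)) \<in> reg C V U"
    and f: "f \<in> poly_funs C'"
  shows "(\<lambda>x. f (\<sigma> x)) \<in> reg C V U"
  using f by induction (use c in \<open>auto intro: reg_const[OF U] reg_add reg_mult\<close>)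

lemma reg_det:
  fixes A :: "'a \<Rightarrow> complex ^ 'n ^ 'n"
  assumes U: "openin (zariski C V) U" and "\<And>i j. (\<lambda>x. A x $ i $ j) \<in> reg C V U"
  shows "(\<lambda>x. det (A x)) \<in> reg C V U"
  unfolding det_def using assms
  by (intro reg_sum[OF U] reg_mult reg_prod[OF U] reg_const[OF U]) auto

section \<open>Matrix inverses and Cramer's rule\<close>

lemma matrix_mul_matrix_inv:
  fixes A :: "'a::field ^ 'n ^ 'n"
  assumes "invertible A"
  shows "A ** matrix_inv A = mat 1" "matrix_inv A ** A = mat 1"
  using assms unfolding invertible_def matrix_inv_def by (metis (mono_tags, lifting) someI_ex)+

lemma matrix_inv_cancel:
  fixes A :: "'a::field ^ 'n ^ 'n"
  assumes "invertible A"
  shows "matrix_inv A *v (A *v X) = X" "A *v (matrix_inv A *v X) = X"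
  using assms by (simp_all add: matrix_vector_mul_assoc matrix_mul_matrix_inv)

lemma matrix_inv_unique_left:
  fixes A :: "'a::field ^ 'n ^ 'n"
  assumes "A ** B = mat 1"
  shows "matrix_inv A = B"
proof -
  have "invertible A" using assms by (meson invertible_right_inverse)
  then have "matrix_inv A ** (A ** B) = B"
    by (simp add: matrix_mul_assoc matrix_mul_matrix_inv)
  with assms show ?thesis by simp
qed

lemma matrix_vector_mult_axis: "(A :: 'a::field ^ 'n ^ 'k) *v axis j 1 = column j A"
  by (simp add: vec_eq_iff matrix_vector_mult_def column_def axis_def if_distrib cong: if_cong)

text \<open>Cramer's rule, applied to the system whose solution is the j-th column of the inverse.
  It exhibits the entries of the inverse as quotients of polynomials.\<close>

lemma matrix_inv_entry:
  fixes A :: "complex ^ 'n ^ 'n"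
  assumes "det A \<noteq> 0"
  shows "matrix_inv A $ i $ j =
    det (\<chi> k l. if l = i then axis j 1 $ k else A $ k $ l) / det A"
proof -
  have "invertible A" using assms by (simp add: invertible_det_nz)
  then have "A *v (matrix_inv A *v axis j 1) = axis j 1"
    by (simp add: matrix_vector_mul_assoc matrix_mul_matrix_inv)
  then have "matrix_inv A *v axis j 1 =
    (\<chi> i. det (\<chi> k l. if l = i then axis j 1 $ k else A $ k $ l) / det A)"
    by (simp only: cramer[OF assms])
  then show ?thesis
    unfolding matrix_vector_mult_axis by (simp add: column_def vec_eq_iff)
qed

lemma reg_matrix_inv:
  fixes A :: "'a \<Rightarrow> complex ^ 'n ^ 'n"
  assumes U: "openin (zariski C V) U" and A: "\<And>i j. (\<lambda>x. A x $ i $ j) \<in> reg C V U"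
    and ne: "\<And>x. x \<in> U \<Longrightarrow> det (A x) \<noteq> 0"
  shows "(\<lambda>x. matrix_inv (A x) $ i $ j) \<in> reg C V U"
proof -
  have "(\<lambda>x. det (\<chi> k l. if l = i then axis j 1 $ k else A x $ k $ l) / det (A x)) \<in> reg C V U"
  proof (intro reg_divide reg_det[OF U] A ne)
    show "(\<lambda>x. (\<chi> k l. if l = i then axis j 1 $ k else A x $ k $ l) $ k $ l) \<in> reg C V U" for k l
      by (cases "l = i") (simp_all add: A reg_const[OF U])
  qed
  then show ?thesis by (subst reg_cong) (use ne matrix_inv_entry in auto)
qed

lemma reg_matrix_vector_mult:
  fixes A :: "'a \<Rightarrow> complex ^ 'n ^ 'k"
  assumes U: "openin (zariski C V) U" and "\<And>i j. (\<lambda>x. A x $ i $ j) \<in> reg C V U"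
    and "\<And>j. (\<lambda>x. v x $ j) \<in> reg C V U"
  shows "(\<lambda>x. (A x *v v x) $ i) \<in> reg C V U"
  unfolding matrix_vector_mult_def using assms by (simp add: reg_sum[OF U] reg_mult)

text \<open>A map with regular coordinates pulls a polynomial function back to a regular one, whose
  nonvanishing locus is open. The map is only required to land in \<open>V'\<close> on the open set
  \<open>U\<close>, since the lifts to which this is applied exist only locally.\<close>

lemma openin_vimage_zariski:
  assumes U: "openin (zariski C V) U" and c: "\<And>c. c \<in> C' \<Longrightarrow> (\<lambda>x. c (\<sigma> x)) \<in> reg C V U"
    and V': "\<And>x. x \<in> U \<Longrightarrow> \<sigma> x \<in> V'" and W: "openin (zariski C' V') W"
  shows "openin (zariski C V) {x \<in> U. \<sigma> x \<in> W}"
proof (subst openin_subopen, intro ballI)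
  fix x assume x: "x \<in> {x \<in> U. \<sigma> x \<in> W}"
  then obtain f where f: "f \<in> poly_funs C'" "f (\<sigma> x) \<noteq> 0" "{y \<in> V'. f y \<noteq> 0} \<subseteq> W"
    using W unfolding openin_zariski_iff by blast
  show "\<exists>T. openin (zariski C V) T \<and> x \<in> T \<and> T \<subseteq> {x \<in> U. \<sigma> x \<in> W}"
    using openin_reg_nonzero[OF U reg_poly_funs_comp[OF U c f(1)]] f x V'
    by (intro exI[of _ "{x \<in> U. f (\<sigma> x) \<noteq> 0}"]) auto
qed

lemma reg_comp:
  assumes U: "openin (zariski C V) U" and c: "\<And>c. c \<in> C' \<Longrightarrow> (\<lambda>x. c (\<sigma> x)) \<in> reg C V U"
    and V': "\<And>x. x \<in> U \<Longrightarrow> \<sigma> x \<in> V'" and f: "f \<in> reg C' V' W"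
  shows "(\<lambda>x. f (\<sigma> x)) \<in> reg C V {x \<in> U. \<sigma> x \<in> W}"
proof (rule reg_local)
  fix x assume x: "x \<in> {x \<in> U. \<sigma> x \<in> W}"
  then obtain W' a b where W': "openin (zariski C' V') W'" "\<sigma> x \<in> W'" "W' \<subseteq> W"
      "a \<in> poly_funs C'" "b \<in> poly_funs C'" "\<forall>y\<in>W'. b y \<noteq> 0 \<and> f y = a y / b y"
    using regE[OF f] by blast
  define T where "T = {x \<in> U. \<sigma> x \<in> W'}"
  have T: "openin (zariski C V) T" unfolding T_def by (rule openin_vimage_zariski[where C' = C' and V' = V']) (use U c V' W'(1) in auto)
  have TU: "T \<subseteq> U" by (auto simp: T_def)
  have "(\<lambda>x. a (\<sigma> x) / b (\<sigma> x)) \<in> reg C V T"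
    using reg_restrict[OF reg_poly_funs_comp[OF U c W'(4)] T TU]
      reg_restrict[OF reg_poly_funs_comp[OF U c W'(5)] T TU] W'
    by (intro reg_divide) (auto simp: T_def)
  then have "(\<lambda>x. f (\<sigma> x)) \<in> reg C V T"
    by (subst reg_cong) (use W' in \<open>auto simp: T_def\<close>)
  then show "\<exists>U'. openin (zariski C V) U' \<and> x \<in> U' \<and> U' \<subseteq> {x \<in> U. \<sigma> x \<in> W} \<and> (\<lambda>x. f (\<sigma> x)) \<in> reg C V U'"
    using T x W' by (intro exI[of _ T]) (auto simp: T_def)
qed

section \<open>Forms and linear functionals on them\<close>

lemma act_apply: "act g q X = q (matrix_inv g *v X)"
  by (simp add: act_def)

lemma poly_funs_linear_comp:
  assumes "f \<in> poly_funs coords_E"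
  shows "(\<lambda>X. f (A *v X)) \<in> poly_funs (coords_E :: ('m::finite E \<Rightarrow> complex) set)"
  using assms
proof induction
  case (gen f)
  then obtain a where f: "f = (\<lambda>X. X $ a)" by (auto simp: coords_E_def)
  have "(\<lambda>X. X $ b) \<in> poly_funs coords_E" for b :: "'m \<times> 'm"
    by (rule poly_funs.gen) (auto simp: coords_E_def)
  then show ?case
    unfolding f matrix_vector_mult_def
    by (auto intro!: poly_funs_sum poly_funs.mult poly_funs.const)
qed (auto intro: poly_funs.intros)

lemma poly_funs_coord: "(\<lambda>X. X $ a) \<in> poly_funs (coords_E :: ('m::finite E \<Rightarrow> complex) set)"
  by (rule poly_funs.gen) (auto simp: coords_E_def)

lemma forms_linear_comp: "q \<in> forms d \<Longrightarrow> (\<lambda>X. q (A *v X)) \<in> forms d"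
  by (simp add: forms_def poly_funs_linear_comp matrix_vector_mult_scaleR vector_scalar_commute)

lemma act_forms: "q \<in> forms d \<Longrightarrow> act g q \<in> forms d"
  unfolding act_def by (rule forms_linear_comp)

lemma forms_lincomb: "q \<in> forms d \<Longrightarrow> r \<in> forms d \<Longrightarrow> (\<lambda>X. a * q X + b * r X) \<in> forms d"
  unfolding forms_def by (auto intro!: poly_funs.const poly_funs.add poly_funs.mult simp: algebra_simps)

lemma zero_forms: "(\<lambda>X. 0) \<in> forms d"
  unfolding forms_def by (auto intro: poly_funs.const)

lemma eval_coords_forms: "(\<lambda>q. q X) \<in> coords_forms d"
  by (simp add: coords_forms_def)

lemma coords_formsD:
  "l \<in> coords_forms d \<Longrightarrow> q \<in> forms d \<Longrightarrow> r \<in> forms d \<Longrightarrow>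
    l (\<lambda>X. a * q X + b * r X) = a * l q + b * l r"
  by (simp add: coords_forms_def)

lemma act_coords_forms:
  assumes "l \<in> coords_forms d" shows "(\<lambda>q. l (act g q)) \<in> coords_forms d"
proof -
  have "act g (\<lambda>X. a * q X + b * r X) = (\<lambda>X. a * act g q X + b * act g r X)" for a b q r
    by (simp add: act_def)
  then show ?thesis
    using coords_formsD[OF assms act_forms act_forms] by (simp add: coords_forms_def)
qed

text \<open>A functional in \<open>coords_forms d\<close> is linear only on forms and arbitrary
  elsewhere. Each partial sum must therefore be known to be a form before linearity applies, which
  is why both claims go through one induction.\<close>

lemma coords_forms_sum:
  assumes l: "l \<in> coords_forms d" and "finite T" and "\<And>t. t \<in> T \<Longrightarrow> b t \<in> forms d"
  shows "l (\<lambda>X. \<Sum>t\<in>T. c t * b t X) = (\<Sum>t\<in>T. c t * l (b t))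
    \<and> (\<lambda>X. \<Sum>t\<in>T. c t * b t X) \<in> forms d"
  using assms(2,3)
proof (induction T rule: finite_induct)
  case empty
  \<comment> \<open>Linearity with both coefficients 0 gives the value 0 at the zero form.\<close>
  have "l (\<lambda>X. 0 * (0::complex) + 0 * 0) = 0 * l (\<lambda>X. 0) + 0 * l (\<lambda>X. 0)"
    by (rule coords_formsD[OF l zero_forms zero_forms])
  then show ?case by (simp add: zero_forms)
next
  case (insert t T)
  then have IH: "l (\<lambda>X. \<Sum>t\<in>T. c t * b t X) = (\<Sum>t\<in>T. c t * l (b t))"
    and F: "(\<lambda>X. \<Sum>t\<in>T. c t * b t X) \<in> forms d" and bt: "b t \<in> forms d" by auto
  have "l (\<lambda>X. c t * b t X + 1 * (\<Sum>t\<in>T. c t * b t X)) = c t * l (b t) + 1 * l (\<lambda>X. \<Sum>t\<in>T. c t * b t X)"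
    by (rule coords_formsD[OF l bt F])
  moreover have "(\<lambda>X. c t * b t X + 1 * (\<Sum>t\<in>T. c t * b t X)) \<in> forms d"
    by (rule forms_lincomb[OF bt F])
  ultimately show ?case using insert.hyps IH by simp
qed

section \<open>Interpolation in a finitely generated space of functions\<close>

definition fspan :: "'i set \<Rightarrow> ('i \<Rightarrow> 'a \<Rightarrow> complex) \<Rightarrow> ('a \<Rightarrow> complex) set" where
  "fspan I f = range (\<lambda>c X. \<Sum>i\<in>I. c i * f i X)"

lemma fspan_lincomb:
  assumes "g \<in> fspan I f" "h \<in> fspan I f" shows "(\<lambda>X. a * g X + b * h X) \<in> fspan I f"
proof -
  obtain c d where "g = (\<lambda>X. \<Sum>i\<in>I. c i * f i X)" "h = (\<lambda>X. \<Sum>i\<in>I. d i * f i X)"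
    using assms unfolding fspan_def by auto
  then have "(\<lambda>X. a * g X + b * h X) = (\<lambda>X. \<Sum>i\<in>I. (a * c i + b * d i) * f i X)"
    by (simp add: sum.distrib sum_distrib_left algebra_simps)
  then show ?thesis unfolding fspan_def by (intro range_eqI)
qed

lemma fspan_base:
  assumes "finite I" "j \<in> I" shows "f j \<in> fspan I f"
proof -
  have "f j = (\<lambda>X. \<Sum>i\<in>I. of_bool (i = j) * f i X)"
    using assms by (simp add: of_bool_def if_distrib[of "\<lambda>c. c * _"] cong: if_cong)
  then show ?thesis unfolding fspan_def by (intro range_eqI)
qed

lemma fspan_sum:
  assumes "finite T" "\<And>t. t \<in> T \<Longrightarrow> b t \<in> fspan I f"
  shows "(\<lambda>X. \<Sum>t\<in>T. c t * b t X) \<in> fspan I f"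
  using assms
proof (induction T rule: finite_induct)
  case empty
  have "(\<lambda>X. \<Sum>i\<in>I. 0 * f i X) \<in> fspan I f" unfolding fspan_def by (rule rangeI)
  then show ?case by simp
next
  case (insert t T)
  then show ?case using fspan_lincomb[of "b t" I f "\<lambda>X. \<Sum>t\<in>T. c t * b t X" "c t" 1] by simp
qed

lemma fspan_insert:
  assumes "finite I" "j \<notin> I" "g \<in> fspan (insert j I) f"
  obtains h c where "h \<in> fspan I f" "g = (\<lambda>X. h X + c * f j X)"
proof -
  obtain d where "g = (\<lambda>X. \<Sum>i\<in>insert j I. d i * f i X)" using assms unfolding fspan_def by auto
  then have "g = (\<lambda>X. (\<Sum>i\<in>I. d i * f i X) + d j * f j X)" using assms by (simp add: add.commute)
  then show ?thesis using that unfolding fspan_def by blast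
qed

lemma fspan_mono: "finite J \<Longrightarrow> I \<subseteq> J \<Longrightarrow> fspan I f \<subseteq> fspan J f"
proof
  fix g assume J: "finite J" "I \<subseteq> J" and "g \<in> fspan I f"
  then obtain c where "g = (\<lambda>X. \<Sum>i\<in>I. c i * f i X)" unfolding fspan_def by auto
  then show "g \<in> fspan J f"
    using fspan_sum[of I f J f c] J by (simp add: finite_subset fspan_base subset_iff)
qed

text \<open>The points are added one at a time; the dual basis \<open>b\<close> stays normalised by
  \<open>b t s = 1\<close> if \<open>s = t\<close> and \<open>0\<close> otherwise.\<close>

lemma fspan_interpolation:
  assumes "finite I"
  shows "\<exists>T b. finite T \<and> (\<forall>t\<in>T. b t \<in> fspan I f) \<and> (\<forall>t\<in>T. \<forall>s\<in>T. b t s = of_bool (s = t))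
    \<and> (\<forall>g\<in>fspan I f. \<forall>X. g X = (\<Sum>t\<in>T. g t * b t X))"
  using assms
proof (induction I rule: finite_induct)
  case empty
  show ?case by (intro exI[of _ "{}"]) (auto simp: fspan_def)
next
  case (insert j I)
  then obtain T b where T: "finite T" and b: "\<And>t. t \<in> T \<Longrightarrow> b t \<in> fspan I f"
    and \<delta>: "\<And>s t. s \<in> T \<Longrightarrow> t \<in> T \<Longrightarrow> b t s = of_bool (s = t)"
    and g: "\<And>g X. g \<in> fspan I f \<Longrightarrow> g X = (\<Sum>t\<in>T. g t * b t X)" by metis
  have mono: "fspan I f \<subseteq> fspan (insert j I) f" using insert by (intro fspan_mono) auto
  \<comment> \<open>The error of interpolating \<open>f j\<close> at the points found so far. It
    vanishes on \<open>T\<close>, and together with the old span it generates the new one.\<close>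
  define r where "r = (\<lambda>X. f j X - (\<Sum>t\<in>T. f j t * b t X))"
  have r: "r \<in> fspan (insert j I) f"
    using fspan_lincomb[OF fspan_base[where I = "insert j I" and j = j and f = f] subsetD[OF mono fspan_sum[where b = b and c = "f j" and f = f, OF T b]], where a = 1 and b = "-1"]
      insert by (simp add: r_def)
  have rT: "r s = 0" if "s \<in> T" for s
    using that T by (simp add: r_def \<delta> of_bool_def if_distrib[of "\<lambda>c. _ * c"] cong: if_cong)
  have split: "\<exists>h c. h \<in> fspan I f \<and> g = (\<lambda>X. h X + c * r X)" if "g \<in> fspan (insert j I) f" for g
  proof -
    obtain h c where h: "h \<in> fspan I f" "g = (\<lambda>X. h X + c * f j X)"
      using fspan_insert[OF insert(1,2) \<open>g \<in> _\<close>] by metis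
    have "(\<lambda>X. 1 * h X + c * (\<Sum>t\<in>T. f j t * b t X)) \<in> fspan I f"
      by (intro fspan_lincomb h fspan_sum T b)
    moreover have "g = (\<lambda>X. (1 * h X + c * (\<Sum>t\<in>T. f j t * b t X)) + c * r X)"
      by (simp add: h r_def algebra_simps)
    ultimately show ?thesis by blast
  qed
  show ?case
  proof (cases "\<exists>z. r z \<noteq> 0")
    case False
    then have "fspan (insert j I) f \<subseteq> fspan I f" using split by fastforce
    then show ?thesis
      using T b \<delta> g mono by (intro exI[of _ T] exI[of _ b]) blast
  next
    case True
    then obtain z where z: "r z \<noteq> 0" by blast
    have zT: "z \<notin> T" using rT z by blast
    define q where "q = (\<lambda>X. r X / r z)"
    \<comment> \<open>\<open>z\<close> is a new point with \<open>r z\<close> nonzero. The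
      normalised error \<open>q\<close> is the dual function of \<open>z\<close>; subtracting a
      multiple of it makes the old dual functions vanish at \<open>z\<close> and keeps their values
      on \<open>T\<close>.\<close>
    define b' where "b' t = (if t = z then q else (\<lambda>X. b t X - b t z * q X))" for t
    have q: "q \<in> fspan (insert j I) f"
      using fspan_lincomb[OF r r, of "1 / r z" 0] by (simp add: q_def)
    have "\<forall>t\<in>insert z T. b' t \<in> fspan (insert j I) f"
      using fspan_lincomb[OF subsetD[OF mono b] q, of _ 1 "- b _ z"] q by (auto simp: b'_def)
    moreover have "\<forall>t\<in>insert z T. \<forall>s\<in>insert z T. b' t s = of_bool (s = t)"
      using zT z rT \<delta> by (auto simp: b'_def q_def)
    moreover have "g X = (\<Sum>t\<in>insert z T. g t * b' t X)" if gI: "g \<in> fspan (insert j I) f" for g X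
    proof -
      obtain h c where h: "h \<in> fspan I f" "g = (\<lambda>X. h X + c * r X)" using split[OF gI] by blast
      have "(\<Sum>t\<in>insert z T. g t * b' t X) = g z * q X + (\<Sum>t\<in>T. g t * b' t X)"
        using zT T by (simp add: b'_def)
      also have "(\<Sum>t\<in>T. g t * b' t X) = (\<Sum>t\<in>T. h t * b t X - (h t * b t z) * q X)"
        using zT by (intro sum.cong) (auto simp: b'_def h rT algebra_simps)
      also have "\<dots> = h X - h z * q X"
        by (simp add: sum_subtractf g[OF h(1), of X] g[OF h(1), of z] flip: sum_distrib_right)
      finally show ?thesis using z by (simp add: h q_def algebra_simps)
    qed
    ultimately show ?thesis using T by (intro exI[of _ "insert z T"] exI[of _ b']) blast
  qed
qed

section \<open>Forms of fixed degree as a finitely generated space\<close>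

text \<open>A list of indices encodes the exponents, so one function is listed once per ordering of
  its factors. The family is only used as a finite generating set.\<close>

definition monomial :: "'k list \<Rightarrow> complex ^ 'k \<Rightarrow> complex" where
  "monomial xs X = (\<Prod>a\<leftarrow>xs. X $ a)"

text \<open>A generated counterpart of \<open>forms\<close>. The latter is cut out by a functional
  equation, which does not show that finitely many functions span it.\<close>

inductive_set homog :: "nat \<Rightarrow> (complex ^ 'k \<Rightarrow> complex) set" for k :: nat where
  mono: "length xs = k \<Longrightarrow> monomial xs \<in> homog k"
| lin: "f \<in> homog k \<Longrightarrow> h \<in> homog k \<Longrightarrow> (\<lambda>X. a * f X + b * h X) \<in> homog k"

lemma homog_zero: "(\<lambda>X. 0) \<in> homog k"
  using homog.lin[OF homog.mono homog.mono, of "replicate k undefined" k "replicate k undefined" 0 0] by simp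

lemma homog_scale: "f \<in> homog k \<Longrightarrow> f (c *s X) = c ^ k * f X"
proof (induction rule: homog.induct)
  case (mono xs)
  have "monomial xs (c *s X) = c ^ length xs * monomial xs X"
    by (induction xs) (auto simp: monomial_def)
  then show ?case using mono by simp
qed (simp add: algebra_simps)

lemma homog_monomial_mult: "f \<in> homog k \<Longrightarrow> (\<lambda>X. monomial xs X * f X) \<in> homog (length xs + k)"
proof (induction rule: homog.induct)
  case (mono ys)
  have "(\<lambda>X. monomial xs X * monomial ys X) = monomial (xs @ ys)"
    by (simp add: monomial_def fun_eq_iff)
  then show ?case using homog.mono[of "xs @ ys" "length xs + k"] mono by simp
next
  case (lin f h a b)
  then show ?case using homog.lin[OF lin.IH, of a b] by (simp add: algebra_simps)
qed

lemma homog_mult: "f \<in> homog j \<Longrightarrow> h \<in> homog k \<Longrightarrow> (\<lambda>X. f X * h X) \<in> homog (j + k)"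
proof (induction rule: homog.induct)
  case (mono xs)
  then show ?case using homog_monomial_mult[of h k xs] by simp
next
  case (lin f f' a b)
  then show ?case using homog.lin[OF lin.IH, of a b] by (simp add: algebra_simps)
qed

lemma homog_sum:
  assumes "finite T" "\<And>t. t \<in> T \<Longrightarrow> f t \<in> homog k"
  shows "(\<lambda>X. \<Sum>t\<in>T. f t X) \<in> homog k"
  using assms
proof (induction T rule: finite_induct)
  case (insert t T)
  then show ?case using homog.lin[of "f t" k "\<lambda>X. \<Sum>t\<in>T. f t X" 1 1] by simp
qed (simp add: homog_zero)

lemma homog_subset_fspan:
  "homog k \<subseteq> fspan {xs. length xs = k} (monomial :: 'k::finite list \<Rightarrow> _)"
proof
  fix f :: "complex ^ 'k \<Rightarrow> complex" assume "f \<in> homog k"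
  then show "f \<in> fspan {xs. length xs = k} monomial"
  proof induction
    case (mono xs)
    have "finite {xs :: 'k list. length xs = k}"
      using finite_lists_length_eq[of "UNIV :: 'k set" k] by simp
    then show ?case using mono by (intro fspan_base) auto
  qed (rule fspan_lincomb)
qed

text \<open>Products are regrouped by total degree as a Cauchy product. The components are indexed
  by all degrees and vanish beyond \<open>N\<close>, so that two decompositions can be padded to a
  common bound.\<close>

lemma poly_funs_homog_decomposition:
  assumes "q \<in> poly_funs (coords_E :: ('m::finite E \<Rightarrow> complex) set)"
  shows "\<exists>N f. (\<forall>k. f k \<in> homog k) \<and> (\<forall>k>N. f k = (\<lambda>X. 0)) \<and> (\<forall>X. q X = (\<Sum>k\<le>N. f k X))"
  using assms
proof induction
  case (const c)
  have "(\<lambda>X. c * monomial [] X + 0 * monomial [] X) \<in> homog 0"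
    by (intro homog.intros) auto
  then have "(\<lambda>X. c) \<in> homog 0" by (simp add: monomial_def)
  then show ?case
    by (intro exI[of _ 0] exI[of _ "\<lambda>k. if k = 0 then (\<lambda>X. c) else (\<lambda>X. 0)"]) (auto simp: homog_zero)
next
  case (gen f)
  then obtain a where f: "f = (\<lambda>X. X $ a)" by (auto simp: coords_E_def)
  have "monomial [a] = f" by (simp add: f monomial_def fun_eq_iff)
  then have "f \<in> homog (Suc 0)" using homog.mono[of "[a]"] by auto
  then show ?case
    by (intro exI[of _ 1] exI[of _ "\<lambda>k. if k = 1 then f else (\<lambda>X. 0)"]) (auto simp: homog_zero)
next
  case (add f h)
  from add.IH(1) obtain N u where u: "\<And>k. u k \<in> homog k" "\<And>k. k > N \<Longrightarrow> u k = (\<lambda>X. 0)"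
    "\<And>X. f X = (\<Sum>k\<le>N. u k X)" by auto
  from add.IH(2) obtain M v where v: "\<And>k. v k \<in> homog k" "\<And>k. k > M \<Longrightarrow> v k = (\<lambda>X. 0)"
    "\<And>X. h X = (\<Sum>k\<le>M. v k X)" by auto
  have "f X = (\<Sum>k\<le>max N M. u k X)" for X
    unfolding u(3) by (rule sum.mono_neutral_left) (auto simp: u(2))
  moreover have "h X = (\<Sum>k\<le>max N M. v k X)" for X
    unfolding v(3) by (rule sum.mono_neutral_left) (auto simp: v(2))
  moreover have "(\<lambda>X. u k X + v k X) \<in> homog k" for k
    using homog.lin[OF u(1) v(1), of 1 k 1] by simp
  ultimately show ?case
    by (intro exI[of _ "max N M"] exI[of _ "\<lambda>k X. u k X + v k X"]) (auto simp: u(2) v(2) sum.distrib)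
next
  case (mult f h)
  from mult.IH(1) obtain N u where u: "\<And>k. u k \<in> homog k" "\<And>k. k > N \<Longrightarrow> u k = (\<lambda>X. 0)"
    "\<And>X. f X = (\<Sum>k\<le>N. u k X)" by auto
  from mult.IH(2) obtain M v where v: "\<And>k. v k \<in> homog k" "\<And>k. k > M \<Longrightarrow> v k = (\<lambda>X. 0)"
    "\<And>X. h X = (\<Sum>k\<le>M. v k X)" by auto
  define w where "w k = (\<lambda>X. \<Sum>i\<le>k. u i X * v (k - i) X)" for k
  have "w k \<in> homog k" for k
    unfolding w_def
  proof (intro homog_sum)
    fix i assume "i \<in> {..k}"
    then show "(\<lambda>X. u i X * v (k - i) X) \<in> homog k"
      using homog_mult[OF u(1)[of i] v(1)[of "k - i"]] by simp
  qed simp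
  moreover have "w k = (\<lambda>X. 0)" if "k > N + M" for k
  proof -
    have "u i X * v (k - i) X = 0" for i X
      using u(2)[of i] v(2)[of "k - i"] that by (cases "i > N") auto
    then show ?thesis unfolding w_def by (intro ext sum.neutral) simp
  qed
  moreover have "f X * h X = (\<Sum>k\<le>N + M. w k X)" for X
  proof -
    have "u i X = 0" if "i > N" for i using u(2)[OF that] by simp
    moreover have "v i X = 0" if "i > M" for i using v(2)[OF that] by simp
    ultimately show ?thesis
      unfolding u(3) v(3) w_def using polynomial_product[of N "\<lambda>i. u i X" M "\<lambda>i. v i X" 1] by simp
  qed
  ultimately show ?case by blast
qed

text \<open>For fixed X, evaluating at c X turns the decomposition into a polynomial in c that
  equals q(X) c^d for every c. Comparing coefficients leaves only the component of degree d.\<close>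

lemma forms_subset_homog: "forms d \<subseteq> (homog d :: ('m::finite E \<Rightarrow> complex) set)"
proof
  fix q :: "'m E \<Rightarrow> complex" assume q: "q \<in> forms d"
  then obtain N f where f: "\<And>k. f k \<in> homog k" "\<And>k. k > N \<Longrightarrow> f k = (\<lambda>X. 0)"
    "\<And>X. q X = (\<Sum>k\<le>N. f k X)"
    using poly_funs_homog_decomposition[of q] unfolding forms_def by auto
  have sum: "q X = (\<Sum>k\<le>max N d. f k X)" for X
    unfolding f(3) by (rule sum.mono_neutral_left) (auto simp: f(2))
  have "q X = f d X" for X
  proof -
    have "(\<Sum>k\<le>max N d. f k X * c ^ k) = (\<Sum>k\<le>max N d. (if k = d then q X else 0) * c ^ k)" for c
    proof -
      have "(\<Sum>k\<le>max N d. f k X * c ^ k) = q (c *s X)"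
        unfolding sum by (simp add: homog_scale[OF f(1)] mult.commute)
      also have "\<dots> = c ^ d * q X" using q by (simp add: forms_def)
      also have "\<dots> = (\<Sum>k\<le>max N d. (if k = d then q X else 0) * c ^ k)"
        by (simp add: if_distrib[of "\<lambda>x. x * _"] cong: if_cong)
      finally show ?thesis .
    qed
    then show ?thesis
      using polyfun_eq_coeffs[of "\<lambda>k. f k X" "max N d" "\<lambda>k. if k = d then q X else 0"] by auto
  qed
  then have "q = f d" by blast
  then show "q \<in> homog d" using f(1) by simp
qed

lemma homog_subset_forms: "homog d \<subseteq> (forms d :: ('m::finite E \<Rightarrow> complex) set)"
proof
  fix f :: "'m E \<Rightarrow> complex" assume f: "f \<in> homog d"
  have "monomial xs \<in> poly_funs coords_E" for xs :: "('m \<times> 'm) list"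
  proof (induction xs)
    case (Cons a xs)
    have "monomial (a # xs) = (\<lambda>X. X $ a * monomial xs X)" by (simp add: monomial_def fun_eq_iff)
    then show ?case using poly_funs.mult[OF poly_funs_coord Cons] by simp
  qed (simp add: monomial_def[abs_def] poly_funs.const)
  with f have "f \<in> poly_funs coords_E"
    by induction (simp_all add: poly_funs.const poly_funs.add poly_funs.mult)
  then show "f \<in> forms d" using homog_scale[OF f] by (simp add: forms_def)
qed

lemma fspan_monomial_eq_forms:
  "fspan {xs. length xs = d} monomial = (forms d :: ('m::finite E \<Rightarrow> complex) set)"
proof
  have fin: "finite {xs :: ('m \<times> 'm) list. length xs = d}"
    using finite_lists_length_eq[of "UNIV :: ('m \<times> 'm) set" d] by simp
  show "fspan {xs. length xs = d} monomial \<subseteq> (forms d :: ('m E \<Rightarrow> complex) set)"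
  proof
    fix g :: "'m E \<Rightarrow> complex" assume "g \<in> fspan {xs. length xs = d} monomial"
    then obtain c where g: "g = (\<lambda>X. \<Sum>xs | length xs = d. c xs * monomial xs X)"
      unfolding fspan_def by auto
    have *: "(\<lambda>X. c xs * monomial xs X) \<in> homog d" if "length xs = d" for xs :: "('m \<times> 'm) list"
      using homog.lin[OF homog.mono homog.mono, OF that that, of "c xs" 0] by simp
    have "(\<lambda>X. \<Sum>xs | length xs = d. c xs * monomial xs X) \<in> homog d"
      by (rule homog_sum[OF fin *]) simp
    then show "g \<in> forms d" unfolding g by (rule subsetD[OF homog_subset_forms])
  qed
qed (use forms_subset_homog homog_subset_fspan in blast)

text \<open>Forms are recovered linearly from their values at finitely many points. This reduces
  arbitrary linear functionals to evaluations.\<close>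

lemma forms_interpolation:
  obtains T and b :: "'m::finite E \<Rightarrow> 'm E \<Rightarrow> complex" where "finite T" "\<And>t. t \<in> T \<Longrightarrow> b t \<in> forms d"
    "\<And>q X. q \<in> forms d \<Longrightarrow> q X = (\<Sum>t\<in>T. q t * b t X)"
proof -
  have fin: "finite {xs :: ('m \<times> 'm) list. length xs = d}"
    using finite_lists_length_eq[of "UNIV :: ('m \<times> 'm) set" d] by simp
  show ?thesis
    using fspan_interpolation[OF fin, of monomial] that unfolding fspan_monomial_eq_forms by metis
qed

text \<open>Interpolation is used twice. The composed form is determined by its values at the points
  s of \<open>T\<close>, and F(h s) is the sum over t of F(t) b_t(h s): a regular function times a
  polynomial in the entries of h.\<close>

lemma reg_form_comp:
  fixes F :: "'a \<Rightarrow> 'm::finite E \<Rightarrow> complex" and h :: "'a \<Rightarrow> 'm End_E"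
  assumes U: "openin (zariski C V) U" and F: "\<And>x. F x \<in> forms d"
    and lF: "\<And>l. l \<in> coords_forms d \<Longrightarrow> (\<lambda>x. l (F x)) \<in> reg C V U"
    and h: "\<And>i j. (\<lambda>x. h x $ i $ j) \<in> reg C V U" and l: "l \<in> coords_forms d"
  shows "(\<lambda>x. l (\<lambda>X. F x (h x *v X))) \<in> reg C V U"
proof -
  obtain T and b :: "'m::finite E \<Rightarrow> 'm E \<Rightarrow> complex" where T: "finite T"
    and b: "\<And>t. t \<in> T \<Longrightarrow> b t \<in> forms d"
    and q: "\<And>q X. q \<in> forms d \<Longrightarrow> q X = (\<Sum>t\<in>T. q t * b t X)" using forms_interpolation by metis
  have "l (\<lambda>X. F x (h x *v X)) = (\<Sum>s\<in>T. (\<Sum>t\<in>T. F x t * b t (h x *v s)) * l (b s))" for x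
  proof -
    let ?q = "\<lambda>X. F x (h x *v X)"
    have "?q = (\<lambda>X. \<Sum>t\<in>T. ?q t * b t X)" using q[OF forms_linear_comp[OF F]] by blast
    then have "l ?q = l (\<lambda>X. \<Sum>t\<in>T. ?q t * b t X)" by (rule arg_cong)
    also have "\<dots> = (\<Sum>s\<in>T. ?q s * l (b s))"
      using coords_forms_sum[where b = b and c = ?q, OF l T b] by blast
    finally show ?thesis by (simp add: q[OF F, of x "h x *v _"])
  qed
  moreover have "(\<lambda>x. (\<Sum>s\<in>T. (\<Sum>t\<in>T. F x t * b t (h x *v s)) * l (b s))) \<in> reg C V U"
  proof (intro reg_sum[OF U] T reg_mult reg_const[OF U] lF[OF eval_coords_forms])
    fix s t assume "t \<in> T"
    have "(\<lambda>x. (h x *v s) $ a) \<in> reg C V U" for a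
      by (intro reg_matrix_vector_mult[OF U] h reg_const[OF U])
    then have "(\<lambda>x. c (h x *v s)) \<in> reg C V U" if "c \<in> coords_E" for c
      using that unfolding coords_E_def by auto
    moreover have "b t \<in> poly_funs coords_E" using b[OF \<open>t \<in> T\<close>] by (simp add: forms_def)
    ultimately show "(\<lambda>x. b t (h x *v s)) \<in> reg C V U"
      by (rule reg_poly_funs_comp[where C' = coords_E and f = "b t" and \<sigma> = "\<lambda>x. h x *v s", OF U])
  qed
  ultimately show ?thesis by simp
qed

section \<open>Morphisms to and from an associated bundle\<close>

definition matrix_group :: "'m::finite End_E set \<Rightarrow> bool" where
  "matrix_group H \<longleftrightarrow> mat 1 \<in> H \<and> (\<forall>g\<in>H. \<forall>h\<in>H. g ** h \<in> H) \<and>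
     (\<forall>g\<in>H. invertible g \<and> matrix_inv g \<in> H)"

lemma matrix_inv_matrix_mul:
  fixes A B :: "'a::field ^ 'n ^ 'n"
  assumes "invertible A" "invertible B"
  shows "matrix_inv (A ** B) = matrix_inv B ** matrix_inv A"
proof (rule matrix_inv_unique_left)
  have "A ** B ** (matrix_inv B ** matrix_inv A) = A ** (B ** matrix_inv B) ** matrix_inv A"
    by (simp add: matrix_mul_assoc)
  then show "A ** B ** (matrix_inv B ** matrix_inv A) = mat 1"
    by (simp add: matrix_mul_matrix_inv assms)
qed

lemma matrix_inv_matrix_inv:
  fixes A :: "'a::field ^ 'n ^ 'n"
  assumes "invertible A"
  shows "matrix_inv (matrix_inv A) = A" "invertible (matrix_inv A)"
  using matrix_mul_matrix_inv[OF assms] by (auto intro: matrix_inv_unique_left simp: invertible_def)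

lemma matrix_inv_mat_1 [simp]: "matrix_inv (mat 1 :: 'a::field ^ 'n ^ 'n) = mat 1"
  by (rule matrix_inv_unique_left) simp

lemma act_mat_1 [simp]: "act (mat 1) q = q"
  by (simp add: act_def)

lemma act_matrix_mul:
  assumes "invertible g" "invertible h" shows "act (g ** h) q = act g (act h q)"
  by (simp add: act_def matrix_inv_matrix_mul[OF assms] matrix_vector_mul_assoc)

lemma act_matrix_inv: "invertible g \<Longrightarrow> act (matrix_inv g) (act g q) = q"
  by (simp add: matrix_inv_matrix_inv matrix_mul_matrix_inv flip: act_matrix_mul)

text \<open>The factors r^-1 and r cancel, so the action is constant on a class and
  \<open>the_elem\<close> is applied to a singleton.\<close>

lemma beta_bundle_class:
  assumes H: "matrix_group H" and g: "invertible g"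
  shows "beta (bundle_class H (g, f)) = act g f"
proof -
  have "act (g ** matrix_inv r) (act r f) = act g f" if "r \<in> H" for r
  proof -
    have r: "invertible r" using H that by (simp add: matrix_group_def)
    have "act (g ** matrix_inv r) (act r f) = act g (act (matrix_inv r) (act r f))"
      by (rule act_matrix_mul) (simp_all add: g r matrix_inv_matrix_inv)
    then show ?thesis by (simp add: act_matrix_inv r)
  qed
  moreover have "mat 1 \<in> H" using H by (simp add: matrix_group_def)
  ultimately have "(\<lambda>(g, f). act g f) ` bundle_class H (g, f) = {act g f}"
    by (auto simp: bundle_class_def image_iff)
  then show ?thesis by (simp add: beta_def)
qed

text \<open>An element of the group may be moved from one component to the other: substitute s r^-1
  for s in the enumeration of the class.\<close>

lemma bundle_class_eq:
  assumes H: "matrix_group H" and g: "invertible g" and r: "r \<in> H"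
  shows "bundle_class H (g ** r, f) = bundle_class H (g, act r f)"
proof -
  have inv: "invertible s" "matrix_inv s \<in> H" "s ** t \<in> H" if "s \<in> H" "t \<in> H" for s t
    using H that by (auto simp: matrix_group_def)
  have "(\<lambda>s. (g ** r ** matrix_inv s, act s f)) ` H = (\<lambda>s. (g ** matrix_inv s, act s (act r f))) ` H" (is "?f ` H = ?g ` H")
  proof (intro equalityI image_subsetI)
    fix s assume s: "s \<in> H"
    have "?f s = ?g (s ** matrix_inv r)"
    proof -
      have "matrix_inv (s ** matrix_inv r) = r ** matrix_inv s"
        by (simp add: matrix_inv_matrix_mul matrix_inv_matrix_inv inv[OF s r] inv[OF r r])
      moreover have "act (s ** matrix_inv r) (act r f) = act s f"
        by (simp add: act_matrix_mul matrix_inv_matrix_inv inv[OF s r] inv[OF r r] act_matrix_inv)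
      ultimately show ?thesis by (simp add: matrix_mul_assoc)
    qed
    then show "?f s \<in> ?g ` H" using inv(3)[OF s inv(2)[OF r r]] by blast
  next
    fix s assume s: "s \<in> H"
    have "?g s = ?f (s ** r)"
    proof -
      have "g ** r ** (matrix_inv r ** matrix_inv s) = g ** (r ** matrix_inv r) ** matrix_inv s"
        by (simp add: matrix_mul_assoc)
      then show ?thesis
        by (simp add: matrix_inv_matrix_mul inv[OF s r] inv[OF r r] act_matrix_mul matrix_mul_matrix_inv)
    qed
    then show "?g s \<in> ?f ` H" using inv(3)[OF s r] by blast
  qed
  then show ?thesis by (simp add: bundle_class_def)
qed

abbreviation bundle_coords :: "nat \<Rightarrow> ('m::finite End_E \<times> ('m E \<Rightarrow> complex) \<Rightarrow> complex) set" where
  "bundle_coords d \<equiv> (\<lambda>c. c \<circ> fst) ` coords_End \<union> (\<lambda>c. c \<circ> snd) ` coords_forms d"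

lemma topspace_quotient_topology: "topspace (quotient_topology T \<pi>) = \<pi> ` topspace T"
proof
  have "{x \<in> topspace T. \<pi> x \<in> \<pi> ` topspace T} = topspace T" by auto
  then have "openin (quotient_topology T \<pi>) (\<pi> ` topspace T)" by (simp add: openin_quotient_topology)
  then show "\<pi> ` topspace T \<subseteq> topspace (quotient_topology T \<pi>)" by (rule openin_subset)
  show "topspace (quotient_topology T \<pi>) \<subseteq> \<pi> ` topspace T"
    using openin_topspace[of "quotient_topology T \<pi>"] unfolding openin_quotient_topology by blast
qed

lemma topspace_assoc_bundle: "topspace (topol (assoc_bundle d L H W)) = bundle_points L H W"
  by (simp add: assoc_bundle_def quotient_variety_def topspace_quotient_topology bundle_points_def)

lemma openin_assoc_bundle:
  "openin (topol (assoc_bundle d L H W)) U \<longleftrightarrow> U \<subseteq> bundle_points L H W \<and>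
    openin (zariski (bundle_coords d) (L \<times> W)) {x \<in> L \<times> W. bundle_class H x \<in> U}"
  by (simp add: assoc_bundle_def quotient_variety_def openin_quotient_topology bundle_points_def)

lemma regular_assoc_bundle:
  "f \<in> regular (assoc_bundle d L H W) U \<longleftrightarrow>
    (\<lambda>x. f (bundle_class H x)) \<in> reg (bundle_coords d) (L \<times> W) {x \<in> L \<times> W. bundle_class H x \<in> U}"
  by (simp add: assoc_bundle_def quotient_variety_def reg_def o_def)

text \<open>Open sets and functions of the quotient are by definition tested on the product, where
  the map becomes (g, f) -> g f. Its coordinates are regular by Cramer's rule for g^-1 and
  substitution into forms.\<close>

lemma morphism_beta:
  fixes L H :: "'m::finite End_E set"
  assumes H: "matrix_group H" and L: "\<And>g. g \<in> L \<Longrightarrow> invertible g" and W: "W \<subseteq> forms d"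
    and act: "\<And>g f. g \<in> L \<Longrightarrow> f \<in> W \<Longrightarrow> act g f \<in> W'"
  shows "morphism (assoc_bundle d L H W) (forms_variety d W') beta"
proof -
  let ?C = "bundle_coords d :: ('m End_E \<times> ('m E \<Rightarrow> complex) \<Rightarrow> complex) set" and ?V = "L \<times> W"
  define \<sigma> where "\<sigma> x = act (fst x) (snd x)" for x :: "'m End_E \<times> ('m E \<Rightarrow> complex)"
  have beta: "beta (bundle_class H x) = \<sigma> x" if "x \<in> ?V" for x
    using that L beta_bundle_class[OF H] by (cases x) (auto simp: \<sigma>_def)
  have U: "openin (zariski ?C ?V) ?V" using openin_topspace[of "zariski ?C ?V"] by simp
  have fst_reg: "(\<lambda>x. fst x $ i $ j) \<in> reg ?C ?V ?V" for i j
  proof (intro reg_poly_funs[OF U] poly_funs.gen)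
    have "(\<lambda>g::'m End_E. g $ i $ j) \<in> coords_End" by (force simp: coords_End_def)
    then have "(\<lambda>g. g $ i $ j) \<circ> fst \<in> ?C" by blast
    then show "(\<lambda>x. fst x $ i $ j) \<in> ?C" by (simp add: o_def)
  qed
  have snd_reg: "(\<lambda>x. l (snd x)) \<in> reg ?C ?V ?V" if "l \<in> coords_forms d" for l
  proof (intro reg_poly_funs[OF U] poly_funs.gen)
    have "l \<circ> snd \<in> ?C" using that by blast
    then show "(\<lambda>x. l (snd x)) \<in> ?C" by (simp add: o_def)
  qed
  have \<sigma>_reg: "(\<lambda>x. l (\<sigma> x)) \<in> reg ?C ?V ?V" if l: "l \<in> coords_forms d" for l
  proof -
    \<comment> \<open>\<open>reg_form_comp\<close> asks for a form at every argument, so the zero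
      form serves as default off the variety.\<close>
    define F where "F x = (if x \<in> ?V then snd x else (\<lambda>X. 0))" for x :: "'m End_E \<times> ('m E \<Rightarrow> complex)"
    have F: "F x \<in> forms d" for x using W zero_forms by (auto simp: F_def)
    have "(\<lambda>x. l (\<lambda>X. F x (matrix_inv (fst x) *v X))) \<in> reg ?C ?V ?V"
    proof (rule reg_form_comp[OF U F _ _ l])
      show "(\<lambda>x. l (F x)) \<in> reg ?C ?V ?V" if "l \<in> coords_forms d" for l
        by (subst reg_cong[of _ _ "\<lambda>x. l (snd x)"]) (auto simp: F_def snd_reg[OF that])
      show "(\<lambda>x. matrix_inv (fst x) $ i $ j) \<in> reg ?C ?V ?V" for i j
        using L by (intro reg_matrix_inv[OF U] fst_reg) (auto simp: invertible_det_nz)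
    qed
    then show ?thesis
      by (subst reg_cong[of _ _ "\<lambda>x. l (\<lambda>X. F x (matrix_inv (fst x) *v X))"]) (auto simp: F_def \<sigma>_def act_def)
  qed
  have \<sigma>W: "\<sigma> x \<in> W'" if "x \<in> ?V" for x using that act by (auto simp: \<sigma>_def)
  have eq: "{x \<in> ?V. bundle_class H x \<in> {c \<in> bundle_points L H W. beta c \<in> Z}} = {x \<in> ?V. \<sigma> x \<in> Z}" for Z
    using beta by (auto simp: bundle_points_def)
  show ?thesis
    unfolding morphism_def continuous_map_def
  proof (intro conjI allI impI)
    show "beta \<in> topspace (topol (assoc_bundle d L H W)) \<rightarrow> topspace (topol (forms_variety d W'))"
      unfolding topspace_assoc_bundle using beta \<sigma>W by (auto simp: bundle_points_def)
  next
    fix Z assume "openin (topol (forms_variety d W')) Z"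
    then have "openin (zariski ?C ?V) {x \<in> ?V. \<sigma> x \<in> Z}"
      using \<sigma>_reg \<sigma>W by (intro openin_vimage_zariski[where C' = "coords_forms d" and V' = W'] U) auto
    then show "openin (topol (assoc_bundle d L H W)) {x \<in> topspace (topol (assoc_bundle d L H W)). beta x \<in> Z}"
      unfolding topspace_assoc_bundle openin_assoc_bundle eq by auto
  next
    fix Z f assume "f \<in> regular (forms_variety d W') Z"
    then have "f \<in> reg (coords_forms d) W' Z" by (simp add: reg_def)
    then have "(\<lambda>x. f (\<sigma> x)) \<in> reg ?C ?V {x \<in> ?V. \<sigma> x \<in> Z}"
      using \<sigma>_reg \<sigma>W by (intro reg_comp[where C' = "coords_forms d" and V' = W'] U) auto
    then show "f \<circ> beta \<in> regular (assoc_bundle d L H W) {x \<in> topspace (topol (assoc_bundle d L H W)). beta x \<in> Z}"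
      unfolding topspace_assoc_bundle regular_assoc_bundle eq
      by (subst reg_cong[of _ _ "\<lambda>x. f (\<sigma> x)"]) (auto simp: beta)
  qed
qed

text \<open>Local lifts to the product suffice: both continuity and regularity into the quotient are
  conditions on the product, and these pull back along the lift \<sigma>.\<close>

lemma morphism_assoc_bundleI:
  fixes L H :: "'m::finite End_E set"
  assumes "\<And>y. y \<in> V \<Longrightarrow> \<exists>U \<sigma>. openin (zariski C V) U \<and> y \<in> U \<and>
      (\<forall>z\<in>U. \<sigma> z \<in> L \<times> W \<and> \<psi> z = bundle_class H (\<sigma> z)) \<and>
      (\<forall>c\<in>bundle_coords d. (\<lambda>z. c (\<sigma> z)) \<in> reg C V U)"
  shows "morphism (quasi_affine C V) (assoc_bundle d L H W) \<psi>"
  unfolding morphism_def continuous_map_def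
proof (intro conjI allI impI)
  show "\<psi> \<in> topspace (topol (quasi_affine C V)) \<rightarrow> topspace (topol (assoc_bundle d L H W))"
  proof
    fix y assume "y \<in> topspace (topol (quasi_affine C V))"
    then obtain U \<sigma> where "y \<in> U" "\<forall>z\<in>U. \<sigma> z \<in> L \<times> W \<and> \<psi> z = bundle_class H (\<sigma> z)"
      using assms[of y] by auto
    then show "\<psi> y \<in> topspace (topol (assoc_bundle d L H W))"
      unfolding topspace_assoc_bundle bundle_points_def by blast
  qed
next
  fix Z assume "openin (topol (assoc_bundle d L H W)) Z"
  then have Z: "openin (zariski (bundle_coords d) (L \<times> W)) {x \<in> L \<times> W. bundle_class H x \<in> Z}"
    by (simp add: openin_assoc_bundle)
  show "openin (topol (quasi_affine C V)) {x \<in> topspace (topol (quasi_affine C V)). \<psi> x \<in> Z}"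
  proof (subst openin_subopen, intro ballI)
    fix y assume "y \<in> {x \<in> topspace (topol (quasi_affine C V)). \<psi> x \<in> Z}"
    then have y: "y \<in> V" "\<psi> y \<in> Z" by auto
    obtain U \<sigma> where U: "openin (zariski C V) U" "y \<in> U"
      and \<sigma>: "\<And>z. z \<in> U \<Longrightarrow> \<sigma> z \<in> L \<times> W" "\<And>z. z \<in> U \<Longrightarrow> \<psi> z = bundle_class H (\<sigma> z)"
      and reg: "\<And>c. c \<in> bundle_coords d \<Longrightarrow> (\<lambda>z. c (\<sigma> z)) \<in> reg C V U"
      using assms[OF y(1)] by metis
    have "openin (zariski C V) {x \<in> U. \<sigma> x \<in> {x \<in> L \<times> W. bundle_class H x \<in> Z}}"
      by (rule openin_vimage_zariski[where C' = "bundle_coords d" and V' = "L \<times> W"])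
        (use U(1) reg \<sigma>(1) Z in auto)
    then show "\<exists>T. openin (topol (quasi_affine C V)) T \<and> y \<in> T \<and>
        T \<subseteq> {x \<in> topspace (topol (quasi_affine C V)). \<psi> x \<in> Z}"
      using \<sigma> y U openin_subset[OF U(1)]
      by (intro exI[of _ "{x \<in> U. \<sigma> x \<in> {x \<in> L \<times> W. bundle_class H x \<in> Z}}"]) auto
  qed
next
  fix Z f assume "openin (topol (assoc_bundle d L H W)) Z" and f: "f \<in> regular (assoc_bundle d L H W) Z"
  then have Z: "openin (zariski (bundle_coords d) (L \<times> W)) {x \<in> L \<times> W. bundle_class H x \<in> Z}"
    by (simp add: openin_assoc_bundle)
  have "f \<circ> \<psi> \<in> reg C V {x \<in> V. \<psi> x \<in> Z}"
  proof (rule reg_local)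
    fix y assume "y \<in> {x \<in> V. \<psi> x \<in> Z}"
    then have y: "y \<in> V" "\<psi> y \<in> Z" by auto
    obtain U \<sigma> where U: "openin (zariski C V) U" "y \<in> U"
      and \<sigma>: "\<And>z. z \<in> U \<Longrightarrow> \<sigma> z \<in> L \<times> W" "\<And>z. z \<in> U \<Longrightarrow> \<psi> z = bundle_class H (\<sigma> z)"
      and reg: "\<And>c. c \<in> bundle_coords d \<Longrightarrow> (\<lambda>z. c (\<sigma> z)) \<in> reg C V U"
      using assms[OF y(1)] by metis
    let ?T = "{x \<in> U. \<sigma> x \<in> {x \<in> L \<times> W. bundle_class H x \<in> Z}}"
    have "openin (zariski C V) ?T"
      by (rule openin_vimage_zariski[where C' = "bundle_coords d" and V' = "L \<times> W"])
        (use U(1) reg \<sigma>(1) Z in auto)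
    moreover have "(\<lambda>x. f (bundle_class H (\<sigma> x))) \<in> reg C V ?T"
      by (rule reg_comp[where C' = "bundle_coords d" and V' = "L \<times> W" and \<sigma> = \<sigma>])
        (use U(1) reg \<sigma>(1) f[unfolded regular_assoc_bundle] in auto)
    then have "f \<circ> \<psi> \<in> reg C V ?T" by (subst reg_cong[of _ _ "\<lambda>x. f (bundle_class H (\<sigma> x))"]) (auto simp: \<sigma>(2))
    ultimately show "\<exists>U'. openin (zariski C V) U' \<and> y \<in> U' \<and> U' \<subseteq> {x \<in> V. \<psi> x \<in> Z} \<and> f \<circ> \<psi> \<in> reg C V U'"
      using \<sigma> y U openin_subset[OF U(1)] by (intro exI[of _ ?T]) auto
  qed
  then show "f \<circ> \<psi> \<in> regular (quasi_affine C V) {x \<in> topspace (topol (quasi_affine C V)). \<psi> x \<in> Z}"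
    by (simp add: reg_def)
qed

section \<open>Sections of kernels of constant rank\<close>

text \<open>Rows that form a basis of the row space at \<open>x0\<close> are completed by constant
  vectors to an invertible matrix \<open>Q x0\<close>. Where \<open>Q x\<close> is still invertible,
  it embeds \<open>K x\<close> into the space \<open>Z\<close> of vectors vanishing at the chosen
  rows; the injections \<open>T\<close> bound the dimension of \<open>K x\<close> from below, so the
  embedding is onto. Hence \<open>Q x0 *v a0\<close>, a vector of \<open>Z\<close>, can be pulled
  back by \<open>Q x\<close>, which returns \<open>a0\<close> itself at \<open>x0\<close>. The
  system may have infinitely many rows.\<close>

lemma constant_rank_section:
  fixes M :: "'r \<Rightarrow> 'x \<Rightarrow> complex ^ 'k"
  assumes K: "\<And>x. x \<in> V \<Longrightarrow> K x = {a. \<forall>r. (\<Sum>j\<in>UNIV. M r x $ j * a $ j) = 0}"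
    and x0: "x0 \<in> V" and a0: "a0 \<in> K x0"
    and T: "\<And>x. x \<in> V \<Longrightarrow> \<exists>T. Vector_Spaces.linear (*s) (*s) T \<and> inj T \<and> T ` K x0 \<subseteq> K x"
  obtains Q :: "'x \<Rightarrow> complex ^ 'k ^ 'k" where
    "\<And>i. (\<exists>r. \<forall>x. Q x $ i = M r x) \<or> (\<exists>v. \<forall>x. Q x $ i = v)"
    "det (Q x0) \<noteq> 0"
    "\<And>x. x \<in> V \<Longrightarrow> det (Q x) \<noteq> 0 \<Longrightarrow> matrix_inv (Q x) *v (Q x0 *v a0) \<in> K x"
proof -
  obtain B1 where B1: "B1 \<subseteq> range (\<lambda>r. M r x0)" "vec.independent B1" "range (\<lambda>r. M r x0) \<subseteq> vec.span B1"
    using vec.maximal_independent_subset by metis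
  define B where "B = vec.extend_basis B1"
  have B: "B1 \<subseteq> B" "vec.independent B" "vec.span B = UNIV"
    using vec.extend_basis_superset vec.independent_extend_basis vec.span_extend_basis B1(2)
    by (auto simp: B_def)
  have "card B = CARD('k)"
    using vec.dim_eq_card_independent[OF B(2)] vec.dim_span[of B] unfolding B(3)
    by (simp add: vec.dimension_def card_cart_basis)
  moreover have "finite B" using B(2) by (rule vec.finiteI_independent)
  ultimately obtain f where f: "bij_betw f (UNIV :: 'k set) B"
    using finite_same_card_bij by (metis finite_class.finite_UNIV)
  have "\<exists>r. f i \<in> B1 \<longrightarrow> M r x0 = f i" for i
  proof (cases "f i \<in> B1")
    case True
    then obtain r where "f i = M r x0" using B1(1) by blast
    then show ?thesis by metis
  qed simp
  then obtain r where r: "\<And>i. f i \<in> B1 \<Longrightarrow> M (r i) x0 = f i" by metis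
  \<comment> \<open>Only the rows taken from the system vary with x; the completing rows stay
    fixed.\<close>
  define Q where "Q x = (\<chi> i. if f i \<in> B1 then M (r i) x else f i)" for x
  have Qx0: "Q x0 $ i = f i" for i by (simp add: Q_def r)
  have "rows (Q x0) = B"
    using f unfolding rows_def row_def bij_betw_def by (auto simp: Qx0)
  then have det0: "det (Q x0) \<noteq> 0"
    using B(3) matrix_left_invertible_span_rows_gen[of "Q x0"]
    by (simp add: invertible_left_inverse flip: invertible_det_nz)
  define Z where "Z = {z :: complex ^ 'k. \<forall>i. f i \<in> B1 \<longrightarrow> z $ i = 0}"
  have QZ: "Q x *v a \<in> Z" if "x \<in> V" "a \<in> K x" for x a
    using that unfolding K[OF that(1)] Z_def by (simp add: Q_def matrix_vector_mult_def)
  \<comment> \<open>The chosen rows span all rows at \<open>x0\<close>, so vanishing against them is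
    already membership in the kernel.\<close>
  have KQ: "a \<in> K x0" if "Q x0 *v a \<in> Z" for a
  proof -
    have "vec.subspace {v. (\<Sum>j\<in>UNIV. v $ j * a $ j) = 0}"
      unfolding vec.subspace_def
      by (auto simp: distrib_right sum.distrib mult.assoc simp flip: sum_distrib_left)
    moreover have "B1 \<subseteq> {v. (\<Sum>j\<in>UNIV. v $ j * a $ j) = 0}"
    proof
      fix v assume v: "v \<in> B1"
      then obtain i where i: "v = f i" using f B(1) unfolding bij_betw_def by blast
      have "(Q x0 *v a) $ i = 0" using that v i by (simp add: Z_def)
      then show "v \<in> {v. (\<Sum>j\<in>UNIV. v $ j * a $ j) = 0}"
        by (simp add: matrix_vector_mult_def Qx0 i)
    qed
    ultimately have "vec.span B1 \<subseteq> {v. (\<Sum>j\<in>UNIV. v $ j * a $ j) = 0}" by (rule vec.span_minimal[rotated])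
    then show ?thesis using B1(3) unfolding K[OF x0] by blast
  qed
  have subK: "vec.subspace (K x)" if "x \<in> V" for x
    unfolding K[OF that] vec.subspace_def
    by (auto simp: distrib_left sum.distrib mult.left_commute simp flip: sum_distrib_left)
  have subZ: "vec.subspace Z" unfolding Z_def vec.subspace_def by auto
  have inj: "inj ((*v) A)" if "det A \<noteq> 0" for A :: "complex ^ 'k ^ 'k"
    using that by (simp add: invertible_left_inverse flip: invertible_det_nz matrix_left_invertible_injective)
  have lin: "Vector_Spaces.linear (*s) (*s) ((*v) A)" for A :: "complex ^ 'k ^ 'k"
    by (rule matrix_vector_mul_linear_gen)
  have dim_im: "vec.dim (h ` S) = vec.dim S"
    if "Vector_Spaces.linear (*s) (*s) h" "inj h" for h :: "complex ^ 'k \<Rightarrow> complex ^ 'k" and S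
    by (rule vec.dim_image_eq[OF that(1)]) (use that(2) in \<open>auto intro: inj_on_subset\<close>)
  have "Z \<subseteq> (*v) (Q x0) ` K x0"
  proof
    fix z assume z: "z \<in> Z"
    have "Q x0 *v (matrix_inv (Q x0) *v z) = z"
      using det0 by (simp add: matrix_vector_mul_assoc matrix_mul_matrix_inv flip: invertible_det_nz)
    with z show "z \<in> (*v) (Q x0) ` K x0" using KQ by (metis imageI)
  qed
  then have dimZ: "vec.dim Z \<le> vec.dim (K x0)"
    using vec.dim_subset dim_im[OF lin inj[OF det0]] by metis
  have "matrix_inv (Q x) *v (Q x0 *v a0) \<in> K x" if x: "x \<in> V" and det: "det (Q x) \<noteq> 0" for x
  proof -
    obtain h where h: "Vector_Spaces.linear (*s) (*s) h" "inj h" "h ` K x0 \<subseteq> K x" using T[OF x] by blast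
    \<comment> \<open>This is where constancy of the rank enters; it forces the image of
      \<open>K x\<close> to fill \<open>Z\<close>.\<close>
    have "vec.dim Z \<le> vec.dim (K x)"
      using dimZ vec.dim_subset[OF h(3)] dim_im[OF h(1,2)] by simp
    then have "vec.dim Z \<le> vec.dim ((*v) (Q x) ` K x)" by (simp add: dim_im[OF lin inj[OF det]])
    moreover have "(*v) (Q x) ` K x \<subseteq> Z" using QZ[OF x] by blast
    moreover have "vec.subspace ((*v) (Q x) ` K x)"
      by (rule vec.linear_subspace_image[OF lin subK[OF x]])
    ultimately have "(*v) (Q x) ` K x = Z" using subZ by (intro vec.subspace_dim_equal) auto
    moreover have "Q x0 *v a0 \<in> Z" by (rule QZ[OF x0 a0])
    ultimately obtain a where a: "a \<in> K x" "Q x0 *v a0 = Q x *v a" by blast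
    have "matrix_inv (Q x) *v (Q x *v a) = a"
      using det by (simp add: matrix_vector_mul_assoc matrix_mul_matrix_inv flip: invertible_det_nz)
    with a show ?thesis by simp
  qed
  moreover have "(\<exists>r. \<forall>x. Q x $ i = M r x) \<or> (\<exists>v. \<forall>x. Q x $ i = v)" for i
    by (auto simp: Q_def)
  ultimately show ?thesis using that det0 by blast
qed

section \<open>The permanent and its directional derivatives\<close>

definition perm_deriv :: "'i set \<Rightarrow> ('i \<Rightarrow> 'i \<Rightarrow> complex) \<Rightarrow> ('i \<Rightarrow> 'i \<Rightarrow> complex) \<Rightarrow> complex" where
  "perm_deriv I M V = (\<Sum>\<sigma> | \<sigma> permutes I. \<Sum>i\<in>I. V i (\<sigma> i) * (\<Prod>j\<in>I - {i}. M j (\<sigma> j)))"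

lemma permanent_scale: "permanent I (\<lambda>i j. c * M i j) = c ^ card I * permanent I M"
  by (simp add: permanent_def prod.distrib sum_distrib_left)

lemma permanent_has_field_derivative:
  "((\<lambda>t. permanent I (\<lambda>i j. M i j + t * V i j)) has_field_derivative perm_deriv I M V) (at 0)"
proof -
  have "((\<lambda>t. \<Prod>i\<in>I. M i (\<sigma> i) + t * V i (\<sigma> i)) has_field_derivative
      (\<Sum>i\<in>I. V i (\<sigma> i) * (\<Prod>j\<in>I - {i}. M j (\<sigma> j) + 0 * V j (\<sigma> j)))) (at 0)" for \<sigma>
    by (rule has_field_derivative_prod) (auto intro!: derivative_eq_intros)
  then show ?thesis unfolding permanent_def perm_deriv_def
    by (intro DERIV_sum) simp
qed

lemma permanent_cong: "(\<And>i j. i \<in> I \<Longrightarrow> j \<in> I \<Longrightarrow> M i j = N i j) \<Longrightarrow> permanent I M = permanent I N"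
  unfolding permanent_def by (intro sum.cong prod.cong) (auto simp: permutes_in_image)

lemma perm_deriv_cong:
  "(\<And>i j. i \<in> I \<Longrightarrow> j \<in> I \<Longrightarrow> M i j = N i j) \<Longrightarrow> (\<And>i j. i \<in> I \<Longrightarrow> j \<in> I \<Longrightarrow> V i j = W i j) \<Longrightarrow>
    perm_deriv I M V = perm_deriv I N W"
  unfolding perm_deriv_def by (intro sum.cong prod.cong arg_cong2[of _ _ _ _ "(*)"]) (auto simp: permutes_in_image)

lemma perm_deriv_add: "perm_deriv I M (\<lambda>i j. V i j + W i j) = perm_deriv I M V + perm_deriv I M W"
  by (simp add: perm_deriv_def distrib_right sum.distrib)

lemma perm_deriv_scale: "perm_deriv I M (\<lambda>i j. c * V i j) = c * perm_deriv I M V"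
  by (simp add: perm_deriv_def sum_distrib_left mult.assoc)

lemma perm_deriv_matrix_scale:
  "finite I \<Longrightarrow> perm_deriv I (\<lambda>i j. c * M i j) V = c ^ (card I - 1) * perm_deriv I M V"
  by (simp add: perm_deriv_def prod.distrib sum_distrib_left mult.left_commute)

lemma bij_betw_compose_permutes:
  assumes "\<tau> permutes I" shows "bij_betw (\<lambda>\<sigma>. \<tau> \<circ> \<sigma>) {\<sigma>. \<sigma> permutes I} {\<sigma>. \<sigma> permutes I}"
  using permutes_inverses[OF assms]
  by (intro bij_betw_byWitness[where f' = "\<lambda>\<sigma>. inv \<tau> \<circ> \<sigma>"])
    (auto simp: fun_eq_iff permutes_compose[OF _ assms] permutes_compose[OF _ permutes_inv[OF assms]])

text \<open>Reindex the sum by \<sigma> -> \<tau> o \<sigma>. Permuting columns serves to move a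
  given entry onto the diagonal.\<close>

lemma permanent_columns:
  assumes "\<tau> permutes I" shows "permanent I (\<lambda>i j. M i (\<tau> j)) = permanent I M"
  unfolding permanent_def
  by (rule sum.reindex_bij_betw[of "\<lambda>\<sigma>. \<tau> \<circ> \<sigma>", where g = "\<lambda>\<sigma>. \<Prod>i\<in>I. M i (\<sigma> i)", unfolded o_def])
    (rule bij_betw_compose_permutes[OF assms, unfolded o_def])

lemma perm_deriv_columns:
  assumes "\<tau> permutes I" shows "perm_deriv I (\<lambda>i j. M i (\<tau> j)) (\<lambda>i j. V i (\<tau> j)) = perm_deriv I M V"
  unfolding perm_deriv_def
  by (rule sum.reindex_bij_betw[of "\<lambda>\<sigma>. \<tau> \<circ> \<sigma>", where g = "\<lambda>\<sigma>. \<Sum>i\<in>I. V i (\<sigma> i) * (\<Prod>j\<in>I - {i}. M j (\<sigma> j))", unfolded o_def])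
    (rule bij_betw_compose_permutes[OF assms, unfolded o_def])

section \<open>Sparse test matrices\<close>

text \<open>A diagonal matrix with two further entries at mirrored positions, so sparse that only
  the identity and one transposition contribute to the permanent.\<close>

definition near_diag :: "'i \<Rightarrow> 'i \<Rightarrow> ('i \<Rightarrow> complex) \<Rightarrow> complex \<Rightarrow> complex \<Rightarrow> 'i \<Rightarrow> 'i \<Rightarrow> complex" where
  "near_diag p q y b c i j =
     (if i = j then y i else if i = p \<and> j = q then b else if i = q \<and> j = p then c else 0)"

lemma near_diag_same [simp]: "near_diag p q y b c i i = y i"
  by (simp add: near_diag_def)

text \<open>The index \<open>a\<close> is exempt because each term of the derivative lacks one
  factor. Injectivity of \<sigma> makes up for the missing information at \<open>a\<close>.\<close>

lemma near_diag_support: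
  assumes \<sigma>: "\<sigma> permutes I" and pq: "p \<in> I" "q \<in> I" "p \<noteq> q"
    and nz: "\<And>j. j \<in> I - {a} \<Longrightarrow> near_diag p q y b c j (\<sigma> j) \<noteq> 0"
  shows "\<sigma> = id \<or> \<sigma> = Transposition.transpose p q"
proof -
  have inj: "\<sigma> i = \<sigma> j \<Longrightarrow> i = j" for i j using permutes_inj[OF \<sigma>] by (auto dest: injD)
  have out: "\<sigma> j = j" if "j \<notin> {p, q, a}" for j
  proof (cases "j \<in> I")
    case True
    then show ?thesis using nz[of j] that by (auto simp: near_diag_def split: if_splits)
  next
    case False
    then show ?thesis using permutes_not_in[OF \<sigma>] by simp
  qed
  have p: "\<sigma> p \<in> {p, q}" if "p \<noteq> a" using nz[of p] that pq by (auto simp: near_diag_def split: if_splits)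
  have q: "\<sigma> q \<in> {p, q}" if "q \<noteq> a" using nz[of q] that pq by (auto simp: near_diag_def split: if_splits)
  have a: "\<sigma> a \<in> {p, q, a}" using out inj by blast
  have P: "\<sigma> p \<in> {p, q}" using p a by (cases "p = a") auto
  have Q: "\<sigma> q \<in> {p, q}" using q a by (cases "q = a") auto
  have ne: "\<sigma> p \<noteq> \<sigma> q" using inj pq(3) by blast
  have sw: "\<sigma> p = p \<and> \<sigma> q = q \<or> \<sigma> p = q \<and> \<sigma> q = p" using P Q ne by auto
  have aa: "\<sigma> a = a" if "a \<notin> {p, q}"
  proof -
    have "\<sigma> a \<noteq> \<sigma> p" "\<sigma> a \<noteq> \<sigma> q" using inj that by auto
    then show ?thesis using a sw by auto
  qed
  have fixed: "\<sigma> j = j" if "j \<notin> {p, q}" for j using out that aa by (cases "j = a") auto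
  show ?thesis
  proof (cases "\<sigma> p = p")
    case True
    then have "\<sigma> j = id j" for j using sw fixed pq(3) by (cases "j \<in> {p, q}") auto
    then show ?thesis by blast
  next
    case False
    then have "\<sigma> j = Transposition.transpose p q j" for j
      using sw fixed by (cases "j \<in> {p, q}") (auto simp: transpose_def)
    then show ?thesis by blast
  qed
qed

lemma sum_permutations_two:
  assumes "finite I" "p \<in> I" "q \<in> I" "p \<noteq> q"
    and "\<And>\<sigma>. \<sigma> permutes I \<Longrightarrow> \<sigma> \<noteq> id \<Longrightarrow> \<sigma> \<noteq> Transposition.transpose p q \<Longrightarrow> f \<sigma> = 0"
  shows "(\<Sum>\<sigma> | \<sigma> permutes I. f \<sigma>) = f id + f (Transposition.transpose p q :: 'i \<Rightarrow> 'i)"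
proof -
  have ne: "id \<noteq> (Transposition.transpose p q :: 'i \<Rightarrow> 'i)" using assms(4) by (metis id_apply transpose_apply_first)
  have "(\<Sum>\<sigma> | \<sigma> permutes I. f \<sigma>) = (\<Sum>\<sigma>\<in>{id, Transposition.transpose p q}. f \<sigma>)"
    using assms by (intro sum.mono_neutral_right finite_permutations)
      (auto simp: permutes_swap_id)
  then show ?thesis using ne by simp
qed

lemma permanent_near_diag:
  assumes I: "finite I" "p \<in> I" "q \<in> I" "p \<noteq> q"
  shows "permanent I (near_diag p q y b c) = (\<Prod>i\<in>I. y i) + b * c * (\<Prod>i\<in>I - {p, q}. y i)"
proof -
  have "(\<Prod>i\<in>I. near_diag p q y b c i (\<sigma> i)) = 0"
    if "\<sigma> permutes I" "\<sigma> \<noteq> id" "\<sigma> \<noteq> Transposition.transpose p q" for \<sigma>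
    using near_diag_support[OF that(1) I(2-4), of p y b c] that I(1) by auto
  then have "permanent I (near_diag p q y b c) = (\<Prod>i\<in>I. near_diag p q y b c i (id i)) +
      (\<Prod>i\<in>I. near_diag p q y b c i (Transposition.transpose p q i))"
    unfolding permanent_def by (rule sum_permutations_two[OF I])
  also have "(\<Prod>i\<in>I. near_diag p q y b c i (Transposition.transpose p q i)) =
      (\<Prod>i\<in>insert p (insert q (I - {p, q})). near_diag p q y b c i (Transposition.transpose p q i))"
    using I by (intro prod.cong) auto
  also have "\<dots> = b * (c * (\<Prod>i\<in>I - {p, q}. near_diag p q y b c i (Transposition.transpose p q i)))"
    using I by (simp add: near_diag_def)
  also have "(\<Prod>i\<in>I - {p, q}. near_diag p q y b c i (Transposition.transpose p q i)) = (\<Prod>i\<in>I - {p, q}. y i)"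
    by (intro prod.cong) (auto simp: near_diag_def transpose_def)
  finally show ?thesis by (simp add: mult.assoc)
qed

text \<open>In the transposition's contribution, differentiating a factor outside {p, q} leaves both
  b and c in the product. The assumption that one of them is 0 removes these terms.\<close>

lemma perm_deriv_near_diag:
  assumes I: "finite I" "p \<in> I" "q \<in> I" "p \<noteq> q" and bc: "b = 0 \<or> c = 0"
  shows "perm_deriv I (near_diag p q y b c) V = (\<Sum>i\<in>I. V i i * (\<Prod>j\<in>I - {i}. y j)) +
    (V p q * c + V q p * b) * (\<Prod>i\<in>I - {p, q}. y i)"
proof -
  let ?N = "near_diag p q y b c" and ?t = "Transposition.transpose p q"
  have "(\<Sum>i\<in>I. V i (\<sigma> i) * (\<Prod>j\<in>I - {i}. ?N j (\<sigma> j))) = 0"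
    if "\<sigma> permutes I" "\<sigma> \<noteq> id" "\<sigma> \<noteq> ?t" for \<sigma>
  proof (rule sum.neutral, rule ballI)
    fix i assume "i \<in> I"
    have "\<exists>j\<in>I - {i}. ?N j (\<sigma> j) = 0" using near_diag_support[OF that(1) I(2-4), of i y b c] that by blast
    then show "V i (\<sigma> i) * (\<Prod>j\<in>I - {i}. ?N j (\<sigma> j)) = 0" using I(1) by auto
  qed
  then have "perm_deriv I ?N V = (\<Sum>i\<in>I. V i (id i) * (\<Prod>j\<in>I - {i}. ?N j (id j))) +
      (\<Sum>i\<in>I. V i (?t i) * (\<Prod>j\<in>I - {i}. ?N j (?t j)))"
    unfolding perm_deriv_def by (rule sum_permutations_two[OF I])
  also have "(\<Sum>i\<in>I. V i (?t i) * (\<Prod>j\<in>I - {i}. ?N j (?t j))) =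
      (\<Sum>i\<in>insert p (insert q (I - {p, q})). V i (?t i) * (\<Prod>j\<in>I - {i}. ?N j (?t j)))"
    using I by (intro sum.cong) auto
  also have "\<dots> = V p q * (\<Prod>j\<in>I - {p}. ?N j (?t j)) + (V q p * (\<Prod>j\<in>I - {q}. ?N j (?t j)) +
      (\<Sum>i\<in>I - {p, q}. V i (?t i) * (\<Prod>j\<in>I - {i}. ?N j (?t j))))"
    using I by simp
  also have "(\<Sum>i\<in>I - {p, q}. V i (?t i) * (\<Prod>j\<in>I - {i}. ?N j (?t j))) = 0"
  proof (rule sum.neutral, rule ballI)
    fix i assume i: "i \<in> I - {p, q}"
    have "?N p (?t p) = 0 \<or> ?N q (?t q) = 0" using bc I by (auto simp: near_diag_def)
    then have "\<exists>j\<in>I - {i}. ?N j (?t j) = 0" using i I by blast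
    then show "V i (?t i) * (\<Prod>j\<in>I - {i}. ?N j (?t j)) = 0" using I(1) by auto
  qed
  also have "(\<Prod>j\<in>I - {p}. ?N j (?t j)) = c * (\<Prod>j\<in>I - {p, q}. y j)"
  proof -
    have "(\<Prod>j\<in>I - {p}. ?N j (?t j)) = (\<Prod>j\<in>insert q (I - {p, q}). ?N j (?t j))"
      using I by (intro prod.cong) auto
    also have "\<dots> = c * (\<Prod>j\<in>I - {p, q}. ?N j (?t j))" using I by (simp add: near_diag_def)
    also have "(\<Prod>j\<in>I - {p, q}. ?N j (?t j)) = (\<Prod>j\<in>I - {p, q}. y j)"
      by (intro prod.cong) (auto simp: near_diag_def transpose_def)
    finally show ?thesis .
  qed
  also have "(\<Prod>j\<in>I - {q}. ?N j (?t j)) = b * (\<Prod>j\<in>I - {p, q}. y j)"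
  proof -
    have "(\<Prod>j\<in>I - {q}. ?N j (?t j)) = (\<Prod>j\<in>insert p (I - {p, q}). ?N j (?t j))"
      using I by (intro prod.cong) auto
    also have "\<dots> = b * (\<Prod>j\<in>I - {p, q}. ?N j (?t j))" using I by (simp add: near_diag_def)
    also have "(\<Prod>j\<in>I - {p, q}. ?N j (?t j)) = (\<Prod>j\<in>I - {p, q}. y j)"
      by (intro prod.cong) (auto simp: near_diag_def transpose_def)
    finally show ?thesis .
  qed
  finally show ?thesis by (simp add: algebra_simps)
qed

text \<open>After a column permutation the nonzero entry of the direction is diagonal. For the
  diagonal matrix with t at \<open>i0\<close> and 1 elsewhere the permanent is t, and the derivative
  is affine in t with nonzero constant term, so it cannot vanish at both 1 and -1.\<close>

lemma exists_permanent_perm_deriv_nonzero: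
  assumes I: "finite I" "i0 \<in> I" "j0 \<in> I" "2 \<le> card I" and V: "V i0 j0 \<noteq> 0"
  shows "\<exists>M. permanent I M \<noteq> 0 \<and> perm_deriv I M V \<noteq> 0"
proof -
  define \<tau> where "\<tau> = Transposition.transpose i0 j0"
  have \<tau>: "\<tau> permutes I" using I by (simp add: \<tau>_def permutes_swap_id)
  define W where "W = (\<lambda>i j. V i (\<tau> j))"
  have W: "W i0 i0 \<noteq> 0" using V by (simp add: W_def \<tau>_def)
  have "I \<noteq> {i0}" using I(4) by auto
  then obtain i1 where i1: "i1 \<in> I" "i0 \<noteq> i1" using I(2) by blast
  define y where "y t = (\<lambda>i. if i = i0 then t else 1)" for t :: complex
  define N where "N t = near_diag i0 i1 (y t) 0 0" for t
  have P: "permanent I (N t) = t" for t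
    using permanent_near_diag[OF I(1,2) i1, of "y t" 0 0] I(1,2)
    by (simp add: N_def y_def)
  have D: "perm_deriv I (N t) W = W i0 i0 + t * (\<Sum>i\<in>I - {i0}. W i i)" for t
  proof -
    have "perm_deriv I (N t) W = (\<Sum>i\<in>I. W i i * (\<Prod>j\<in>I - {i}. y t j))"
      using perm_deriv_near_diag[OF I(1,2) i1, of 0 0 "y t" W] by (simp add: N_def)
    also have "\<dots> = (\<Sum>i\<in>I. W i i * (if i = i0 then 1 else t))"
      using I(1,2) by (intro sum.cong) (auto simp: y_def)
    also have "\<dots> = W i0 i0 + (\<Sum>i\<in>I - {i0}. W i i * t)"
      using I(1,2) by (subst sum.remove[of _ i0]) (auto intro!: sum.cong)
    finally show ?thesis by (simp add: sum_distrib_left mult.commute)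
  qed
  obtain t :: complex where t: "t \<noteq> 0" "W i0 i0 + t * (\<Sum>i\<in>I - {i0}. W i i) \<noteq> 0"
  proof (cases "W i0 i0 + 1 * (\<Sum>i\<in>I - {i0}. W i i) = 0")
    case True
    then have "W i0 i0 + (-1) * (\<Sum>i\<in>I - {i0}. W i i) \<noteq> 0" using W by (auto simp: add_eq_0_iff)
    then show ?thesis using that[of "-1"] by simp
  next
    case False
    then show ?thesis using that[of 1] by simp
  qed
  have "(\<lambda>i j. V i j) = (\<lambda>i j. W i (\<tau> j))" by (simp add: W_def \<tau>_def)
  then have "perm_deriv I (\<lambda>i j. N t i (\<tau> j)) V \<noteq> 0"
    using perm_deriv_columns[OF \<tau>, of "N t" W] D t by simp
  moreover have "permanent I (\<lambda>i j. N t i (\<tau> j)) \<noteq> 0" using permanent_columns[OF \<tau>, of "N t"] P t by simp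
  ultimately show ?thesis by blast
qed

text \<open>The data that refute additivity: two zeros of the permanent with nonzero derivatives
  whose sum is not a zero. Both matrices have 0 at (i0, i0) and one of the two mirrored entries, so
  each permanent vanishes, while their sum has both entries and permanent b c times a power of
  2.\<close>

lemma exists_permanent_zeros_sum_nonzero:
  assumes I: "finite I" "i0 \<in> I" "j0 \<in> I" "2 \<le> card I" and V: "V i0 j0 \<noteq> 0"
  shows "\<exists>M M'. permanent I M = 0 \<and> permanent I M' = 0 \<and> perm_deriv I M V \<noteq> 0 \<and>
    perm_deriv I M' V \<noteq> 0 \<and> permanent I (\<lambda>i j. M i j + M' i j) \<noteq> 0"
proof -
  define \<tau> where "\<tau> = Transposition.transpose i0 j0"
  have \<tau>: "\<tau> permutes I" using I by (simp add: \<tau>_def permutes_swap_id)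
  define W where "W = (\<lambda>i j. V i (\<tau> j))"
  have W: "W i0 i0 \<noteq> 0" using V by (simp add: W_def \<tau>_def)
  have "I \<noteq> {i0}" using I(4) by auto
  then obtain i1 where i1: "i1 \<in> I" "i0 \<noteq> i1" using I(2) by blast
  define y where "y r = (\<lambda>i. if i = i0 then 0 else r)" for r :: complex
  define N where "N = near_diag i0 i1 (y 1)"
  have P: "permanent I (near_diag i0 i1 (y r) b c) = b * c * r ^ card (I - {i0, i1})" for r b c
  proof -
    have "(\<Prod>i\<in>I. y r i) = 0" using I(1,2) by (auto simp: y_def)
    moreover have "(\<Prod>i\<in>I - {i0, i1}. y r i) = (\<Prod>i\<in>I - {i0, i1}. r)"
      by (intro prod.cong) (auto simp: y_def)
    ultimately show ?thesis using permanent_near_diag[OF I(1,2) i1, of "y r" b c] by simp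
  qed
  have D: "perm_deriv I (N b c) W = W i0 i0 + (W i0 i1 * c + W i1 i0 * b)" if "b = 0 \<or> c = 0" for b c
  proof -
    have "(\<Sum>i\<in>I. W i i * (\<Prod>j\<in>I - {i}. y 1 j)) = (\<Sum>i\<in>I. if i = i0 then W i i else 0)"
    proof (intro sum.cong refl)
      fix i assume i: "i \<in> I"
      show "W i i * (\<Prod>j\<in>I - {i}. y 1 j) = (if i = i0 then W i i else 0)"
      proof (cases "i = i0")
        case True
        have "(\<Prod>j\<in>I - {i}. y 1 j) = (\<Prod>j\<in>I - {i}. 1)" by (intro prod.cong) (auto simp: y_def True)
        then show ?thesis using True by simp
      next
        case False
        then have "(\<Prod>j\<in>I - {i}. y 1 j) = 0" using I(1,2) by (auto simp: y_def)
        then show ?thesis using False by simp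
      qed
    qed
    moreover have "(\<Prod>i\<in>I - {i0, i1}. y 1 i) = (\<Prod>i\<in>I - {i0, i1}. 1)"
      by (intro prod.cong) (auto simp: y_def)
    ultimately show ?thesis
      using perm_deriv_near_diag[OF I(1,2) i1 that, of "y 1" W] I(1,2) by (simp add: N_def)
  qed
  \<comment> \<open>The derivative is affine in the off-diagonal entry with nonzero constant term,
    so 1 or -1 is a suitable entry.\<close>
  have pick: "\<exists>c. c \<noteq> 0 \<and> W i0 i0 + w * c \<noteq> 0" for w :: complex
  proof (cases "W i0 i0 + w * 1 = 0")
    case True
    then have "W i0 i0 + w * (-1) \<noteq> 0" using W by (auto simp: add_eq_0_iff)
    then show ?thesis by (intro exI[of _ "-1"]) simp
  next
    case False
    then show ?thesis by (intro exI[of _ 1]) simp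
  qed
  obtain b c where b: "b \<noteq> 0" "W i0 i0 + W i1 i0 * b \<noteq> 0" and c: "c \<noteq> 0" "W i0 i0 + W i0 i1 * c \<noteq> 0"
    using pick by metis
  have VW: "V = (\<lambda>i j. W i (\<tau> j))" by (simp add: W_def \<tau>_def)
  let ?M = "\<lambda>i j. N b 0 i (\<tau> j)" and ?M' = "\<lambda>i j. N 0 c i (\<tau> j)"
  have "(\<lambda>i j. N b 0 i j + N 0 c i j) = near_diag i0 i1 (y 2) b c"
    by (auto simp: N_def near_diag_def fun_eq_iff y_def)
  then have "permanent I (\<lambda>i j. ?M i j + ?M' i j) \<noteq> 0"
    using permanent_columns[OF \<tau>, of "\<lambda>i j. N b 0 i j + N 0 c i j"] P b c by simp
  moreover have "permanent I ?M = 0" "permanent I ?M' = 0"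
    using permanent_columns[OF \<tau>] P[of 1] by (simp_all add: N_def)
  moreover have "perm_deriv I ?M V \<noteq> 0" "perm_deriv I ?M' V \<noteq> 0"
    using perm_deriv_columns[OF \<tau>, of _ W] D[of b 0] D[of 0 c] b c unfolding VW by simp_all
  ultimately show ?thesis by blast
qed

section \<open>The trace of a linear map acting on the permanent by a scalar\<close>

text \<open>Flipping the sign at a single index a, compared with no flip, shows that the
  off-diagonal entries in row a and column a sum to 0. Summing over a turns the total \<kappa> into
  the diagonal sum.\<close>

lemma sum_diagonal_of_signs:
  fixes f :: "'i \<Rightarrow> 'i \<Rightarrow> complex"
  assumes I: "finite I"
    and f: "\<And>y :: 'i \<Rightarrow> complex. (\<And>i. y i = 1 \<or> y i = -1) \<Longrightarrow> (\<Sum>i\<in>I. \<Sum>k\<in>I. f i k * y i * y k) = \<kappa>"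
  shows "(\<Sum>i\<in>I. f i i) = \<kappa>"
proof -
  have all: "(\<Sum>i\<in>I. \<Sum>k\<in>I. f i k) = \<kappa>" using f[of "\<lambda>_. 1"] by simp
  have "(\<Sum>k\<in>I. f a k) + (\<Sum>k\<in>I. f k a) = 2 * f a a" if a: "a \<in> I" for a
  proof -
    define y where "y i = (1 - 2 * of_bool (i = a) :: complex)" for i
    have "\<kappa> = (\<Sum>i\<in>I. \<Sum>k\<in>I. f i k * y i * y k)" by (rule f[symmetric]) (simp add: y_def)
    also have "\<dots> = (\<Sum>i\<in>I. \<Sum>k\<in>I. f i k - 2 * (if i = a then f a k else 0) - 2 * (if k = a then f i a else 0)
        + 4 * (if i = a then if k = a then f a a else 0 else 0))"
      by (intro sum.cong refl) (auto simp: y_def)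
    also have "\<dots> = \<kappa> - 2 * (\<Sum>k\<in>I. f a k) - 2 * (\<Sum>k\<in>I. f k a) + 4 * f a a"
    proof -
      have "(\<Sum>i\<in>I. \<Sum>k\<in>I. if i = a then f a k else 0) = (\<Sum>k\<in>I. f a k)"
        using I a by (subst sum.swap) simp
      moreover have "(\<Sum>i\<in>I. \<Sum>k\<in>I. if i = a then if k = a then f a a else 0 else 0) = f a a"
        using I a by (subst sum.swap) simp
      ultimately show ?thesis
        using I a by (simp add: sum.distrib sum_subtractf all flip: sum_distrib_left)
    qed
    finally have "2 * ((\<Sum>k\<in>I. f a k) + (\<Sum>k\<in>I. f k a)) = 2 * (2 * f a a)"
      by (simp add: algebra_simps)
    then show ?thesis by (simp only: mult_cancel_left) simp
  qed
  then have "(\<Sum>a\<in>I. (\<Sum>k\<in>I. f a k) + (\<Sum>k\<in>I. f k a)) = (\<Sum>a\<in>I. 2 * f a a)" by (rule sum.cong[OF refl])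
  then have "\<kappa> + \<kappa> = 2 * (\<Sum>a\<in>I. f a a)"
    using all sum.swap[of "\<lambda>k a. f k a" I I] by (simp add: sum.distrib sum_distrib_left)
  then show ?thesis by simp
qed

text \<open>The number of permutations with \<sigma>(i) = j does not depend on j, so each entry
  occurs equally often. The factor \<open>card I\<close> avoids a division.\<close>

lemma sum_over_permutations_entries:
  fixes g :: "'i \<Rightarrow> 'i \<Rightarrow> complex"
  assumes I: "finite I"
  shows "of_nat (card I) * (\<Sum>\<sigma> | \<sigma> permutes I. \<Sum>i\<in>I. g i (\<sigma> i)) = fact (card I) * (\<Sum>i\<in>I. \<Sum>j\<in>I. g i j)"
proof -
  have fin: "finite {\<sigma>. \<sigma> permutes I}" by (rule finite_permutations[OF I])
  define N where "N i j = card {\<sigma>. \<sigma> permutes I \<and> \<sigma> i = j}" for i j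
  have N: "N i j = N i i" if "i \<in> I" "j \<in> I" for i j
  proof -
    have t: "Transposition.transpose i j permutes I" using that by (simp add: permutes_swap_id)
    have "bij_betw (\<lambda>\<sigma>. Transposition.transpose i j \<circ> \<sigma>) {\<sigma>. \<sigma> permutes I \<and> \<sigma> i = i} {\<sigma>. \<sigma> permutes I \<and> \<sigma> i = j}"
      by (rule bij_betw_byWitness[where f' = "\<lambda>\<sigma>. Transposition.transpose i j \<circ> \<sigma>"])
        (use that in \<open>auto simp: fun_eq_iff intro!: permutes_compose permutes_swap_id\<close>)
    then show ?thesis unfolding N_def by (rule bij_betw_same_card[symmetric])
  qed
  have split: "(\<Sum>\<sigma> | \<sigma> permutes I. h (\<sigma> i)) = (\<Sum>j\<in>I. of_nat (N i i) * h j)"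
    if i: "i \<in> I" for h :: "'i \<Rightarrow> complex" and i
  proof -
    have "(\<Sum>\<sigma> | \<sigma> permutes I. h (\<sigma> i)) = (\<Sum>j\<in>I. \<Sum>\<sigma> | \<sigma> \<in> {\<sigma>. \<sigma> permutes I} \<and> \<sigma> i = j. h (\<sigma> i))"
      using i by (intro sum.group[symmetric] fin I) (auto simp: permutes_in_image)
    also have "\<dots> = (\<Sum>j\<in>I. of_nat (N i j) * h j)"
      by (intro sum.cong refl) (simp add: N_def)
    finally show ?thesis using N[OF i] by simp
  qed
  have N': "of_nat (card I) * (of_nat (N i i) :: complex) = fact (card I)" if "i \<in> I" for i
    using split[OF that, of "\<lambda>_. 1"] card_permutations[OF refl I] by simp
  have "(\<Sum>\<sigma> | \<sigma> permutes I. \<Sum>i\<in>I. g i (\<sigma> i)) = (\<Sum>i\<in>I. \<Sum>j\<in>I. of_nat (N i i) * g i j)"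
    by (subst sum.swap) (intro sum.cong refl split)
  then have "of_nat (card I) * (\<Sum>\<sigma> | \<sigma> permutes I. \<Sum>i\<in>I. g i (\<sigma> i)) =
      (\<Sum>i\<in>I. \<Sum>j\<in>I. of_nat (card I) * of_nat (N i i) * g i j)"
    by (simp add: sum_distrib_left mult.assoc)
  also have "\<dots> = (\<Sum>i\<in>I. \<Sum>j\<in>I. fact (card I) * g i j)" by (intro sum.cong refl) (simp add: N')
  finally show ?thesis by (simp add: sum_distrib_left)
qed

text \<open>Evaluate the hypothesis at all permutation matrices with signed entries.\<close>

lemma trace_of_permanent_semi_invariant:
  fixes C :: "'i \<Rightarrow> 'i \<Rightarrow> 'i \<Rightarrow> 'i \<Rightarrow> complex"
  assumes I: "finite I"
    and C: "\<And>Y. perm_deriv I Y (\<lambda>i j. \<Sum>k\<in>I. \<Sum>l\<in>I. C i j k l * Y k l) = \<kappa> * permanent I Y"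
  shows "(\<Sum>i\<in>I. \<Sum>j\<in>I. C i j i j) = of_nat (card I) * \<kappa>"
proof -
  have "(\<Sum>i\<in>I. C i (\<sigma> i) i (\<sigma> i)) = \<kappa>" if \<sigma>: "\<sigma> permutes I" for \<sigma>
  proof (rule sum_diagonal_of_signs[OF I, where f = "\<lambda>i k. C i (\<sigma> i) k (\<sigma> k)"])
    fix y :: "'i \<Rightarrow> complex" assume y: "\<And>i. y i = 1 \<or> y i = -1"
    then have y2: "y i * y i = 1" for i by (metis mult_minus1 mult_1 minus_minus)
    define M where "M i j = (if i = j then y i else 0)" for i j
    \<comment> \<open>The signed permutation matrix with entry y_i at (i, \<sigma>(i)).\<close>
    define Y where "Y i j = M i (inv \<sigma> j)" for i j
    define V where "V i j = (\<Sum>k\<in>I. \<Sum>l\<in>I. C i j k l * Y k l)" for i j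
    have inv: "inv \<sigma> permutes I" by (rule permutes_inv[OF \<sigma>])
    have P: "permanent I M = (\<Prod>i\<in>I. y i)" and
      D: "perm_deriv I M W = (\<Sum>i\<in>I. W i i * (\<Prod>j\<in>I - {i}. y j))" for W
    proof -
      \<comment> \<open>A permutation other than the identity moves at least two indices, so one of
        them survives the removal of \<open>a\<close>.\<close>
      have nz: "\<exists>j\<in>I - {a}. M j (\<tau> j) = 0" if "\<tau> permutes I" "\<tau> \<noteq> id" for \<tau> a
      proof (rule ccontr)
        assume *: "\<not> ?thesis"
        then have fixed: "\<tau> j = j" if "j \<in> I - {a}" for j using that by (metis M_def)
        have "\<tau> j = j" if "j \<noteq> a" for j
          using fixed[of j] that permutes_not_in[OF \<open>\<tau> permutes I\<close>, of j] by (cases "j \<in> I") auto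
        moreover from this have "\<tau> a = a"
          using permutes_inj[OF \<open>\<tau> permutes I\<close>] by (metis injD)
        ultimately have "\<tau> = id" by (metis eq_id_iff)
        with that show False by simp
      qed
      have one: "(\<Sum>\<tau> | \<tau> permutes I. h \<tau>) = h id"
        if "\<And>\<tau>. \<tau> permutes I \<Longrightarrow> \<tau> \<noteq> id \<Longrightarrow> h \<tau> = 0" for h :: "('i \<Rightarrow> 'i) \<Rightarrow> complex"
      proof -
        have "(\<Sum>\<tau> | \<tau> permutes I. h \<tau>) = (\<Sum>\<tau>\<in>{id}. h \<tau>)"
          using that by (intro sum.mono_neutral_right finite_permutations I) auto
        then show ?thesis by simp
      qed
      have "permanent I M = (\<Prod>i\<in>I. M i (id i))"
        unfolding permanent_def
      proof (rule one)
        fix \<tau> assume "\<tau> permutes I" "\<tau> \<noteq> id"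
        then show "(\<Prod>i\<in>I. M i (\<tau> i)) = 0" using nz[of \<tau> undefined] I by (intro prod_zero) auto
      qed
      then show "permanent I M = (\<Prod>i\<in>I. y i)" by (simp add: M_def)
      have "perm_deriv I M W = (\<Sum>i\<in>I. W i (id i) * (\<Prod>j\<in>I - {i}. M j (id j)))"
        unfolding perm_deriv_def
      proof (rule one)
        fix \<tau> assume "\<tau> permutes I" "\<tau> \<noteq> id"
        then have "(\<Prod>j\<in>I - {i}. M j (\<tau> j)) = 0" for i using nz[of \<tau> i] I by (intro prod_zero) auto
        then show "(\<Sum>i\<in>I. W i (\<tau> i) * (\<Prod>j\<in>I - {i}. M j (\<tau> j))) = 0" by simp
      qed
      then show "perm_deriv I M W = (\<Sum>i\<in>I. W i i * (\<Prod>j\<in>I - {i}. y j))" by (simp add: M_def)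
    qed
    have "permanent I Y = (\<Prod>i\<in>I. y i)"
      unfolding Y_def using permanent_columns[OF inv, of M] P by simp
    moreover have "perm_deriv I Y V = (\<Sum>i\<in>I. V i (\<sigma> i) * (\<Prod>j\<in>I - {i}. y j))"
    proof -
      have "V = (\<lambda>i j. V i (\<sigma> (inv \<sigma> j)))" using permutes_inverses[OF \<sigma>] by simp
      then show ?thesis
        unfolding Y_def using perm_deriv_columns[OF inv, of M "\<lambda>i j. V i (\<sigma> j)"] D by simp
    qed
    moreover have "perm_deriv I Y V = \<kappa> * permanent I Y" unfolding V_def by (rule C)
    ultimately have "(\<Sum>i\<in>I. V i (\<sigma> i) * (\<Prod>j\<in>I - {i}. y j)) = \<kappa> * (\<Prod>i\<in>I. y i)" by simp
    \<comment> \<open>For signs, omitting a factor is the same as multiplying by it once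
      more.\<close>
    moreover have "(\<Prod>j\<in>I - {i}. y j) = y i * (\<Prod>i\<in>I. y i)" if "i \<in> I" for i
      using prod.remove[OF I that, of y] y2[of i] by (simp flip: mult.assoc)
    ultimately have "(\<Sum>i\<in>I. V i (\<sigma> i) * y i) * (\<Prod>i\<in>I. y i) = \<kappa> * (\<Prod>i\<in>I. y i)"
      by (simp add: sum_distrib_right mult.assoc)
    moreover have "(\<Prod>i\<in>I. y i) \<noteq> 0" using y2 I by (metis mult_zero_left prod_zero_iff zero_neq_one)
    ultimately have "(\<Sum>i\<in>I. V i (\<sigma> i) * y i) = \<kappa>" by simp
    moreover have "V i (\<sigma> i) * y i = (\<Sum>k\<in>I. C i (\<sigma> i) k (\<sigma> k) * y i * y k)" for i
    proof -
      have "(\<Sum>l\<in>I. C i (\<sigma> i) k l * Y k l) = C i (\<sigma> i) k (\<sigma> k) * y k" if k: "k \<in> I" for k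
      proof -
        have "(\<Sum>l\<in>I. C i (\<sigma> i) k l * Y k l) = (\<Sum>l\<in>I. if l = \<sigma> k then C i (\<sigma> i) k (\<sigma> k) * y k else 0)"
        proof (intro sum.cong refl)
          fix l
          have "k = inv \<sigma> l \<longleftrightarrow> l = \<sigma> k" using permutes_inv_eq[OF \<sigma>, of l k] by auto
          then show "C i (\<sigma> i) k l * Y k l = (if l = \<sigma> k then C i (\<sigma> i) k (\<sigma> k) * y k else 0)"
            by (auto simp: Y_def M_def)
        qed
        then show ?thesis using I k permutes_in_image[OF \<sigma>] by simp
      qed
      then show ?thesis by (simp add: V_def sum_distrib_right sum_distrib_left mult_ac)
    qed
    ultimately show "(\<Sum>i\<in>I. \<Sum>k\<in>I. C i (\<sigma> i) k (\<sigma> k) * y i * y k) = \<kappa>" by simp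
  qed
  then have "(\<Sum>\<sigma> | \<sigma> permutes I. \<Sum>i\<in>I. C i (\<sigma> i) i (\<sigma> i)) = fact (card I) * \<kappa>"
    using card_permutations[OF refl I] by simp
  then have "fact (card I) * (of_nat (card I) * \<kappa>) = fact (card I) * (\<Sum>i\<in>I. \<Sum>j\<in>I. C i j i j)"
    using sum_over_permutations_entries[OF I, of "\<lambda>i j. C i j i j"] by (simp add: mult.left_commute)
  then show ?thesis by simp
qed

section \<open>Directional derivatives of forms\<close>

definition dderiv :: "('m::finite E \<Rightarrow> complex) \<Rightarrow> 'm E \<Rightarrow> 'm E \<Rightarrow> complex" where
  "dderiv q X V = deriv (\<lambda>t. q (X + t *s V)) 0"

text \<open>Differentiability along every line and linearity in the direction are obtained together,
  by the sum and product rules for a formal gradient.\<close>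

lemma poly_funs_gradient:
  assumes "q \<in> poly_funs (coords_E :: ('m::finite E \<Rightarrow> complex) set)"
  shows "\<exists>G. \<forall>X V. ((\<lambda>t. q (X + t *s V)) has_field_derivative (\<Sum>a\<in>UNIV. V $ a * G X a)) (at 0)"
  using assms
proof induction
  case (const c)
  show ?case by (intro exI[of _ "\<lambda>_ _. 0"]) simp
next
  case (gen f)
  then obtain a where f: "f = (\<lambda>X. X $ a)" by (auto simp: coords_E_def)
  have "((\<lambda>t. f (X + t *s V)) has_field_derivative (\<Sum>b\<in>UNIV. V $ b * of_bool (b = a))) (at 0)" for X V
    by (auto simp: f of_bool_def if_distrib[of "\<lambda>c. _ * c"] cong: if_cong intro!: derivative_eq_intros)
  then show ?case by (intro exI[of _ "\<lambda>_ b. of_bool (b = a)"]) blast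
next
  case (add f h)
  then obtain G H where
    G: "\<And>X V. ((\<lambda>t. f (X + t *s V)) has_field_derivative (\<Sum>a\<in>UNIV. V $ a * G X a)) (at 0)" and
    H: "\<And>X V. ((\<lambda>t. h (X + t *s V)) has_field_derivative (\<Sum>a\<in>UNIV. V $ a * H X a)) (at 0)"
    by blast
  have "((\<lambda>t. f (X + t *s V) + h (X + t *s V)) has_field_derivative (\<Sum>a\<in>UNIV. V $ a * (G X a + H X a))) (at 0)" for X V
    using DERIV_add[OF G H, of X V X V] by (simp add: distrib_left sum.distrib)
  then show ?case by (intro exI[of _ "\<lambda>X a. G X a + H X a"]) blast
next
  case (mult f h)
  then obtain G H where
    G: "\<And>X V. ((\<lambda>t. f (X + t *s V)) has_field_derivative (\<Sum>a\<in>UNIV. V $ a * G X a)) (at 0)" and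
    H: "\<And>X V. ((\<lambda>t. h (X + t *s V)) has_field_derivative (\<Sum>a\<in>UNIV. V $ a * H X a)) (at 0)"
    by blast
  have "((\<lambda>t. f (X + t *s V) * h (X + t *s V)) has_field_derivative
      (\<Sum>a\<in>UNIV. V $ a * (G X a * h X + H X a * f X))) (at 0)" for X V
    using DERIV_mult[OF G H, of X V X V]
    by (simp add: distrib_left sum.distrib sum_distrib_right mult.assoc)
  then show ?case by (intro exI[of _ "\<lambda>X a. G X a * h X + H X a * f X"]) blast
qed

lemma
  assumes q: "q \<in> forms d"
  shows has_field_derivative_dderiv: "((\<lambda>t. q (X + t *s V)) has_field_derivative dderiv q X V) (at 0)"
    and dderiv_eq_sum: "dderiv q X V = (\<Sum>a\<in>UNIV. V $ a * dderiv q X (axis a 1))"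
proof -
  obtain G where
    G: "\<And>X V. ((\<lambda>t. q (X + t *s V)) has_field_derivative (\<Sum>a\<in>UNIV. V $ a * G X a)) (at 0)"
    using q poly_funs_gradient unfolding forms_def by blast
  have d: "dderiv q X V = (\<Sum>a\<in>UNIV. V $ a * G X a)" for V
    unfolding dderiv_def by (rule DERIV_imp_deriv[OF G])
  then have "dderiv q X (axis a 1) = G X a" for a
    by (simp add: axis_def if_distrib[of "\<lambda>c. c * _"] cong: if_cong)
  then show "dderiv q X V = (\<Sum>a\<in>UNIV. V $ a * dderiv q X (axis a 1))" by (simp add: d)
  show "((\<lambda>t. q (X + t *s V)) has_field_derivative dderiv q X V) (at 0)"
    unfolding d by (rule G)
qed

text \<open>Differentiation at a fixed point and direction is thus one of the coordinates on the
  space of forms, and conditions on derivatives become polynomial in the form.\<close>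

lemma dderiv_coords_forms: "(\<lambda>q. dderiv q X V) \<in> coords_forms d"
proof -
  have "dderiv (\<lambda>X. a * q X + b * r X) X V = a * dderiv q X V + b * dderiv r X V"
    if "q \<in> forms d" "r \<in> forms d" for q r a b
    unfolding dderiv_def[of "\<lambda>X. a * q X + b * r X"]
    by (rule DERIV_imp_deriv)
      (auto intro!: derivative_eq_intros has_field_derivative_dderiv that)
  then show ?thesis by (simp add: coords_forms_def)
qed

lemma dderiv_act: "dderiv (act g q) X V = dderiv q (matrix_inv g *v X) (matrix_inv g *v V)"
  by (simp add: dderiv_def act_def matrix_vector_right_distrib vector_scalar_commute)

text \<open>If \<open>q = l\<^sup>k h\<close> with \<open>l\<close> linear and \<open>h\<close> constant in direction \<open>v\<close>, then \<open>q / dderiv q v\<close> is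
  a multiple of \<open>l\<close>, hence additive.  This is the condition below with denominators cleared, so
  that it is polynomial in \<open>q\<close>.\<close>

definition additive_ratio :: "('m::finite E \<Rightarrow> complex) \<Rightarrow> 'm E \<Rightarrow> bool" where
  "additive_ratio q v \<longleftrightarrow> (\<forall>X X'. q (X + X') * dderiv q X v * dderiv q X' v =
     dderiv q (X + X') v * (q X * dderiv q X' v + q X' * dderiv q X v))"

lemma additive_ratio_act:
  assumes g: "invertible g"
  shows "additive_ratio (act g q) v \<longleftrightarrow> additive_ratio q (matrix_inv g *v v)"
proof
  assume A: "additive_ratio (act g q) v"
  show "additive_ratio q (matrix_inv g *v v)"
    unfolding additive_ratio_def
  proof (intro allI)
    fix Z Z'
    have inv: "matrix_inv g *v (g *v Z) = Z" for Z
      by (simp add: matrix_vector_mul_assoc matrix_mul_matrix_inv[OF g])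
    have "matrix_inv g *v (g *v Z + g *v Z') = Z + Z'"
      by (simp add: matrix_vector_right_distrib inv)
    then show "q (Z + Z') * dderiv q Z (matrix_inv g *v v) * dderiv q Z' (matrix_inv g *v v) =
       dderiv q (Z + Z') (matrix_inv g *v v) * (q Z * dderiv q Z' (matrix_inv g *v v) + q Z' * dderiv q Z (matrix_inv g *v v))"
      using A[unfolded additive_ratio_def, rule_format, of "g *v Z" "g *v Z'"]
      by (simp add: dderiv_act act_apply inv)
  qed
next
  assume "additive_ratio q (matrix_inv g *v v)"
  then show "additive_ratio (act g q) v"
    by (simp add: additive_ratio_def dderiv_act act_apply matrix_vector_right_distrib)
qed

text \<open>For fixed X and X' both sides are cubic polynomials in linear functionals of the form,
  so the identity passes to the closure.\<close>

lemma additive_ratio_closure: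
  assumes "\<And>q. q \<in> A \<Longrightarrow> additive_ratio q v" and f: "f \<in> zariski (coords_forms d) V closure_of A"
  shows "additive_ratio f v"
  unfolding additive_ratio_def
proof (intro allI)
  fix X X'
  let ?\<Phi> = "\<lambda>q. q (X + X') * dderiv q X v * dderiv q X' v +
     - 1 * (dderiv q (X + X') v * (q X * dderiv q X' v + q X' * dderiv q X v))"
  have "?\<Phi> \<in> poly_funs (coords_forms d)"
    by (intro poly_funs.add poly_funs.mult poly_funs.const)
      (rule poly_funs.gen, rule dderiv_coords_forms eval_coords_forms)+
  then have "?\<Phi> f = 0"
    by (rule closure_of_zariski_vanishing[OF _ _ f]) (use assms(1) in \<open>simp add: additive_ratio_def\<close>)
  then show "f (X + X') * dderiv f X v * dderiv f X' v =
     dderiv f (X + X') v * (f X * dderiv f X' v + f X' * dderiv f X v)" by simp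
qed

section \<open>The groups and the padded permanent in coordinates\<close>

lemma span_axis: "vec.span ((\<lambda>a. axis a 1) ` A) = {X :: complex ^ 'k. \<forall>a. a \<notin> A \<longrightarrow> X $ a = 0}"
proof
  have "vec.subspace {X :: complex ^ 'k. \<forall>a. a \<notin> A \<longrightarrow> X $ a = 0}" by (simp add: vec.subspace_def)
  then show "vec.span ((\<lambda>a. axis a 1) ` A) \<subseteq> {X :: complex ^ 'k. \<forall>a. a \<notin> A \<longrightarrow> X $ a = 0}"
    by (intro vec.span_minimal) (auto simp: axis_def)
  show "{X :: complex ^ 'k. \<forall>a. a \<notin> A \<longrightarrow> X $ a = 0} \<subseteq> vec.span ((\<lambda>a. axis a 1) ` A)"
  proof
    fix X :: "complex ^ 'k" assume X: "X \<in> {X. \<forall>a. a \<notin> A \<longrightarrow> X $ a = 0}"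
    have "X = (\<Sum>a\<in>UNIV. X $ a *s axis a 1)" by (rule basis_expansion[symmetric])
    also have "\<dots> = (\<Sum>a\<in>A. X $ a *s axis a 1)"
      using X by (intro sum.mono_neutral_right) auto
    also have "\<dots> \<in> vec.span ((\<lambda>a. axis a 1) ` A)"
      by (intro vec.span_sum vec.span_scale vec.span_base) auto
    finally show "X \<in> vec.span ((\<lambda>a. axis a 1) ` A)" .
  qed
qed

locale padded_permanent =
  fixes e :: "nat \<Rightarrow> 'm::finite" and m n :: nat
  assumes e: "bij_betw e {1..m} (UNIV :: 'm set)" and n2: "2 \<le> n" and nm: "n < m"
begin

declare split_paired_All [simp del] split_paired_Ex [simp del]

abbreviation "p \<equiv> padded_perm e m n"
abbreviation "L \<equiv> LP2 e m n"
abbreviation "R \<equiv> R_LP2 e m n"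
abbreviation "I \<equiv> {m - n + 1..m}"
abbreviation "k \<equiv> m - n"

definition o1 :: "'m \<times> 'm" where "o1 = (e 1, e 1)"

definition e11 :: "'m E" where "e11 = axis o1 1"

definition Sx :: "('m \<times> 'm) set" where
  "Sx = insert o1 ((\<lambda>(i, j). (e i, e j)) ` (I \<times> I))"

lemma e_eq_iff: "i \<in> {1..m} \<Longrightarrow> j \<in> {1..m} \<Longrightarrow> e i = e j \<longleftrightarrow> i = j"
  using e by (meson bij_betw_def inj_on_eq_iff)

lemma card_I: "card I = n"
  using nm by auto

lemma e_I: "i \<in> I \<Longrightarrow> j \<in> I \<Longrightarrow> (e i, e j) \<in> Sx"
  by (auto simp: Sx_def)

lemma Sx_cases:
  assumes "a \<in> Sx" "a \<noteq> o1" obtains i j where "i \<in> I" "j \<in> I" "a = (e i, e j)"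
proof -
  have "a \<in> (\<lambda>(i, j). (e i, e j)) ` (I \<times> I)" using assms by (simp add: Sx_def)
  then show ?thesis using that by (elim imageE) auto
qed

lemma o1_Sx: "o1 \<in> Sx"
  by (simp add: Sx_def)

lemma e_ne_o1: "i \<in> I \<Longrightarrow> (e i, e j) \<noteq> o1"
  using e_eq_iff[of i 1] nm by (auto simp: o1_def)

lemma unit_E_S: "unit_E e ` S_index m n = (\<lambda>a. axis a 1) ` Sx"
  by (auto simp: unit_E_def S_index_def Sx_def o1_def image_iff)

lemma S_space_eq: "S_space e m n = {X. \<forall>a. a \<notin> Sx \<longrightarrow> X $ a = 0}"
  unfolding S_space_def unit_E_S by (rule span_axis)

lemma S_perp_eq: "S_perp e m n = {X. \<forall>a\<in>Sx. X $ a = 0}"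
proof -
  let ?h = "\<lambda>(i, j). (e i, e j)"
  have bij: "bij_betw ?h ({1..m} \<times> {1..m}) (UNIV :: ('m \<times> 'm) set)"
    using bij_betw_map_prod[OF e e] by (simp add: map_prod_def)
  have sub: "S_index m n \<subseteq> {1..m} \<times> {1..m}" using nm n2 by (auto simp: S_index_def)
  have "?h ` ({1..m} \<times> {1..m} - S_index m n) = UNIV - ?h ` S_index m n"
    using bij sub unfolding bij_betw_def by (metis inj_on_image_set_diff[of ?h "{1..m} \<times> {1..m}"] Diff_subset)
  also have "?h ` S_index m n = Sx" by (auto simp: S_index_def Sx_def o1_def)
  finally have im: "?h ` ({1..m} \<times> {1..m} - S_index m n) = UNIV - Sx" .
  have "unit_E e = (\<lambda>a. axis a 1) \<circ> ?h" by (auto simp: unit_E_def)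
  then have "unit_E e ` ({1..m} \<times> {1..m} - S_index m n) = (\<lambda>a. axis a 1) ` (UNIV - Sx)"
    by (simp only: image_comp[symmetric] im)
  then show ?thesis unfolding S_perp_def by (auto simp: span_axis)
qed

text \<open>Block form: fixing the complement of S pointwise prescribes the columns outside
  \<open>Sx\<close>, and preserving S then prescribes the remaining entries of the rows outside
  \<open>Sx\<close>.\<close>

lemma L_iff: "g \<in> L \<longleftrightarrow> invertible g \<and> (\<forall>a b. a \<notin> Sx \<or> b \<notin> Sx \<longrightarrow> g $ a $ b = of_bool (a = b))"
proof
  assume g: "g \<in> L"
  have "g $ a $ b = of_bool (a = b)" if "a \<notin> Sx \<or> b \<notin> Sx" for a b
  proof (cases "b \<in> Sx")
    case False
    then have "axis b 1 \<in> S_perp e m n" by (auto simp: S_perp_eq axis_def)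
    then have "column b g = axis b 1" using g by (simp add: LP2_def flip: matrix_vector_mult_axis)
    then have "column b g $ a = axis b 1 $ a" by simp
    then show ?thesis by (simp add: column_def axis_def)
  next
    case True
    then have "axis b 1 \<in> S_space e m n" by (auto simp: S_space_eq axis_def)
    then have "g *v axis b 1 \<in> S_space e m n" using g by (auto simp: LP2_def)
    then show ?thesis using that True
      by (auto simp: S_space_eq matrix_vector_mult_axis column_def)
  qed
  then show "invertible g \<and> (\<forall>a b. a \<notin> Sx \<or> b \<notin> Sx \<longrightarrow> g $ a $ b = of_bool (a = b))"
    using g by (simp add: LP2_def)
next
  assume *: "invertible g \<and> (\<forall>a b. a \<notin> Sx \<or> b \<notin> Sx \<longrightarrow> g $ a $ b = of_bool (a = b))"
  then have inv: "invertible g" and g: "\<And>a b. a \<notin> Sx \<or> b \<notin> Sx \<Longrightarrow> g $ a $ b = of_bool (a = b)"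
    by blast+
  have row: "(g *v X) $ a = X $ a" if "a \<notin> Sx" for X a
    using g that by (simp add: matrix_vector_mult_def of_bool_def if_distrib[of "\<lambda>c. c * _"] cong: if_cong)
  have "S_space e m n \<subseteq> (\<lambda>X. g *v X) ` S_space e m n"
  proof
    fix X assume X: "X \<in> S_space e m n"
    have eq: "g *v (matrix_inv g *v X) = X"
      using inv by (simp add: matrix_vector_mul_assoc matrix_mul_matrix_inv)
    have "matrix_inv g *v X \<in> S_space e m n"
      using X row[of _ "matrix_inv g *v X"] unfolding eq S_space_eq by auto
    then show "X \<in> (\<lambda>X. g *v X) ` S_space e m n" using eq by (metis imageI)
  qed
  moreover have "(\<lambda>X. g *v X) ` S_space e m n \<subseteq> S_space e m n" using row by (auto simp: S_space_eq)
  moreover have "g *v X = X" if "X \<in> S_perp e m n" for X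
  proof -
    have "(g *v X) $ a = X $ a" for a
    proof -
      have "(g *v X) $ a = (\<Sum>b\<in>UNIV. of_bool (a = b) * X $ b)"
        unfolding matrix_vector_mult_def vec_lambda_beta
      proof (rule sum.cong[OF refl])
        fix b show "g $ a $ b * X $ b = of_bool (a = b) * X $ b"
          using g[of a b] that by (cases "b \<in> Sx") (auto simp: S_perp_eq)
      qed
      then show ?thesis by (simp add: of_bool_def if_distrib[of "\<lambda>c. c * _"] cong: if_cong)
    qed
    then show ?thesis by (simp add: vec_eq_iff)
  qed
  ultimately show "g \<in> L" using inv by (simp add: LP2_def set_eq_subset)
qed

lemma L_invertible: "g \<in> L \<Longrightarrow> invertible g"
  by (simp add: L_iff)

lemma L_entry: "g \<in> L \<Longrightarrow> a \<notin> Sx \<or> b \<notin> Sx \<Longrightarrow> g $ a $ b = of_bool (a = b)"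
  unfolding L_iff by blast

lemma L_row: "g \<in> L \<Longrightarrow> a \<notin> Sx \<Longrightarrow> (g *v X) $ a = X $ a"
  by (simp add: L_entry matrix_vector_mult_def of_bool_def if_distrib[of "\<lambda>c. c * _"] cong: if_cong)

lemma L_inv: assumes g: "g \<in> L" shows "matrix_inv g \<in> L"
proof -
  have inv: "invertible g" using g by (rule L_invertible)
  have "matrix_inv g $ a $ b = of_bool (a = b)" if "a \<notin> Sx \<or> b \<notin> Sx" for a b
  proof (cases "a \<in> Sx")
    case False
    have "(g ** matrix_inv g) $ a $ b = matrix_inv g $ a $ b"
      using g False by (simp add: L_entry matrix_matrix_mult_def of_bool_def if_distrib[of "\<lambda>c. c * _"] cong: if_cong)
    then show ?thesis unfolding matrix_mul_matrix_inv[OF inv] by (auto simp: mat_def)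
  next
    case True
    have "(matrix_inv g ** g) $ a $ b = matrix_inv g $ a $ b"
      using g that True by (simp add: L_entry matrix_matrix_mult_def of_bool_def if_distrib[of "\<lambda>c. _ * c"] cong: if_cong)
    then show ?thesis unfolding matrix_mul_matrix_inv[OF inv] by (auto simp: mat_def)
  qed
  then show ?thesis using inv unfolding L_iff by (simp add: matrix_inv_matrix_inv)
qed

lemma L_mult: assumes g: "g \<in> L" and h: "h \<in> L" shows "g ** h \<in> L"
proof -
  have "(g ** h) $ a $ b = of_bool (a = b)" if "a \<notin> Sx \<or> b \<notin> Sx" for a b
  proof (cases "a \<in> Sx")
    case False
    then have "(g ** h) $ a $ b = h $ a $ b"
      using g by (simp add: L_entry matrix_matrix_mult_def of_bool_def if_distrib[of "\<lambda>c. c * _"] cong: if_cong)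
    then show ?thesis using h that by (simp add: L_entry)
  next
    case True
    then have "(g ** h) $ a $ b = g $ a $ b"
      using h that by (simp add: L_entry matrix_matrix_mult_def of_bool_def if_distrib[of "\<lambda>c. _ * c"] cong: if_cong)
    then show ?thesis using g that by (simp add: L_entry)
  qed
  then show ?thesis using g h unfolding L_iff by (simp add: invertible_mult)
qed

lemma invertible_mat_1: "invertible (mat 1 :: complex ^ 'a ^ 'a)"
  unfolding invertible_def by (intro exI[of _ "mat 1"]) simp

lemma mat_1_L: "mat 1 \<in> L"
  unfolding L_iff by (simp add: invertible_mat_1) (simp add: mat_def)

text \<open>An eigenvector equation suffices for stabilising the line: the eigenvalue of an
  invertible matrix is nonzero, so the line is mapped onto itself.\<close>

lemma R_iff: "g \<in> R \<longleftrightarrow> g \<in> L \<and> (\<exists>c. g *v e11 = c *s e11)"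
proof -
  have u: "unit_E e (1, 1) = e11" by (simp add: unit_E_def e11_def o1_def)
  have sp: "vec.span {e11} = range (\<lambda>c. c *s e11)" by (simp add: vec.span_singleton)
  have "(\<lambda>X. g *v X) ` vec.span {e11} = vec.span {e11} \<longleftrightarrow> (\<exists>c. g *v e11 = c *s e11)" if g: "g \<in> L"
  proof
    assume *: "(\<lambda>X. g *v X) ` vec.span {e11} = vec.span {e11}"
    have "e11 \<in> vec.span {e11}" by (simp add: vec.span_base)
    then have "g *v e11 \<in> vec.span {e11}" using * by blast
    then show "\<exists>c. g *v e11 = c *s e11" unfolding sp by blast
  next
    assume "\<exists>c. g *v e11 = c *s e11"
    then obtain c where c: "g *v e11 = c *s e11" by blast
    have "matrix_inv g *v (g *v e11) = e11"
      using L_invertible[OF g] by (simp add: matrix_vector_mul_assoc matrix_mul_matrix_inv)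
    then have "c \<noteq> 0" unfolding c by (auto simp: e11_def axis_eq_0_iff)
    have gd: "g *v (d *s e11) = (d * c) *s e11" for d
      unfolding vector_scalar_commute c by simp
    have "d *s e11 \<in> (\<lambda>X. g *v X) ` range (\<lambda>c. c *s e11)" for d
      using gd[of "d / c"] \<open>c \<noteq> 0\<close> by (metis nonzero_eq_divide_eq image_eqI rangeI)
    then show "(\<lambda>X. g *v X) ` vec.span {e11} = vec.span {e11}"
      unfolding sp using gd by auto
  qed
  then show ?thesis unfolding R_LP2_def u by blast
qed

lemma R_subset_L: "R \<subseteq> L"
  by (auto simp: R_iff)

lemma matrix_group_R: "matrix_group R"
  unfolding matrix_group_def
proof (intro conjI ballI)
  show "mat 1 \<in> R" unfolding R_iff using mat_1_L by (auto intro: exI[of _ 1])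
next
  fix g h assume g: "g \<in> R" and h: "h \<in> R"
  then obtain c d where c: "g *v e11 = c *s e11" and d: "h *v e11 = d *s e11" by (auto simp: R_iff)
  have "(g ** h) *v e11 = (d * c) *s e11"
    unfolding matrix_vector_mul_assoc[symmetric] d vector_scalar_commute c by simp
  then show "g ** h \<in> R" using g h L_mult unfolding R_iff by blast
next
  fix g assume g: "g \<in> R"
  then show inv: "invertible g" using L_invertible R_subset_L by blast
  obtain c where c: "g *v e11 = c *s e11" using g by (auto simp: R_iff)
  have "matrix_inv g *v (g *v e11) = e11"
    using inv by (simp add: matrix_vector_mul_assoc matrix_mul_matrix_inv)
  then have e: "c *s (matrix_inv g *v e11) = e11" unfolding c vector_scalar_commute .
  then have "c \<noteq> 0" by (auto simp: e11_def axis_eq_0_iff)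
  have "(1 / c) *s (c *s (matrix_inv g *v e11)) = (1 / c) *s e11" unfolding e ..
  then have "matrix_inv g *v e11 = (1 / c) *s e11" using \<open>c \<noteq> 0\<close> by simp
  then show "matrix_inv g \<in> R" using g L_inv unfolding R_iff by blast
qed

lemma p_eq: "p X = (X $ o1) ^ k * permanent I (\<lambda>i j. X $ (e i, e j))"
  by (simp add: padded_perm_def o1_def)

lemma p_forms: "p \<in> forms m"
proof -
  have "p (c *s X) = c ^ m * p X" for c X
  proof -
    have "p (c *s X) = c ^ k * c ^ n * p X"
      using permanent_scale[of I c "\<lambda>i j. X $ (e i, e j)"] card_I by (simp add: p_eq power_mult_distrib)
    then show ?thesis using nm by (simp flip: power_add)
  qed
  moreover have "p \<in> poly_funs coords_E"
    unfolding padded_perm_def[abs_def] permanent_def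
    by (intro poly_funs.mult poly_funs_power poly_funs_sum poly_funs_prod poly_funs_coord finite_permutations) auto
  ultimately show ?thesis by (simp add: forms_def)
qed

lemma dderiv_p: "dderiv p X V = of_nat k * (X $ o1) ^ (k - 1) * V $ o1 * permanent I (\<lambda>i j. X $ (e i, e j)) +
    (X $ o1) ^ k * perm_deriv I (\<lambda>i j. X $ (e i, e j)) (\<lambda>i j. V $ (e i, e j))"
  unfolding dderiv_def p_eq
  by (rule DERIV_imp_deriv)
    (auto intro!: derivative_eq_intros permanent_has_field_derivative simp: algebra_simps)

section \<open>The additivity condition for the padded permanent\<close>

text \<open>The point with padding entry x and block M. Positions outside \<open>Sx\<close> also
  receive values of M, which \<open>p\<close> never reads.\<close>

definition emb :: "complex \<Rightarrow> (nat \<Rightarrow> nat \<Rightarrow> complex) \<Rightarrow> 'm E" where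
  "emb x M = (\<chi> ab. if ab = o1 then x else M (inv_into {1..m} e (fst ab)) (inv_into {1..m} e (snd ab)))"

lemma emb_o1 [simp]: "emb x M $ o1 = x"
  by (simp add: emb_def)

lemma emb_I [simp]: "i \<in> I \<Longrightarrow> j \<in> I \<Longrightarrow> emb x M $ (e i, e j) = M i j"
  using e_ne_o1[of i j] e by (auto simp: emb_def bij_betw_def)

lemma emb_add: "emb x M + emb y N = emb (x + y) (\<lambda>i j. M i j + N i j)"
  by (simp add: emb_def vec_eq_iff)

lemma p_emb: "p (emb x M) = x ^ k * permanent I M"
  using permanent_cong[of I "\<lambda>i j. emb x M $ (e i, e j)" M] by (simp add: p_eq)

lemma dderiv_p_emb: "dderiv p (emb x M) V = of_nat k * x ^ (k - 1) * V $ o1 * permanent I M +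
    x ^ k * perm_deriv I M (\<lambda>i j. V $ (e i, e j))"
  using permanent_cong[of I "\<lambda>i j. emb x M $ (e i, e j)" M]
    perm_deriv_cong[of I "\<lambda>i j. emb x M $ (e i, e j)" M "\<lambda>i j. V $ (e i, e j)"] by (simp add: dderiv_p)

text \<open>In this direction only the padding factor varies, so for c nonzero the quotient of
  \<open>p\<close> by its derivative is X_11 / (k c). With denominators cleared the case c = 0 is
  covered too.\<close>

lemma additive_ratio_p_e11: "additive_ratio p (c *s e11)"
proof -
  obtain k' where k: "k = Suc k'" using nm by (cases k) auto
  have "perm_deriv I M (\<lambda>i j. (c *s e11) $ (e i, e j)) = perm_deriv I M (\<lambda>i j. 0 * 0)" for M
    by (rule perm_deriv_cong) (auto simp: e11_def axis_def e_ne_o1)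
  then have 0: "perm_deriv I M (\<lambda>i j. (c *s e11) $ (e i, e j)) = 0" for M
    using perm_deriv_scale[of I M 0 "\<lambda>_ _. 0"] by simp
  have d: "dderiv p X (c *s e11) = of_nat k * (X $ o1) ^ k' * c * permanent I (\<lambda>i j. X $ (e i, e j))" for X
    unfolding dderiv_p 0 by (simp add: k e11_def)
  show ?thesis
    unfolding additive_ratio_def d unfolding p_eq k by (simp add: algebra_simps)
qed

text \<open>Suppose v has a nonzero entry in the block. If v has no component along
  \<open>e11\<close>, two zeros of the permanent with nonzero sum value make the right side 0 and
  the left side not. Otherwise one block M with padding entries 1 and 2 already violates the
  identity.\<close>

lemma additive_ratio_p:
  assumes v: "additive_ratio p v" and S: "\<And>a. a \<notin> Sx \<Longrightarrow> v $ a = 0" and ne: "v \<noteq> 0"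
  shows "\<exists>c. v = c *s e11"
proof -
  define V where "V i j = v $ (e i, e j)" for i j
  have I: "finite I" "2 \<le> card I" using n2 card_I by auto
  have A: "p (X + X') * dderiv p X v * dderiv p X' v = dderiv p (X + X') v * (p X * dderiv p X' v + p X' * dderiv p X v)" for X X'
    using v by (simp add: additive_ratio_def)
  have D: "dderiv p (emb x M) v = of_nat k * x ^ (k - 1) * v $ o1 * permanent I M + x ^ k * perm_deriv I M V" for x M
    unfolding dderiv_p_emb V_def ..
  have "v $ a = 0" if a: "a \<noteq> o1" for a
  proof (rule ccontr)
    assume nz: "v $ a \<noteq> 0"
    then have "a \<in> Sx" using S by blast
    then obtain i0 j0 where ij: "i0 \<in> I" "j0 \<in> I" "a = (e i0, e j0)" using a by (rule Sx_cases)
    then have V: "V i0 j0 \<noteq> 0" using nz by (simp add: V_def)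
    show False
    proof (cases "v $ o1 = 0")
      case True
      obtain M M' where M: "permanent I M = 0" "permanent I M' = 0" "perm_deriv I M V \<noteq> 0"
        "perm_deriv I M' V \<noteq> 0" "permanent I (\<lambda>i j. M i j + M' i j) \<noteq> 0"
        using exists_permanent_zeros_sum_nonzero[OF I(1) ij(1,2) I(2), of V, OF V] by blast
      show False using A[of "emb 1 M" "emb 1 M'"] M unfolding emb_add p_emb D True by simp
    next
      case False
      obtain M where M: "permanent I M \<noteq> 0" "perm_deriv I M V \<noteq> 0"
        using exists_permanent_perm_deriv_nonzero[OF I(1) ij(1,2) I(2), of V, OF V] by blast
      define P u \<kappa> where "P = permanent I M" and "u = perm_deriv I M V" and "\<kappa> = of_nat k * v $ o1"
      have \<kappa>: "\<kappa> \<noteq> 0" using False nm by (simp add: \<kappa>_def)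
      obtain k' where k: "k = Suc k'" using nm by (cases k) auto
      obtain n' where n': "n = Suc n'" using n2 by (cases n) auto
      \<comment> \<open>The same block with different padding entries keeps the two points off a
        common line, where homogeneity would make the condition hold.\<close>
      have e3: "emb 1 M + emb 2 M = emb 3 (\<lambda>i j. 2 * M i j)" by (simp add: emb_add)
      have P2: "permanent I (\<lambda>i j. 2 * M i j) = 2 * 2 ^ n' * P"
        using permanent_scale[of I 2 M] card_I by (simp add: P_def n')
      have u2: "perm_deriv I (\<lambda>i j. 2 * M i j) V = 2 ^ n' * u"
        using perm_deriv_matrix_scale[OF I(1), of 2 M V] card_I by (simp add: u_def n')
      have "p (emb 1 M) = P" "p (emb 2 M) = 2 * 2 ^ k' * P"
        "p (emb 3 (\<lambda>i j. 2 * M i j)) = 3 * 3 ^ k' * (2 * 2 ^ n' * P)"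
        unfolding p_emb P2 by (simp_all add: P_def k)
      moreover have "dderiv p (emb 1 M) v = \<kappa> * P + u" "dderiv p (emb 2 M) v = 2 ^ k' * (\<kappa> * P + 2 * u)"
        "dderiv p (emb 3 (\<lambda>i j. 2 * M i j)) v = 3 ^ k' * 2 ^ n' * (2 * \<kappa> * P + 3 * u)"
        unfolding D P2 u2 by (simp_all add: P_def u_def k \<kappa>_def algebra_simps)
      ultimately have "3 * 3 ^ k' * (2 * 2 ^ n' * P) * (\<kappa> * P + u) * (2 ^ k' * (\<kappa> * P + 2 * u)) =
          3 ^ k' * 2 ^ n' * (2 * \<kappa> * P + 3 * u) * (P * (2 ^ k' * (\<kappa> * P + 2 * u)) + 2 * 2 ^ k' * P * (\<kappa> * P + u))"
        using A[of "emb 1 M" "emb 2 M"] unfolding e3 by simp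
      \<comment> \<open>With a = \<kappa> P and b = u, the two sides are a common factor times 6 a^2
        + 18 a b + 12 b^2 and 6 a^2 + 17 a b + 12 b^2. Their difference is the single mixed term a
        b.\<close>
      then have "(3 ^ k' * 2 ^ n' * 2 ^ k' * P) * (\<kappa> * P * u) = 0" by (simp add: algebra_simps)
      then show False using M \<kappa> by (simp add: P_def u_def)
    qed
  qed
  then have "v = (v $ o1) *s e11" by (auto simp: vec_eq_iff e11_def axis_def)
  then show ?thesis by blast
qed

section \<open>Orbits of the padded permanent and the preimage statement\<close>

lemma orbit_forms: "orbit H p \<subseteq> forms m"
  using act_forms[OF p_forms] by (auto simp: orbit_def)

lemma additive_ratio_orbit_R:
  assumes "f \<in> orbit R p" shows "additive_ratio f e11"
proof -
  obtain g where g: "g \<in> R" "f = act g p" using assms by (auto simp: orbit_def)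
  then have "matrix_inv g \<in> R" "invertible g" using matrix_group_R by (auto simp: matrix_group_def)
  then obtain c where "matrix_inv g *v e11 = c *s e11" by (auto simp: R_iff)
  then show ?thesis using additive_ratio_p_e11[of c] \<open>invertible g\<close> by (simp add: g additive_ratio_act)
qed

lemma orbit_closure_R_inter_orbit:
  assumes h: "h \<in> L" and cl: "act h p \<in> orbit_closure m R p"
  shows "h \<in> R"
proof -
  have inv: "invertible h" using h by (rule L_invertible)
  have "additive_ratio (act h p) e11"
    by (rule additive_ratio_closure[OF additive_ratio_orbit_R cl[unfolded orbit_closure_def]])
  then have A: "additive_ratio p (matrix_inv h *v e11)" using inv by (simp add: additive_ratio_act)
  have "(matrix_inv h *v e11) $ a = 0" if "a \<notin> Sx" for a
    using L_row[OF L_inv[OF h] that] that o1_Sx by (auto simp: e11_def axis_def)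
  moreover have eq: "h *v (matrix_inv h *v e11) = e11"
    using inv by (simp add: matrix_vector_mul_assoc matrix_mul_matrix_inv)
  then have "matrix_inv h *v e11 \<noteq> 0" by (auto simp: e11_def axis_eq_0_iff)
  ultimately obtain c where "matrix_inv h *v e11 = c *s e11" using additive_ratio_p[OF A] by blast
  then have "matrix_inv h \<in> R" using L_inv[OF h] by (auto simp: R_iff)
  then have "matrix_inv (matrix_inv h) \<in> R" using matrix_group_R by (simp add: matrix_group_def)
  then show "h \<in> R" by (simp add: matrix_inv_matrix_inv[OF inv])
qed

lemma orbit_subset_closure: "orbit H p \<subseteq> orbit_closure m H p"
  unfolding orbit_closure_def using orbit_forms by (intro closure_of_subset) simp

lemma stabilizer_subset_R: "h \<in> L \<Longrightarrow> act h p = p \<Longrightarrow> h \<in> R"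
proof (rule orbit_closure_R_inter_orbit)
  assume "h \<in> L" "act h p = p"
  moreover have "p \<in> orbit R p" using matrix_group_R unfolding orbit_def matrix_group_def
    by (metis act_mat_1 image_eqI)
  ultimately show "act h p \<in> orbit_closure m R p" using orbit_subset_closure by auto
qed

text \<open>Acting by g pulls linear functionals back to linear functionals, so it is Zariski
  continuous and maps the closure into the closure of the translated orbit.\<close>

lemma act_orbit_closure:
  assumes g: "g \<in> L" and f: "f \<in> orbit_closure m R p"
  shows "act g f \<in> orbit_closure m L p"
proof -
  let ?T = "zariski (coords_forms m) (forms m :: ('m E \<Rightarrow> complex) set)"
  have U: "openin ?T (forms m)" using openin_topspace[of ?T] by simp
  have "continuous_map ?T ?T (act g)"
    unfolding continuous_map_def
  proof (intro conjI allI impI)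
    show "act g \<in> topspace ?T \<rightarrow> topspace ?T" using act_forms by auto
    fix W assume W: "openin ?T W"
    have "openin ?T {x \<in> forms m. act g x \<in> W}"
      by (rule openin_vimage_zariski[where C' = "coords_forms m" and V' = "forms m", OF U _ act_forms W])
        (auto intro: reg_poly_funs[OF U] poly_funs.gen act_coords_forms)
    then show "openin ?T {x \<in> topspace ?T. act g x \<in> W}" by simp
  qed
  then have "act g ` (?T closure_of orbit L p) \<subseteq> ?T closure_of (act g ` orbit L p)"
    by (rule continuous_map_image_closure_subset)
  moreover have "act g ` orbit L p \<subseteq> orbit L p"
  proof
    fix y assume "y \<in> act g ` orbit L p"
    then obtain h where h: "h \<in> L" "y = act g (act h p)" by (auto simp: orbit_def)
    then have "y = act (g ** h) p" using g by (simp add: act_matrix_mul L_invertible)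
    then show "y \<in> orbit L p" using L_mult[OF g h(1)] by (auto simp: orbit_def)
  qed
  moreover have "f \<in> ?T closure_of orbit L p"
    using f closure_of_mono[of "orbit R p" "orbit L p" ?T] R_subset_L
    unfolding orbit_closure_def orbit_def by blast
  ultimately show ?thesis
    unfolding orbit_closure_def using closure_of_mono[of "act g ` orbit L p" "orbit L p" ?T] by blast
qed

lemma orbit_closure_forms: "orbit_closure m H p \<subseteq> forms m"
  unfolding orbit_closure_def using closure_of_subset_topspace[of "zariski (coords_forms m) (forms m)" "orbit H p"] by simp

lemma preimage_orbit:
  "{c \<in> bundle_points L R (orbit_closure m R p). beta c \<in> orbit L p} = bundle_points L R (orbit R p)"
proof
  show "bundle_points L R (orbit R p) \<subseteq> {c \<in> bundle_points L R (orbit_closure m R p). beta c \<in> orbit L p}"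
  proof
    fix c assume "c \<in> bundle_points L R (orbit R p)"
    then obtain g r where g: "g \<in> L" "r \<in> R" "c = bundle_class R (g, act r p)"
      by (auto simp: bundle_points_def orbit_def)
    have "beta c = act (g ** r) p"
      using g R_subset_L by (simp add: beta_bundle_class[OF matrix_group_R] L_invertible act_matrix_mul subset_iff)
    moreover have "g ** r \<in> L" using g R_subset_L L_mult by blast
    moreover have "c \<in> bundle_points L R (orbit_closure m R p)"
      using g orbit_subset_closure[of R] by (auto simp: bundle_points_def orbit_def)
    ultimately show "c \<in> {c \<in> bundle_points L R (orbit_closure m R p). beta c \<in> orbit L p}"
      by (auto simp: orbit_def)
  qed
  show "{c \<in> bundle_points L R (orbit_closure m R p). beta c \<in> orbit L p} \<subseteq> bundle_points L R (orbit R p)"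
  proof clarify
    fix c assume c: "c \<in> bundle_points L R (orbit_closure m R p)" and b: "beta c \<in> orbit L p"
    obtain g f where g: "g \<in> L" and f: "f \<in> orbit_closure m R p" and c: "c = bundle_class R (g, f)"
      using c by (auto simp: bundle_points_def)
    obtain l where l: "l \<in> L" "act g f = act l p"
      using b g by (auto simp: orbit_def c beta_bundle_class[OF matrix_group_R] L_invertible)
    \<comment> \<open>From g f = l p the fibre component is f = (g^-1 l) p: a point of the L-orbit
      inside the closure of the R-orbit.\<close>
    have "f = act (matrix_inv g) (act g f)" using g by (simp add: act_matrix_inv L_invertible)
    also have "\<dots> = act (matrix_inv g ** l) p"
      using g l by (simp add: act_matrix_mul L_invertible matrix_inv_matrix_inv)
    finally have f': "f = act (matrix_inv g ** l) p" .
    have "matrix_inv g ** l \<in> R"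
      using orbit_closure_R_inter_orbit[of "matrix_inv g ** l"] f f' g l L_mult L_inv by auto
    then show "c \<in> bundle_points L R (orbit R p)" using g f' by (auto simp: c bundle_points_def orbit_def)
  qed
qed

end

context padded_permanent
begin

section \<open>Local sections of the orbit map modulo R\<close>

text \<open>\<open>ann F\<close> is the space of traceless endomorphisms of \<open>S\<close> in the Lie algebra of the stabiliser
  of \<open>F\<close>.\<close>

definition ann :: "('m E \<Rightarrow> complex) \<Rightarrow> 'm End_E set" where
  "ann F = {B. (\<forall>a b. a \<notin> Sx \<or> b \<notin> Sx \<longrightarrow> B $ a $ b = 0) \<and> trace B = 0 \<and>
     (\<forall>X. dderiv F X (B *v X) = 0)}"

lemma annD:
  assumes "B \<in> ann F"
  shows "a \<notin> Sx \<or> b \<notin> Sx \<Longrightarrow> B $ a $ b = 0" "trace B = 0" "dderiv F X (B *v X) = 0"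
  using assms unfolding ann_def by blast+

text \<open>Infinitesimal stabilisers are conjugated along an orbit. The trace is invariant, and
  conjugation by an element of \<open>L\<close> keeps the block supported on
  \<open>Sx\<close>.\<close>

lemma ann_conj:
  assumes g: "g \<in> L" and B: "B \<in> ann F"
  shows "g ** B ** matrix_inv g \<in> ann (act g F)"
proof -
  have inv: "invertible g" using g by (rule L_invertible)
  have "(g ** B ** matrix_inv g) $ a $ b = 0" if "a \<notin> Sx \<or> b \<notin> Sx" for a b
  proof (cases "a \<in> Sx")
    case False
    have "(g ** B ** matrix_inv g) $ a $ b = (g ** (B ** matrix_inv g)) $ a $ b"
      by (simp add: matrix_mul_assoc)
    also have "\<dots> = (B ** matrix_inv g) $ a $ b"
      using g False by (simp add: L_entry matrix_matrix_mult_def of_bool_def if_distrib[of "\<lambda>c. c * _"] cong: if_cong)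
    also have "\<dots> = 0" using False by (simp add: matrix_matrix_mult_def annD(1)[OF B])
    finally show ?thesis .
  next
    case True
    then have "(g ** B ** matrix_inv g) $ a $ b = (g ** B) $ a $ b"
      using L_inv[OF g] that
      by (simp add: L_entry matrix_matrix_mult_def[of "g ** B"] of_bool_def if_distrib[of "\<lambda>c. _ * c"] cong: if_cong)
    also have "\<dots> = 0" using True that by (simp add: matrix_matrix_mult_def annD(1)[OF B])
    finally show ?thesis .
  qed
  moreover have "trace (g ** B ** matrix_inv g) = trace B"
    using trace_mul_sym[of "g ** B" "matrix_inv g"] by (simp add: matrix_mul_assoc matrix_mul_matrix_inv[OF inv])
  then have "trace (g ** B ** matrix_inv g) = 0" using annD(2)[OF B] by simp
  moreover have "dderiv (act g F) X (g ** B ** matrix_inv g *v X) = 0" for X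
  proof -
    have "matrix_inv g *v (g ** B ** matrix_inv g *v X) = (matrix_inv g ** g) *v (B *v (matrix_inv g *v X))"
      by (simp only: matrix_vector_mul_assoc matrix_mul_assoc)
    then have "matrix_inv g *v (g ** B ** matrix_inv g *v X) = B *v (matrix_inv g *v X)"
      by (simp add: matrix_mul_matrix_inv[OF inv])
    then show ?thesis unfolding dderiv_act using annD(3)[OF B] by simp
  qed
  ultimately show ?thesis unfolding ann_def by blast
qed

lemma sum_Sx:
  assumes "\<And>a. a \<notin> Sx \<Longrightarrow> f a = 0"
  shows "(\<Sum>a\<in>UNIV. f a) = f o1 + (\<Sum>i\<in>I. \<Sum>j\<in>I. f (e i, e j))"
proof -
  let ?h = "\<lambda>(i, j). (e i, e j)"
  have "inj_on ?h (I \<times> I)"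
    using e_eq_iff by (auto simp: inj_on_def)
  moreover have "o1 \<notin> ?h ` (I \<times> I)" using e_ne_o1 by force
  moreover have "(\<Sum>a\<in>UNIV. f a) = (\<Sum>a\<in>Sx. f a)"
    using assms by (intro sum.mono_neutral_right) auto
  ultimately show ?thesis
    by (simp add: Sx_def sum.reindex sum.cartesian_product case_prod_unfold)
qed

text \<open>At \<open>emb x Y\<close> the annihilation identity, divided by x^(k-1), is quadratic in
  x. Its leading coefficient says that the block part of B \<open>e11\<close> is a direction in
  which the derivative of the permanent vanishes identically, hence 0. Its linear coefficient says
  that the block of B acts on the permanent by the scalar - k \<alpha>, so that block has trace - n
  k \<alpha>. Thus the trace of B is \<alpha> (1 - n k), and tracelessness forces \<alpha> =
  0.\<close>

lemma ann_p_e11: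
  assumes B: "B \<in> ann p"
  shows "B *v e11 = 0"
proof -
  define \<alpha> where "\<alpha> = B $ o1 $ o1"
  define w where "w i j = B $ (e i, e j) $ o1" for i j
  define C where "C i j r l = B $ (e i, e j) $ (e r, e l)" for i j r l
  define \<mu> where "\<mu> Y = (\<Sum>r\<in>I. \<Sum>l\<in>I. B $ o1 $ (e r, e l) * Y r l)" for Y
  define CY where "CY Y i j = (\<Sum>r\<in>I. \<Sum>l\<in>I. C i j r l * Y r l)" for Y i j
  obtain k' where k: "k = Suc k'" using nm by (cases k) auto
  have BX: "(B *v emb x Y) $ a = B $ a $ o1 * x + (\<Sum>r\<in>I. \<Sum>l\<in>I. B $ a $ (e r, e l) * Y r l)" for a x Y
  proof -
    have "(B *v emb x Y) $ a = B $ a $ o1 * emb x Y $ o1 + (\<Sum>r\<in>I. \<Sum>l\<in>I. B $ a $ (e r, e l) * emb x Y $ (e r, e l))"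
      unfolding matrix_vector_mult_def vec_lambda_beta by (rule sum_Sx) (simp add: annD(1)[OF B])
    then show ?thesis by simp
  qed
  have eq: "x * (of_nat k * \<alpha> * permanent I Y + perm_deriv I Y (CY Y)) + of_nat k * \<mu> Y * permanent I Y
      + x * x * perm_deriv I Y w = 0" if "x \<noteq> 0" for x Y
  proof -
    have "perm_deriv I Y (\<lambda>i j. x * w i j + CY Y i j) = x * perm_deriv I Y w + perm_deriv I Y (CY Y)"
      by (simp add: perm_deriv_add perm_deriv_scale)
    then have "0 = of_nat k * x ^ k' * (\<alpha> * x + \<mu> Y) * permanent I Y +
        x * x ^ k' * (x * perm_deriv I Y w + perm_deriv I Y (CY Y))"
      using annD(3)[OF B, of "emb x Y"] unfolding dderiv_p_emb BX
      by (simp add: \<alpha>_def \<mu>_def w_def C_def CY_def[abs_def] k mult.commute)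
    then have "x ^ k' * (x * (of_nat k * \<alpha> * permanent I Y + perm_deriv I Y (CY Y)) + of_nat k * \<mu> Y * permanent I Y
      + x * x * perm_deriv I Y w) = 0" by (simp add: algebra_simps)
    then show ?thesis using that by simp
  qed
  have "perm_deriv I Y w = 0 \<and> perm_deriv I Y (CY Y) = - (of_nat k * \<alpha>) * permanent I Y" for Y
  proof -
    define s t u where "s = of_nat k * \<alpha> * permanent I Y + perm_deriv I Y (CY Y)"
      and "t = of_nat k * \<mu> Y * permanent I Y" and "u = perm_deriv I Y w"
    have "s + t + u = 0" "- s + t + u = 0" "2 * s + t + 4 * u = 0"
      using eq[of 1 Y] eq[of "-1" Y] eq[of 2 Y] by (simp_all add: s_def t_def u_def)
    \<comment> \<open>The values of t + s x + u x^2 at 1, -1 and 2 are combined so that only 2 s and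
      6 u remain.\<close>
    then have "(s + t + u) - (- s + t + u) = 0" "2 * (2 * s + t + 4 * u) - 3 * (s + t + u) + (- s + t + u) = 0" by simp_all
    then have "s = 0 \<and> u = 0" by (simp add: algebra_simps)
    then show ?thesis by (simp add: s_def u_def add_eq_0_iff2)
  qed
  then have w0: "\<And>Y. perm_deriv I Y w = 0"
    and C0: "\<And>Y. perm_deriv I Y (CY Y) = - (of_nat k * \<alpha>) * permanent I Y" by blast+
  have I: "finite I" "2 \<le> card I" using n2 card_I by auto
  have w: "w i j = 0" if "i \<in> I" "j \<in> I" for i j
    using exists_permanent_perm_deriv_nonzero[OF I(1) that I(2), of w] w0 by blast
  have "(\<Sum>i\<in>I. \<Sum>j\<in>I. C i j i j) = of_nat (card I) * (- (of_nat k * \<alpha>))"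
    by (rule trace_of_permanent_semi_invariant[OF I(1)]) (use C0 in \<open>simp add: CY_def[abs_def]\<close>)
  moreover have "trace B = \<alpha> + (\<Sum>i\<in>I. \<Sum>j\<in>I. C i j i j)"
    unfolding trace_def \<alpha>_def C_def by (rule sum_Sx) (simp add: annD(1)[OF B])
  ultimately have "\<alpha> + of_nat n * (- (of_nat k * \<alpha>)) = 0"
    using annD(2)[OF B] card_I by simp
  moreover have "\<alpha> * (1 - of_nat (n * q)) = \<alpha> + of_nat n * (- (of_nat q * \<alpha>))" for q
    by (simp add: algebra_simps)
  ultimately have "\<alpha> * (1 - of_nat (n * k)) = 0" by simp
  moreover have "n * k \<noteq> 1" using n2 by simp
  then have "1 - of_nat (n * k) \<noteq> (0 :: complex)" by (metis of_nat_1 of_nat_eq_iff right_minus_eq)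
  ultimately have "\<alpha> = 0" by simp
  have "B $ a $ o1 = 0" for a
  proof (cases "a \<in> Sx \<and> a \<noteq> o1")
    case True
    then obtain i j where "i \<in> I" "j \<in> I" "a = (e i, e j)" using Sx_cases by metis
    then show ?thesis using w by (simp add: w_def)
  next
    case False
    then show ?thesis using \<open>\<alpha> = 0\<close> annD(1)[OF B, of a o1] by (auto simp: \<alpha>_def)
  qed
  then show ?thesis by (simp add: e11_def matrix_vector_mult_axis column_def vec_eq_iff)
qed

text \<open>The weights make \<open>B0\<close> traceless and \<open>p\<close> invariant, without vanishing.\<close>

definition weight :: "'m \<times> 'm \<Rightarrow> complex" where
  "weight a = (if a \<notin> Sx \<or> a = o1 then 0 else if fst a = e m then - of_nat (n - 1) else 1)"

definition B0 :: "'m End_E" where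
  "B0 = (\<chi> a b. if a = b then weight a else 0)"

lemma B0_mult: "(B0 *v X) $ a = weight a * X $ a"
  by (simp add: B0_def matrix_vector_mult_def if_distrib[of "\<lambda>c. c * _"] cong: if_cong)

lemma weight_I: "i \<in> I \<Longrightarrow> j \<in> I \<Longrightarrow> weight (e i, e j) = (if i = m then - of_nat (n - 1) else 1)"
  using e_ne_o1[of i j] e_I[of i j] e_eq_iff[of i m] by (auto simp: weight_def)

lemma sum_weight: "(\<Sum>i\<in>I. if i = m then - of_nat (n - 1) else (1 :: complex)) = 0"
proof -
  have m: "m \<in> I" using n2 nm by auto
  have "(\<Sum>i\<in>I. if i = m then - of_nat (n - 1) else (1 :: complex)) = - of_nat (n - 1) + (\<Sum>i\<in>I - {m}. 1)"
    using m by (subst sum.remove[of _ m]) (auto intro!: sum.cong)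
  also have "\<dots> = 0" using m card_I by simp
  finally show ?thesis .
qed

text \<open>Every term of the permanent meets each row once, so scaling the rows infinitesimally
  multiplies it by the sum of the row weights. The trace is n times that same sum, which is
  0.\<close>

lemma B0_ann: "B0 \<in> ann p"
proof -
  have "trace B0 = weight o1 + (\<Sum>i\<in>I. \<Sum>j\<in>I. weight (e i, e j))"
    unfolding trace_def B0_def by (subst sum_Sx) (auto simp: weight_def)
  also have "(\<Sum>i\<in>I. \<Sum>j\<in>I. weight (e i, e j)) = of_nat n * (\<Sum>i\<in>I. if i = m then - of_nat (n - 1) else 1)"
    unfolding sum_distrib_left using card_I by (intro sum.cong refl) (simp add: weight_I)
  finally have "trace B0 = 0" unfolding sum_weight by (simp add: weight_def)
  moreover have "dderiv p X (B0 *v X) = 0" for X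
  proof -
    define t :: "nat \<Rightarrow> complex" where "t i = (if i = m then - of_nat (n - 1) else 1)" for i
    define M where "M i j = X $ (e i, e j)" for i j
    have "perm_deriv I M (\<lambda>i j. t i * M i j) = (\<Sum>\<sigma> | \<sigma> permutes I. \<Sum>i\<in>I. t i * (\<Prod>j\<in>I. M j (\<sigma> j)))"
      unfolding perm_deriv_def by (intro sum.cong refl) (simp add: prod.remove)
    also have "\<dots> = 0" using sum_weight by (simp add: t_def flip: sum_distrib_right)
    finally have "perm_deriv I M (\<lambda>i j. t i * M i j) = 0" .
    moreover have "perm_deriv I M (\<lambda>i j. (B0 *v X) $ (e i, e j)) = perm_deriv I M (\<lambda>i j. t i * M i j)"
      by (rule perm_deriv_cong) (simp_all add: B0_mult weight_I t_def M_def)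
    moreover have "(B0 *v X) $ o1 = 0" by (simp add: B0_mult weight_def)
    ultimately show ?thesis by (simp add: dderiv_p M_def[abs_def])
  qed
  ultimately show ?thesis by (auto simp: ann_def B0_def weight_def)
qed

section \<open>Annihilators as kernels of a linear system\<close>

text \<open>Endomorphisms become vectors, so that the conditions on them are rows to which
  \<open>constant_rank_section\<close> applies.\<close>

definition flat :: "'m End_E \<Rightarrow> complex ^ (('m \<times> 'm) \<times> ('m \<times> 'm))" where
  "flat B = (\<chi> ab. B $ fst ab $ snd ab)"

definition unflat :: "complex ^ (('m \<times> 'm) \<times> ('m \<times> 'm)) \<Rightarrow> 'm End_E" where
  "unflat b = (\<chi> i j. b $ (i, j))"

lemma unflat_flat [simp]: "unflat (flat B) = B" and flat_unflat [simp]: "flat (unflat b) = b"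
  by (simp_all add: flat_def unflat_def vec_eq_iff)

text \<open>Labels of the equations of \<open>ann F\<close>: one for each matrix position, required
  to vanish outside the block; one for the trace; and one for each point X of E, an infinite family
  and the only one that involves the form.\<close>

type_synonym 'a ann_row = "(('a \<times> 'a) \<times> ('a \<times> 'a)) + 'a E option"

definition ann_row :: "'m ann_row \<Rightarrow> ('m E \<Rightarrow> complex) \<Rightarrow> complex ^ (('m \<times> 'm) \<times> ('m \<times> 'm))" where
  "ann_row r F = (case r of
      Inl ab \<Rightarrow> if fst ab \<notin> Sx \<or> snd ab \<notin> Sx then axis ab 1 else 0
    | Inr None \<Rightarrow> (\<chi> ab. of_bool (fst ab = snd ab))
    | Inr (Some X) \<Rightarrow> (\<chi> ab. dderiv F X (axis (fst ab) 1) * X $ snd ab))"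

lemma ann_eq_rows:
  assumes F: "F \<in> forms m"
  shows "unflat b \<in> ann F \<longleftrightarrow> (\<forall>r. (\<Sum>j\<in>UNIV. ann_row r F $ j * b $ j) = 0)"
proof -
  have 1: "(\<Sum>j\<in>UNIV. ann_row (Inl ab) F $ j * b $ j) = (if fst ab \<notin> Sx \<or> snd ab \<notin> Sx then b $ ab else 0)" for ab
    by (simp add: ann_row_def axis_def if_distrib[of "\<lambda>c. c * _"] cong: if_cong)
  have pairs: "(\<Sum>j\<in>UNIV. f j) = (\<Sum>i\<in>UNIV. \<Sum>j\<in>UNIV. f (i, j))"
    for f :: "('m \<times> 'm) \<times> ('m \<times> 'm) \<Rightarrow> complex"
    by (simp add: sum.cartesian_product)
  have 2: "(\<Sum>j\<in>UNIV. ann_row (Inr None) F $ j * b $ j) = trace (unflat b)"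
    unfolding pairs
    by (simp add: ann_row_def trace_def unflat_def of_bool_def if_distrib[of "\<lambda>c. c * _"] cong: if_cong)
  have 3: "(\<Sum>j\<in>UNIV. ann_row (Inr (Some X)) F $ j * b $ j) = dderiv F X (unflat b *v X)" for X
    unfolding pairs dderiv_eq_sum[OF F, of X "unflat b *v X"]
    by (simp add: ann_row_def matrix_vector_mult_def unflat_def sum_distrib_left sum_distrib_right mult_ac)
  have "(\<forall>r. (\<Sum>j\<in>UNIV. ann_row r F $ j * b $ j) = 0) \<longleftrightarrow>
      (\<forall>ab. fst ab \<notin> Sx \<or> snd ab \<notin> Sx \<longrightarrow> b $ ab = 0) \<and> trace (unflat b) = 0 \<and>
      (\<forall>X. dderiv F X (unflat b *v X) = 0)"
  proof
    assume "\<forall>r. (\<Sum>j\<in>UNIV. ann_row r F $ j * b $ j) = 0"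
    then have "(\<Sum>j\<in>UNIV. ann_row (Inl ab) F $ j * b $ j) = 0" "(\<Sum>j\<in>UNIV. ann_row (Inr None) F $ j * b $ j) = 0"
      "(\<Sum>j\<in>UNIV. ann_row (Inr (Some X)) F $ j * b $ j) = 0" for ab X by blast+
    then show "(\<forall>ab. fst ab \<notin> Sx \<or> snd ab \<notin> Sx \<longrightarrow> b $ ab = 0) \<and> trace (unflat b) = 0 \<and>
      (\<forall>X. dderiv F X (unflat b *v X) = 0)" unfolding 1 2 3 by metis
  next
    assume *: "(\<forall>ab. fst ab \<notin> Sx \<or> snd ab \<notin> Sx \<longrightarrow> b $ ab = 0) \<and> trace (unflat b) = 0 \<and>
      (\<forall>X. dderiv F X (unflat b *v X) = 0)"
    show "\<forall>r. (\<Sum>j\<in>UNIV. ann_row r F $ j * b $ j) = 0"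
    proof
      fix r :: "'m ann_row"
      consider ab where "r = Inl ab" | "r = Inr None" | X where "r = Inr (Some X)"
        by (metis option.exhaust sum.exhaust)
      then show "(\<Sum>j\<in>UNIV. ann_row r F $ j * b $ j) = 0" using * by cases (simp_all add: 1 2 3)
    qed
  qed
  moreover have "(\<forall>ab. fst ab \<notin> Sx \<or> snd ab \<notin> Sx \<longrightarrow> b $ ab = 0) \<longleftrightarrow>
      (\<forall>a a'. a \<notin> Sx \<or> a' \<notin> Sx \<longrightarrow> unflat b $ a $ a' = 0)"
  proof (intro iffI allI impI)
    fix a a' assume *: "\<forall>ab. fst ab \<notin> Sx \<or> snd ab \<notin> Sx \<longrightarrow> b $ ab = 0" and "a \<notin> Sx \<or> a' \<notin> Sx"
    then show "unflat b $ a $ a' = 0" using *[rule_format, of "(a, a')"] by (simp add: unflat_def)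
  next
    fix ab assume *: "\<forall>a a'. a \<notin> Sx \<or> a' \<notin> Sx \<longrightarrow> unflat b $ a $ a' = 0" and "fst ab \<notin> Sx \<or> snd ab \<notin> Sx"
    then show "b $ ab = 0" using *[rule_format, of "fst ab" "snd ab"] by (simp add: unflat_def)
  qed
  ultimately show ?thesis unfolding ann_def by blast
qed

lemma ann_row_poly_funs: "(\<lambda>F. ann_row r F $ j) \<in> poly_funs (coords_forms m)"
proof -
  consider ab where "r = Inl ab" | "r = Inr None" | X where "r = Inr (Some X)"
    by (metis option.exhaust sum.exhaust)
  then show ?thesis
  proof cases
    case 3
    then show ?thesis
      by (simp add: ann_row_def poly_funs.mult poly_funs.const poly_funs.gen[OF dderiv_coords_forms])
  qed (simp_all add: ann_row_def poly_funs.const)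
qed

text \<open>Homogeneity of the orbit: conjugation by h = g g0^-1 embeds the annihilator at g0 p into
  the one at g p.\<close>

lemma ann_constant_rank:
  assumes g0: "g0 \<in> L" and F: "F \<in> orbit L p"
  shows "\<exists>T. Vector_Spaces.linear (*s) (*s) T \<and> inj T \<and> T ` {b. unflat b \<in> ann (act g0 p)} \<subseteq> {b. unflat b \<in> ann F}"
proof -
  obtain g where g: "g \<in> L" "F = act g p" using F by (auto simp: orbit_def)
  define h where "h = g ** matrix_inv g0"
  have h: "h \<in> L" using g g0 by (simp add: h_def L_mult L_inv)
  have inv: "invertible h" using h by (rule L_invertible)
  have F: "F = act h (act g0 p)"
    using g g0 by (simp add: h_def act_matrix_mul L_invertible matrix_inv_matrix_inv act_matrix_inv)
  define T where "T b = flat (h ** unflat b ** matrix_inv h)" for b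
  have "Vector_Spaces.linear (*s) (*s) T"
    unfolding Vector_Spaces.linear_iff
  proof (intro conjI allI vec.vector_space_axioms)
    show "T (a + b) = T a + T b" for a b
      by (simp add: T_def flat_def unflat_def matrix_matrix_mult_def vec_eq_iff distrib_left distrib_right sum.distrib)
    show "T (c *s b) = c *s T b" for c b
      by (simp add: T_def flat_def unflat_def matrix_matrix_mult_def vec_eq_iff sum_distrib_left sum_distrib_right mult_ac)
  qed
  moreover have "inj T"
  proof (rule injI)
    fix a b assume "T a = T b"
    then have "unflat (T a) = unflat (T b)" by simp
    then have "h ** unflat a ** matrix_inv h = h ** unflat b ** matrix_inv h" by (simp add: T_def)
    then have "matrix_inv h ** (h ** unflat a ** matrix_inv h) ** h = matrix_inv h ** (h ** unflat b ** matrix_inv h) ** h" by simp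
    moreover have "matrix_inv h ** (h ** C ** matrix_inv h) ** h = C" for C
    proof -
      have "matrix_inv h ** (h ** C ** matrix_inv h) ** h = (matrix_inv h ** h) ** C ** (matrix_inv h ** h)"
        by (simp only: matrix_mul_assoc)
      then show ?thesis by (simp add: matrix_mul_matrix_inv[OF inv])
    qed
    ultimately have "unflat a = unflat b" by simp
    then show "a = b" by (metis flat_unflat)
  qed
  moreover have "T ` {b. unflat b \<in> ann (act g0 p)} \<subseteq> {b. unflat b \<in> ann F}"
    using ann_conj[OF h] by (auto simp: T_def F)
  ultimately show ?thesis by blast
qed

text \<open>The prescribed value is the conjugate of \<open>B0\<close>, whose kernel inside S is
  exactly the line through g0 \<open>e11\<close>. It is a value, not a generic element, that has to
  be extended, so the section must pass through it.\<close>

lemma local_ann_section: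
  assumes g0: "g0 \<in> L"
  obtains U B where "openin (zariski (coords_forms m) (orbit L p)) U" "act g0 p \<in> U"
    "\<And>F. F \<in> U \<Longrightarrow> B F \<in> ann F" "B (act g0 p) = g0 ** B0 ** matrix_inv g0"
    "\<And>i j. (\<lambda>F. B F $ i $ j) \<in> reg (coords_forms m) (orbit L p) U"
proof -
  let ?V = "orbit L p" and ?C = "coords_forms m" and ?F0 = "act g0 p"
  have V: "openin (zariski ?C ?V) ?V" using openin_topspace[of "zariski ?C ?V"] by simp
  have F0: "?F0 \<in> ?V" using g0 by (auto simp: orbit_def)
  define a0 where "a0 = flat (g0 ** B0 ** matrix_inv g0)"
  have a0: "a0 \<in> {b. unflat b \<in> ann ?F0}" using ann_conj[OF g0 B0_ann] by (simp add: a0_def)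
  obtain Q where Q: "\<And>i. (\<exists>r. \<forall>F. Q F $ i = ann_row r F) \<or> (\<exists>v. \<forall>F. Q F $ i = v)"
    and det0: "det (Q ?F0) \<noteq> 0"
    and sec: "\<And>F. F \<in> ?V \<Longrightarrow> det (Q F) \<noteq> 0 \<Longrightarrow> matrix_inv (Q F) *v (Q ?F0 *v a0) \<in> {b. unflat b \<in> ann F}"
  proof (rule constant_rank_section[of ?V "\<lambda>F. {b. unflat b \<in> ann F}" ann_row ?F0 a0])
    show "{b. unflat b \<in> ann F} = {a. \<forall>r. (\<Sum>j\<in>UNIV. ann_row r F $ j * a $ j) = 0}" if "F \<in> ?V" for F
      using ann_eq_rows that orbit_forms by blast
    show "\<exists>T. Vector_Spaces.linear (*s) (*s) T \<and> inj T \<and>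
        T ` {b. unflat b \<in> ann ?F0} \<subseteq> {b. unflat b \<in> ann F}" if "F \<in> ?V" for F
      by (rule ann_constant_rank[OF g0 that])
  qed (use F0 a0 in blast)+
  have Qreg: "(\<lambda>F. Q F $ i $ j) \<in> reg ?C ?V ?V" for i j
  proof (rule reg_poly_funs[OF V])
    from Q[of i] show "(\<lambda>F. Q F $ i $ j) \<in> poly_funs ?C"
      by (elim disjE exE) (simp_all only: ann_row_poly_funs poly_funs.const)
  qed
  define U where "U = {F \<in> ?V. det (Q F) \<noteq> 0}"
  have U: "openin (zariski ?C ?V) U" unfolding U_def by (intro openin_reg_nonzero V reg_det Qreg)
  define B where "B F = unflat (matrix_inv (Q F) *v (Q ?F0 *v a0))" for F
  show ?thesis
  proof (rule that[OF U])
    show "?F0 \<in> U" using F0 det0 by (simp add: U_def)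
    show "B F \<in> ann F" if "F \<in> U" for F using sec[of F] that by (simp add: U_def B_def)
    show "B ?F0 = g0 ** B0 ** matrix_inv g0"
      using det0 by (simp add: B_def a0_def matrix_vector_mul_assoc matrix_mul_matrix_inv flip: invertible_det_nz)
    fix i j
    have "(\<lambda>F. matrix_inv (Q F) $ a $ b) \<in> reg ?C ?V U" for a b
      by (intro reg_matrix_inv[OF U] reg_restrict[OF Qreg U]) (auto simp: U_def)
    then have "(\<lambda>F. (matrix_inv (Q F) *v (Q ?F0 *v a0)) $ a) \<in> reg ?C ?V U" for a
      by (intro reg_matrix_vector_mult[OF U] reg_const[OF U])
    then show "(\<lambda>F. B F $ i $ j) \<in> reg ?C ?V U" by (simp add: B_def unflat_def)
  qed
qed

text \<open>\<open>N F\<close> agrees with \<open>B F\<close> on the line to be found up to a multiple of \<open>z0\<close>, and it is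
  invertible, so this line is spanned by the preimage of \<open>z0\<close>.\<close>

lemma local_line_section:
  assumes g0: "g0 \<in> L"
  obtains U u where "openin (zariski (coords_forms m) (orbit L p)) U" "act g0 p \<in> U"
    "u (act g0 p) = g0 *v e11"
    "\<And>g. g \<in> L \<Longrightarrow> act g p \<in> U \<Longrightarrow> \<exists>c. c \<noteq> 0 \<and> u (act g p) = c *s (g *v e11)"
    "\<And>i. (\<lambda>F. u F $ i) \<in> reg (coords_forms m) (orbit L p) U"
proof -
  let ?V = "orbit L p" and ?C = "coords_forms m" and ?F0 = "act g0 p"
  obtain U1 B where U1: "openin (zariski ?C ?V) U1" "?F0 \<in> U1"
    and B: "\<And>F. F \<in> U1 \<Longrightarrow> B F \<in> ann F" "B ?F0 = g0 ** B0 ** matrix_inv g0"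
    and Breg: "\<And>i j. (\<lambda>F. B F $ i $ j) \<in> reg ?C ?V U1" using local_ann_section[OF g0] by blast
  have inv0: "invertible g0" using g0 by (rule L_invertible)
  define z0 where "z0 = g0 *v e11"
  \<comment> \<open>The \<open>e11\<close>-coordinate after applying g0^-1; it takes the value 1 at
    \<open>z0\<close>.\<close>
  define \<phi> where "\<phi> X = (matrix_inv g0 *v X) $ o1" for X
  define perp :: "'m E \<Rightarrow> 'm E" where "perp X = (\<chi> i. if i \<in> Sx then 0 else X $ i)" for X
  \<comment> \<open>\<open>B F\<close> is corrected by the rank one map z0 \<phi> and by the
    projection to the complement of S along S. At the base point these terms fill exactly the kernel
    of \<open>B F\<close>.\<close>
  define N where "N F = (\<chi> i j. B F $ i $ j + (z0 $ i * matrix_inv g0 $ o1 $ j + of_bool (i = j \<and> i \<notin> Sx)))" for F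
  have N: "N F *v X = B F *v X + (\<phi> X *s z0 + perp X)" for F X
  proof -
    have "(N F *v X) $ i = (B F *v X + (\<phi> X *s z0 + perp X)) $ i" for i
    proof -
      have "(N F *v X) $ i = (\<Sum>j\<in>UNIV. B F $ i $ j * X $ j) +
          (z0 $ i * (\<Sum>j\<in>UNIV. matrix_inv g0 $ o1 $ j * X $ j) + (\<Sum>j\<in>UNIV. of_bool (i = j \<and> i \<notin> Sx) * X $ j))"
        by (simp only: N_def matrix_vector_mult_def vec_lambda_beta distrib_right sum.distrib
            sum_distrib_left mult.assoc)
      also have "(\<Sum>j\<in>UNIV. of_bool (i = j \<and> i \<notin> Sx) * X $ j) = perp X $ i"
        by (cases "i \<in> Sx") (simp_all add: perp_def of_bool_def if_distrib[of "\<lambda>c. c * _"] cong: if_cong)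
      finally show ?thesis by (simp add: \<phi>_def matrix_vector_mult_def mult.commute)
    qed
    then show ?thesis by (simp add: vec_eq_iff)
  qed
  \<comment> \<open>In the coordinates Y = g0^-1 X the map is diagonal, with the weights on the
    block and 1 at all other positions.\<close>
  have "det (N ?F0) \<noteq> 0"
  proof -
    have "X = 0" if X: "N ?F0 *v X = 0" for X
    proof -
      define Y where "Y = matrix_inv g0 *v X"
      have XY: "X = g0 *v Y" by (simp add: Y_def matrix_vector_mul_assoc matrix_mul_matrix_inv[OF inv0])
      have "perp X = perp Y" using L_row[OF g0] by (simp add: XY perp_def vec_eq_iff)
      moreover have "g0 *v perp Y = perp Y"
        using g0 unfolding LP2_def S_perp_eq by (simp add: perp_def)
      moreover have "B ?F0 *v X = g0 *v (B0 *v Y)"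
        by (simp add: B Y_def matrix_vector_mul_assoc matrix_mul_assoc)
      ultimately have "g0 *v (B0 *v Y + (Y $ o1 *s e11 + perp Y)) = 0"
        using X by (simp add: N \<phi>_def Y_def[symmetric] z0_def matrix_vector_right_distrib vector_scalar_commute)
      then have 0: "B0 *v Y + (Y $ o1 *s e11 + perp Y) = 0"
        using matrix_left_invertible_ker[of g0] inv0 unfolding invertible_def by blast
      have "Y $ a = 0" for a
      proof -
        have "weight a * Y $ a + (Y $ o1 * e11 $ a + perp Y $ a) = 0"
          using arg_cong[OF 0, of "\<lambda>Z. Z $ a"] by (simp add: B0_mult)
        moreover have "weight a \<noteq> 0" if "a \<in> Sx" "a \<noteq> o1" using that n2 by (simp add: weight_def)
        ultimately show ?thesis
          using o1_Sx by (cases "a = o1"; cases "a \<in> Sx") (auto simp: e11_def axis_def perp_def weight_def)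
      qed
      then show "X = 0" by (simp add: XY vec_eq_iff matrix_vector_mult_def)
    qed
    then show ?thesis
      using matrix_left_invertible_ker[of "N ?F0"]
      by (simp add: invertible_left_inverse flip: invertible_det_nz)
  qed
  define U where "U = {F \<in> U1. det (N F) \<noteq> 0}"
  have Nreg: "(\<lambda>F. N F $ i $ j) \<in> reg ?C ?V U1" for i j
    unfolding N_def using reg_add[OF Breg reg_const[OF U1(1)]] by simp
  have U: "openin (zariski ?C ?V) U" unfolding U_def by (intro openin_reg_nonzero U1 reg_det Nreg)
  have sub: "U \<subseteq> U1" by (auto simp: U_def)
  define u where "u F = matrix_inv (N F) *v z0" for F
  have F0: "?F0 \<in> U" using U1 \<open>det (N ?F0) \<noteq> 0\<close> by (simp add: U_def)
  have u: "\<phi> (g *v e11) \<noteq> 0 \<and> u (act g p) = (1 / \<phi> (g *v e11)) *s (g *v e11)"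
    if g: "g \<in> L" and gU: "act g p \<in> U" for g
  proof -
    let ?F = "act g p" and ?x = "g *v e11"
    have inv: "invertible g" using g by (rule L_invertible)
    have cancel: "matrix_inv g *v (g *v X) = X" for X
      by (simp add: matrix_vector_mul_assoc matrix_mul_matrix_inv[OF inv])
    have detN: "invertible (N ?F)" using gU by (simp add: U_def invertible_det_nz)
    have "B ?F \<in> ann ?F" using B(1) gU sub by blast
    then have "matrix_inv g ** B ?F ** matrix_inv (matrix_inv g) \<in> ann (act (matrix_inv g) ?F)"
      by (rule ann_conj[OF L_inv[OF g]])
    then have "matrix_inv g ** B ?F ** g \<in> ann p"
      by (simp add: act_matrix_inv[OF inv] matrix_inv_matrix_inv[OF inv])
    then have "matrix_inv g ** B ?F ** g *v e11 = 0" by (rule ann_p_e11)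
    then have "g *v (matrix_inv g ** B ?F ** g *v e11) = 0" by (simp add: matrix_vector_mult_def vec_eq_iff)
    moreover have "g *v (matrix_inv g ** B ?F ** g *v e11) = (g ** matrix_inv g) *v (B ?F *v ?x)"
      by (simp only: matrix_vector_mul_assoc matrix_mul_assoc)
    ultimately have "B ?F *v ?x = 0" by (simp add: matrix_mul_matrix_inv[OF inv])
    moreover have "perp ?x = 0"
      using L_row[OF g, of _ e11] o1_Sx by (auto simp: perp_def vec_eq_iff e11_def axis_def)
    ultimately have Nx: "N ?F *v ?x = \<phi> ?x *s z0" by (simp add: N)
    then have ux: "\<phi> ?x *s u ?F = ?x"
    proof -
      have "matrix_inv (N ?F) *v (N ?F *v ?x) = ?x"
        by (rule matrix_inv_cancel(1)[OF detN])
      then show ?thesis unfolding Nx by (simp add: u_def vector_scalar_commute)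
    qed
    have "?x \<noteq> 0"
    proof
      assume "?x = 0"
      then have "e11 = 0" using cancel[of e11] by simp
      then show False by (simp add: e11_def axis_eq_0_iff)
    qed
    \<comment> \<open>Invertibility of \<open>N\<close> rules out \<phi> = 0, so no further
      shrinking of \<open>U\<close> is needed.\<close>
    with ux have ne: "\<phi> ?x \<noteq> 0" by auto
    have "(1 / \<phi> ?x) *s (\<phi> ?x *s u ?F) = u ?F" using ne by simp
    then show ?thesis using ne unfolding ux by simp
  qed
  show ?thesis
  proof (rule that[OF U F0])
    have "\<phi> (g0 *v e11) = 1"
      by (simp add: \<phi>_def matrix_vector_mul_assoc matrix_mul_matrix_inv[OF inv0] e11_def)
    then show "u ?F0 = g0 *v e11" using u[OF g0 F0] by simp
    show "\<exists>c. c \<noteq> 0 \<and> u (act g p) = c *s (g *v e11)" if "g \<in> L" "act g p \<in> U" for g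
      using u[OF that] by (intro exI[of _ "1 / \<phi> (g *v e11)"]) simp
    show "(\<lambda>F. u F $ i) \<in> reg ?C ?V U" for i
      unfolding u_def
      by (intro reg_matrix_vector_mult[OF U] reg_matrix_inv[OF U] reg_restrict[OF Nreg U sub] reg_const[OF U])
        (simp add: U_def)
  qed
qed

section \<open>The inverse morphism\<close>

definition orbit_to_bundle :: "('m E \<Rightarrow> complex) \<Rightarrow> ('m End_E \<times> ('m E \<Rightarrow> complex)) set" where
  "orbit_to_bundle F = bundle_class R (SOME g. g \<in> L \<and> act g p = F, p)"

text \<open>Two choices of group element differ by a stabiliser of \<open>p\<close>. It lies in
  \<open>R\<close>, so it can be moved across the class, where it fixes \<open>p\<close>.\<close>

lemma orbit_to_bundle_act:
  assumes g: "g \<in> L"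
  shows "orbit_to_bundle (act g p) = bundle_class R (g, p)"
proof -
  define h where "h = (SOME h. h \<in> L \<and> act h p = act g p)"
  have h: "h \<in> L" "act h p = act g p"
    using someI[of "\<lambda>h. h \<in> L \<and> act h p = act g p" g] g by (simp_all add: h_def)
  define t where "t = matrix_inv h ** g"
  have t: "t \<in> L" using g h by (simp add: t_def L_mult L_inv)
  have "act t p = act (matrix_inv h) (act g p)"
    using g h by (simp add: t_def act_matrix_mul L_invertible matrix_inv_matrix_inv)
  also have "\<dots> = p" unfolding h(2)[symmetric] by (rule act_matrix_inv[OF L_invertible[OF h(1)]])
  finally have tp: "act t p = p" .
  then have "t \<in> R" using t by (rule stabilizer_subset_R[rotated])
  moreover have "h ** t = g"
    using h by (simp add: t_def matrix_mul_assoc matrix_mul_matrix_inv L_invertible)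
  ultimately have "bundle_class R (g, p) = bundle_class R (h, p)"
    using bundle_class_eq[OF matrix_group_R L_invertible[OF h(1)], of t p] tp by simp
  then show ?thesis by (simp add: orbit_to_bundle_def h_def)
qed

lemma morphism_orbit_to_bundle:
  "morphism (forms_variety m (orbit L p)) (assoc_bundle m L R (orbit R p)) orbit_to_bundle"
proof (rule morphism_assoc_bundleI)
  let ?V = "orbit L p" and ?C = "coords_forms m"
  fix F0 assume "F0 \<in> ?V"
  then obtain g0 where g0: "g0 \<in> L" and F0: "F0 = act g0 p" by (auto simp: orbit_def)
  obtain U2 u where U2: "openin (zariski ?C ?V) U2" "F0 \<in> U2" and u0: "u F0 = g0 *v e11"
    and u: "\<And>g. g \<in> L \<Longrightarrow> act g p \<in> U2 \<Longrightarrow> \<exists>c. c \<noteq> 0 \<and> u (act g p) = c *s (g *v e11)"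
    and ureg: "\<And>i. (\<lambda>F. u F $ i) \<in> reg ?C ?V U2"
    using local_line_section[OF g0] unfolding F0 by blast
  \<comment> \<open>The lift of F: \<open>g0\<close> with its \<open>e11\<close>-column replaced by
    the regular vector on the line. At the base point it is \<open>g0\<close> itself, hence
    invertible nearby.\<close>
  define s where "s F = (\<chi> i j. if j = o1 then u F $ i else g0 $ i $ j)" for F
  have sreg2: "(\<lambda>F. s F $ i $ j) \<in> reg ?C ?V U2" for i j
    unfolding s_def using ureg reg_const[OF U2(1)] by (cases "j = o1") simp_all
  define U where "U = {F \<in> U2. det (s F) \<noteq> 0}"
  have U: "openin (zariski ?C ?V) U" unfolding U_def by (intro openin_reg_nonzero U2 reg_det sreg2)
  have sreg: "(\<lambda>F. s F $ i $ j) \<in> reg ?C ?V U" for i j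
    by (rule reg_restrict[OF sreg2 U]) (auto simp: U_def)
  have "s F0 = g0"
    unfolding s_def u0 e11_def matrix_vector_mult_axis by (auto simp: column_def vec_eq_iff)
  then have F0U: "F0 \<in> U" using U2 L_invertible[OF g0] by (simp add: U_def invertible_det_nz)
  define \<sigma> where "\<sigma> F = (s F, act (matrix_inv (s F)) F)" for F
  have UV: "U \<subseteq> ?V" using openin_subset[OF U] by simp
  have \<sigma>: "\<sigma> F \<in> L \<times> orbit R p \<and> orbit_to_bundle F = bundle_class R (\<sigma> F)" if F: "F \<in> U" for F
  proof -
    obtain g where g: "g \<in> L" and Fg: "F = act g p" using F UV by (auto simp: orbit_def)
    obtain c where c: "c \<noteq> 0" "u F = c *s (g *v e11)" using u[OF g] F by (auto simp: U_def Fg)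
    have inv: "invertible (s F)" using F by (simp add: U_def invertible_det_nz)
    have ua: "u F $ a = 0" if "a \<notin> Sx" for a
      using L_row[OF g that, of e11] that o1_Sx by (auto simp: c e11_def axis_def)
    have "s F $ a $ b = of_bool (a = b)" if "a \<notin> Sx \<or> b \<notin> Sx" for a b
      using that o1_Sx ua[of a] L_entry[OF g0 that] by (auto simp: s_def)
    then have sL: "s F \<in> L" using inv unfolding L_iff by blast
    \<comment> \<open>Both s F and g send \<open>e11\<close> to the same line, so they differ by an
      element of \<open>R\<close> and define the same class.\<close>
    define t where "t = matrix_inv (s F) ** g"
    have t: "t \<in> L" using g sL by (simp add: t_def L_mult L_inv)
    have se: "s F *v e11 = u F"
      unfolding e11_def matrix_vector_mult_axis by (simp add: column_def s_def)
    have "c *s (t *v e11) = matrix_inv (s F) *v (s F *v e11)"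
      by (simp add: t_def se c vector_scalar_commute matrix_vector_mul_assoc)
    also have "\<dots> = e11" by (rule matrix_inv_cancel(1)[OF inv])
    finally have "(1 / c) *s (c *s (t *v e11)) = (1 / c) *s e11" by simp
    then have "t *v e11 = (1 / c) *s e11" using c by simp
    then have tR: "t \<in> R" using t unfolding R_iff by blast
    have tp: "act (matrix_inv (s F)) F = act t p"
      using inv g by (simp add: t_def Fg act_matrix_mul L_invertible matrix_inv_matrix_inv)
    have "s F ** t = g" by (simp add: t_def matrix_mul_assoc matrix_mul_matrix_inv[OF inv])
    then have "bundle_class R (g, p) = bundle_class R (\<sigma> F)"
      using bundle_class_eq[OF matrix_group_R inv tR, of p] by (simp add: \<sigma>_def tp)
    moreover have "orbit_to_bundle F = bundle_class R (g, p)" unfolding Fg by (rule orbit_to_bundle_act[OF g])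
    moreover have "act (matrix_inv (s F)) F \<in> orbit R p" unfolding tp orbit_def using tR by blast
    ultimately show ?thesis using sL by (simp add: \<sigma>_def)
  qed
  have "\<forall>c\<in>bundle_coords m. (\<lambda>F. c (\<sigma> F)) \<in> reg ?C ?V U"
  proof
    fix c :: "'m End_E \<times> ('m E \<Rightarrow> complex) \<Rightarrow> complex"
    assume "c \<in> bundle_coords m"
    then show "(\<lambda>F. c (\<sigma> F)) \<in> reg ?C ?V U"
    proof
      assume "c \<in> (\<lambda>c. c \<circ> fst) ` coords_End"
      then obtain i j where "c = (\<lambda>x. fst x $ i $ j)" by (auto simp: coords_End_def o_def)
      then show ?thesis using sreg by (simp add: \<sigma>_def)
    next
      assume "c \<in> (\<lambda>c. c \<circ> snd) ` coords_forms m"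
      then obtain l where l: "l \<in> ?C" "c = (\<lambda>x. l (snd x))" by (auto simp: o_def)
      define G where "G F = (if F \<in> U then F else (\<lambda>X. 0))" for F :: "'m E \<Rightarrow> complex"
      have G: "G F \<in> forms m" for F using UV orbit_forms zero_forms by (auto simp: G_def)
      \<comment> \<open>Acting by the inverse of s F substitutes s F itself, so the second component
        of the lift is regular without inverting the matrix.\<close>
      have "(\<lambda>F. l (\<lambda>X. G F (s F *v X))) \<in> reg ?C ?V U"
      proof (rule reg_form_comp[OF U G _ sreg l(1)])
        fix l' :: "('m E \<Rightarrow> complex) \<Rightarrow> complex" assume "l' \<in> ?C"
        then have "l' \<in> reg ?C ?V U" by (intro reg_poly_funs[OF U] poly_funs.gen)
        then show "(\<lambda>F. l' (G F)) \<in> reg ?C ?V U" by (subst reg_cong[of _ _ l']) (auto simp: G_def)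
      qed
      moreover have "l (\<lambda>X. G F (s F *v X)) = c (\<sigma> F)" if "F \<in> U" for F
        using that by (simp add: l(2) \<sigma>_def G_def act_def U_def matrix_inv_matrix_inv invertible_det_nz)
      ultimately show ?thesis using reg_cong[of U "\<lambda>F. c (\<sigma> F)" "\<lambda>F. l (\<lambda>X. G F (s F *v X))"] by simp
    qed
  qed
  then show "\<exists>U \<sigma>. openin (zariski ?C ?V) U \<and> F0 \<in> U \<and>
      (\<forall>F\<in>U. \<sigma> F \<in> L \<times> orbit R p \<and> orbit_to_bundle F = bundle_class R (\<sigma> F)) \<and>
      (\<forall>c\<in>bundle_coords m. (\<lambda>F. c (\<sigma> F)) \<in> reg ?C ?V U)"
    using U F0U \<sigma> by (intro exI[of _ U] exI[of _ \<sigma>] conjI ballI) simp_all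
qed

lemma biregular_iso_beta:
  "biregular_iso (assoc_bundle m L R (orbit R p)) (forms_variety m (orbit L p)) beta"
  unfolding biregular_iso_def
proof (intro conjI exI ballI)
  show "morphism (assoc_bundle m L R (orbit R p)) (forms_variety m (orbit L p)) beta"
  proof (rule morphism_beta[OF matrix_group_R L_invertible orbit_forms])
    fix g f assume g: "g \<in> L" and "f \<in> orbit R p"
    then obtain r where r: "r \<in> R" "f = act r p" by (auto simp: orbit_def)
    then have "act g f = act (g ** r) p" using g R_subset_L L_invertible by (simp add: act_matrix_mul subset_iff)
    then show "act g f \<in> orbit L p" using g r R_subset_L L_mult by (auto simp: orbit_def)
  qed
  show "morphism (forms_variety m (orbit L p)) (assoc_bundle m L R (orbit R p)) orbit_to_bundle"
    by (rule morphism_orbit_to_bundle)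
next
  fix c assume "c \<in> topspace (topol (assoc_bundle m L R (orbit R p)))"
  then obtain g r where g: "g \<in> L" and r: "r \<in> R" and c: "c = bundle_class R (g, act r p)"
    unfolding topspace_assoc_bundle by (auto simp: bundle_points_def orbit_def)
  have rL: "r \<in> L" using r R_subset_L by blast
  have "c = bundle_class R (g ** r, p)" by (simp add: c bundle_class_eq[OF matrix_group_R L_invertible[OF g] r])
  moreover from this have "beta c = act (g ** r) p"
    using L_mult[OF g rL] by (simp add: beta_bundle_class[OF matrix_group_R] L_invertible)
  ultimately show "orbit_to_bundle (beta c) = c" using orbit_to_bundle_act[OF L_mult[OF g rL]] by simp
next
  fix F assume "F \<in> topspace (topol (forms_variety m (orbit L p)))"
  then obtain g where g: "g \<in> L" and F: "F = act g p" by (auto simp: orbit_def)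
  show "beta (orbit_to_bundle F) = F"
    using g by (simp add: F orbit_to_bundle_act beta_bundle_class[OF matrix_group_R] L_invertible)
qed

end

theorem lemma6p2:
  fixes e :: "nat \<Rightarrow> 'm::finite" and m n :: nat
  assumes "bij_betw e {1..m} (UNIV :: 'm set)"
    and "3 \<le> n" and "n < m"
  shows "let p = padded_perm e m n; L = LP2 e m n; R = R_LP2 e m n in
      morphism (assoc_bundle m L R (orbit_closure m R p)) (forms_variety m (orbit_closure m L p)) beta \<and>
      {c \<in> bundle_points L R (orbit_closure m R p). beta c \<in> orbit L p}
        = bundle_points L R (orbit R p) \<and>
      biregular_iso (assoc_bundle m L R (orbit R p)) (forms_variety m (orbit L p)) beta"
proof -
  interpret padded_permanent e m n
    using assms by unfold_locales auto
  have "morphism (assoc_bundle m L R (orbit_closure m R p)) (forms_variety m (orbit_closure m L p)) beta"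
    by (rule morphism_beta[OF matrix_group_R L_invertible orbit_closure_forms act_orbit_closure])
  then show ?thesis
    using preimage_orbit biregular_iso_beta by (simp add: Let_def)
qed

end
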